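(* Let $A$ and $B$ be two $0$-cells in a $\mathcal V$-enriched bicategory $\mathcal B$, and $p:A\to B$, $q:B\to A$ two $1$-cells. Consider $Q={}^B\mathrm{Hom}_2^A(q,q)$, $P={}^A\mathrm{Hom}_2^B(p,p)^{\mathrm{op}}$, $N={}^B\mathrm{Hom}_2^B(B,q\bullet_A p)$ and $M={}^A\mathrm{Hom}_2^A(p\bullet_B q,A)$. Then: (1) $Q$ and $P$ are $0$-cells in $\mathrm{Bim}(\mathcal V)$; (2) $N$ is a $1$-cell from $Q$ to $P$; (3) $M$ is a $1$-cell from $P$ to $Q$; (4) there exist two maps $\triangledown:N\otimes_P M\to Q$ and $\blacktriangledown:M\otimes_Q N\to P$; (5) $\mathbb M(p,q)=(Q,P,N,M,\triangledown,\blacktriangledown)$ is a Morita context in $\mathrm{Bim}(\mathcal V)$.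
   Context: $\mathcal V$ is a monoidal category with coequalizers, i.e. it possesses coequalizers and its tensor product preserves them. A $\mathcal V$-enriched bicategory has $0$-cells $A,B,\dots$; for each pair a $\mathcal V$-enriched category $\mathrm{Hom}(A,B)$ whose objects are the $1$-cells $A\to B$ and whose hom-objects ${}^A\mathrm{Hom}_2^B(f,g)\in\mathcal V$ consist of the $2$-cells $f\to g$, with (vertical) composition $\circ$. Composition of $1$-cells is written in diagrammatic order: for $f:A\to B$, $g:B\to C$, $f\bullet_B g:A\to C$; horizontal composition of $2$-cells is denoted $\underline\bullet_B$. The identity $1$-cell on $A$ is denoted $A$, and an object also denotes its identity morphism. The superscript $\mathrm{op}$ denotes the opposite of the multiplication given by vertical composition. $\mathrm{Bim}(\mathcal V)$ is the ($\mathcal V$-enriched) bicategory whose $0$-cells are algebras in $\mathcal V$, $1$-cells are bimodules between those algebras (a $1$-cell from $R$ to $S$ is an $R$-$S$-bimodule), $2$-cells are bimodule maps, and in which the composition of an $R$-$S$-bimodule $X$ and an $S$-$T$-bimodule $Y$ is $X\otimes_S Y$, the coequalizer of the two maps $X\otimes S\otimes Y\rightrightarrows X\otimes Y$ given by the actions. A Morita context in a bicategory is $(A,B,p,q,\mu,\tau)$ with $0$-cells $A,B$, $1$-cells $p:A\to B$, $q:B\to A$, and $2$-cells $\mu:p\bullet_B q\to A$ and $\tau:q\bullet_A p\to B$ such that $q\,\underline\bullet_A\,\mu=\tau\,\underline\bullet_B\,q$ and $p\,\underline\bullet_B\,\tau=\mu\,\underline\bullet_A\,p$.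
   Formalization: The monoidal category V is taken to be braided (symmetric included), since the opposite algebra P and the interchange law for horizontal composition are undefined otherwise; interchange uses the braiding, while the opposite, the actions and the first pairing use its inverse. *)

theory Defs
  imports Main
begin

section \<open>Monoidal categories\<close>

text \<open>Composition is written in applicative order: \<open>g \<cdot> f\<close> is \<open>f\<close> followed by \<open>g\<close>.\<close>

record ('o, 'm) category =
  Obj :: "'o set"
  Arr :: "'m set"
  Dom :: "'m \<Rightarrow> 'o"
  Cod :: "'m \<Rightarrow> 'o"
  Idn :: "'o \<Rightarrow> 'm"
  Cmp :: "'m \<Rightarrow> 'm \<Rightarrow> 'm"  (infixr "\<cdot>\<index>" 55)

context
  fixes V :: "('o, 'm, 'z) category_scheme" (structure)
begin

definition hom :: "'o \<Rightarrow> 'o \<Rightarrow> 'm set" where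
  "hom x y = {f \<in> Arr V. Dom V f = x \<and> Cod V f = y}"

definition is_inverse :: "'m \<Rightarrow> 'm \<Rightarrow> bool" where
  "is_inverse f g \<longleftrightarrow>
     f \<in> Arr V \<and> g \<in> hom (Cod V f) (Dom V f) \<and>
     g \<cdot> f = Idn V (Dom V f) \<and> f \<cdot> g = Idn V (Cod V f)"

definition is_iso :: "'m \<Rightarrow> bool" where
  "is_iso f \<longleftrightarrow> (\<exists>g. is_inverse f g)"

definition iso_inv :: "'m \<Rightarrow> 'm" where
  "iso_inv f = (THE g. is_inverse f g)"

definition is_coequalizer :: "'m \<Rightarrow> 'm \<Rightarrow> 'm \<Rightarrow> bool" where
  "is_coequalizer f g e \<longleftrightarrow>
     f \<in> Arr V \<and> g \<in> hom (Dom V f) (Cod V f) \<and> e \<in> hom (Cod V f) (Cod V e) \<and>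
     e \<cdot> f = e \<cdot> g \<and>
     (\<forall>z. \<forall>h \<in> hom (Cod V f) z. h \<cdot> f = h \<cdot> g \<longrightarrow> (\<exists>!k. k \<in> hom (Cod V e) z \<and> k \<cdot> e = h))"

end

locale category =
  fixes V :: "('o, 'm, 'z) category_scheme" (structure)
  assumes dom_in_Obj: "f \<in> Arr V \<Longrightarrow> Dom V f \<in> Obj V"
    and cod_in_Obj: "f \<in> Arr V \<Longrightarrow> Cod V f \<in> Obj V"
    and Idn_in_hom: "x \<in> Obj V \<Longrightarrow> Idn V x \<in> hom V x x"
    and Cmp_in_hom: "\<lbrakk>f \<in> hom V x y; g \<in> hom V y z\<rbrakk> \<Longrightarrow> g \<cdot> f \<in> hom V x z"
    and Cmp_Idn_left: "f \<in> hom V x y \<Longrightarrow> Idn V y \<cdot> f = f"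
    and Cmp_Idn_right: "f \<in> hom V x y \<Longrightarrow> f \<cdot> Idn V x = f"
    and Cmp_assoc: "\<lbrakk>f \<in> hom V w x; g \<in> hom V x y; h \<in> hom V y z\<rbrakk>
                      \<Longrightarrow> (h \<cdot> g) \<cdot> f = h \<cdot> (g \<cdot> f)"

text \<open>The tensor product is \<open>\<otimes>\<close> on objects and \<open>\<odot>\<close> on morphisms; \<open>Asc\<close>, \<open>Lun\<close>, \<open>Run\<close> are
  the constraints \<open>(x \<otimes> y) \<otimes> z \<rightarrow> x \<otimes> (y \<otimes> z)\<close>, \<open>I \<otimes> x \<rightarrow> x\<close>, \<open>x \<otimes> I \<rightarrow> x\<close>.\<close>

record ('o, 'm) monoidal_category = "('o, 'm) category" +
  TenO :: "'o \<Rightarrow> 'o \<Rightarrow> 'o"  (infixr "\<otimes>\<index>" 70)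
  TenA :: "'m \<Rightarrow> 'm \<Rightarrow> 'm"  (infixr "\<odot>\<index>" 70)
  Unt :: "'o"
  Asc :: "'o \<Rightarrow> 'o \<Rightarrow> 'o \<Rightarrow> 'm"
  Lun :: "'o \<Rightarrow> 'm"
  Run :: "'o \<Rightarrow> 'm"

locale monoidal_category = category V
  for V :: "('o, 'm, 'z) monoidal_category_scheme" (structure) +
  assumes Unt_in_Obj: "Unt V \<in> Obj V"
    and TenO_in_Obj: "\<lbrakk>x \<in> Obj V; y \<in> Obj V\<rbrakk> \<Longrightarrow> x \<otimes> y \<in> Obj V"
    and TenA_in_hom: "\<lbrakk>f \<in> hom V x x'; g \<in> hom V y y'\<rbrakk> \<Longrightarrow> f \<odot> g \<in> hom V (x \<otimes> y) (x' \<otimes> y')"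
    and TenA_Idn: "\<lbrakk>x \<in> Obj V; y \<in> Obj V\<rbrakk> \<Longrightarrow> Idn V x \<odot> Idn V y = Idn V (x \<otimes> y)"
    and TenA_Cmp: "\<lbrakk>f \<in> hom V x x'; f' \<in> hom V x' x''; g \<in> hom V y y'; g' \<in> hom V y' y''\<rbrakk>
                     \<Longrightarrow> (f' \<cdot> f) \<odot> (g' \<cdot> g) = (f' \<odot> g') \<cdot> (f \<odot> g)"
    and Asc_in_hom: "\<lbrakk>x \<in> Obj V; y \<in> Obj V; z \<in> Obj V\<rbrakk>
                       \<Longrightarrow> Asc V x y z \<in> hom V ((x \<otimes> y) \<otimes> z) (x \<otimes> (y \<otimes> z))"
    and Asc_iso: "\<lbrakk>x \<in> Obj V; y \<in> Obj V; z \<in> Obj V\<rbrakk> \<Longrightarrow> is_iso V (Asc V x y z)"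
    and Asc_natural: "\<lbrakk>f \<in> hom V x x'; g \<in> hom V y y'; h \<in> hom V z z'\<rbrakk>
                        \<Longrightarrow> Asc V x' y' z' \<cdot> ((f \<odot> g) \<odot> h) = (f \<odot> (g \<odot> h)) \<cdot> Asc V x y z"
    and Lun_in_hom: "x \<in> Obj V \<Longrightarrow> Lun V x \<in> hom V (Unt V \<otimes> x) x"
    and Lun_iso: "x \<in> Obj V \<Longrightarrow> is_iso V (Lun V x)"
    and Lun_natural: "f \<in> hom V x x' \<Longrightarrow> Lun V x' \<cdot> (Idn V (Unt V) \<odot> f) = f \<cdot> Lun V x"
    and Run_in_hom: "x \<in> Obj V \<Longrightarrow> Run V x \<in> hom V (x \<otimes> Unt V) x"
    and Run_iso: "x \<in> Obj V \<Longrightarrow> is_iso V (Run V x)"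
    and Run_natural: "f \<in> hom V x x' \<Longrightarrow> Run V x' \<cdot> (f \<odot> Idn V (Unt V)) = f \<cdot> Run V x"
    and pentagon: "\<lbrakk>w \<in> Obj V; x \<in> Obj V; y \<in> Obj V; z \<in> Obj V\<rbrakk>
                     \<Longrightarrow> Asc V w x (y \<otimes> z) \<cdot> Asc V (w \<otimes> x) y z =
                         (Idn V w \<odot> Asc V x y z) \<cdot> Asc V w (x \<otimes> y) z \<cdot> (Asc V w x y \<odot> Idn V z)"
    and triangle: "\<lbrakk>x \<in> Obj V; y \<in> Obj V\<rbrakk>
                     \<Longrightarrow> (Idn V x \<odot> Lun V y) \<cdot> Asc V x (Unt V) y = Run V x \<odot> Idn V y"

locale monoidal_category_with_coequalizers = monoidal_category V
  for V :: "('o, 'm, 'z) monoidal_category_scheme" (structure) +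
  assumes coequalizer_exists:
      "\<lbrakk>f \<in> hom V x y; g \<in> hom V x y\<rbrakk> \<Longrightarrow> \<exists>e. is_coequalizer V f g e"
    and tensor_left_preserves:
      "\<lbrakk>is_coequalizer V f g e; z \<in> Obj V\<rbrakk>
         \<Longrightarrow> is_coequalizer V (Idn V z \<odot> f) (Idn V z \<odot> g) (Idn V z \<odot> e)"
    and tensor_right_preserves:
      "\<lbrakk>is_coequalizer V f g e; z \<in> Obj V\<rbrakk>
         \<Longrightarrow> is_coequalizer V (f \<odot> Idn V z) (g \<odot> Idn V z) (e \<odot> Idn V z)"

text \<open>Opposite algebras, and the horizontal composition of an enriched bicategory (a functor
  defined on a tensor product of enriched categories), only make sense over a braided base.
  Symmetric monoidal categories are the special case where \<open>Brd y x\<close> is inverse to \<open>Brd x y\<close>.\<close>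

record ('o, 'm) braided_category = "('o, 'm) monoidal_category" +
  Brd :: "'o \<Rightarrow> 'o \<Rightarrow> 'm"

locale braided_category = monoidal_category V
  for V :: "('o, 'm, 'z) braided_category_scheme" (structure) +
  assumes Brd_in_hom: "\<lbrakk>x \<in> Obj V; y \<in> Obj V\<rbrakk> \<Longrightarrow> Brd V x y \<in> hom V (x \<otimes> y) (y \<otimes> x)"
    and Brd_iso: "\<lbrakk>x \<in> Obj V; y \<in> Obj V\<rbrakk> \<Longrightarrow> is_iso V (Brd V x y)"
    and Brd_natural: "\<lbrakk>f \<in> hom V x x'; g \<in> hom V y y'\<rbrakk>
                        \<Longrightarrow> Brd V x' y' \<cdot> (f \<odot> g) = (g \<odot> f) \<cdot> Brd V x y"
    and hexagon_right:
      "\<lbrakk>x \<in> Obj V; y \<in> Obj V; z \<in> Obj V\<rbrakk>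
         \<Longrightarrow> Asc V y z x \<cdot> Brd V x (y \<otimes> z) \<cdot> Asc V x y z =
             (Idn V y \<odot> Brd V x z) \<cdot> Asc V y x z \<cdot> (Brd V x y \<odot> Idn V z)"
    and hexagon_left:
      "\<lbrakk>x \<in> Obj V; y \<in> Obj V; z \<in> Obj V\<rbrakk>
         \<Longrightarrow> iso_inv V (Asc V z x y) \<cdot> Brd V (x \<otimes> y) z \<cdot> iso_inv V (Asc V x y z) =
             (Brd V x z \<odot> Idn V y) \<cdot> iso_inv V (Asc V x z y) \<cdot> (Idn V x \<odot> Brd V y z)"


section \<open>Bicategories and Morita contexts\<close>

record ('a, 'b) cells =
  Cell0 :: "'a set"
  Cell1 :: "'b set"
  Src :: "'b \<Rightarrow> 'a"
  Trg :: "'b \<Rightarrow> 'a"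
  Unit1 :: "'a \<Rightarrow> 'b"
  HComp1 :: "'b \<Rightarrow> 'b \<Rightarrow> 'b"  (infixl "\<bullet>\<index>" 65)

definition hom1 :: "('a, 'b, 'z) cells_scheme \<Rightarrow> 'a \<Rightarrow> 'a \<Rightarrow> 'b set" where
  "hom1 B a b = {f \<in> Cell1 B. Src B f = a \<and> Trg B f = b}"

text \<open>The data of a bicategory, vertical composition being written \<open>\<star>\<close> in applicative order; the
  coherence axioms play no role in the definition of a Morita context.
  \<open>Cell2 f g\<close> is the set of 2-cells \<open>f \<rightarrow> g\<close>. For \<open>\<phi> : f \<rightarrow> f'\<close> and \<open>\<psi> : g \<rightarrow> g'\<close>,
  \<open>HComp2 f f' g g' \<phi> \<psi> : f \<bullet> g \<rightarrow> f' \<bullet> g'\<close>. The constraints are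
  \<open>Assoc f g h : (f \<bullet> g) \<bullet> h \<rightarrow> f \<bullet> (g \<bullet> h)\<close>, \<open>LUnit f : Unit1 (Src f) \<bullet> f \<rightarrow> f\<close> and
  \<open>RUnit f : f \<bullet> Unit1 (Trg f) \<rightarrow> f\<close>.\<close>

record ('a, 'b, 'c) bicategory = "('a, 'b) cells" +
  Cell2 :: "'b \<Rightarrow> 'b \<Rightarrow> 'c set"
  Id2 :: "'b \<Rightarrow> 'c"
  VComp :: "'c \<Rightarrow> 'c \<Rightarrow> 'c"  (infixr "\<star>\<index>" 55)
  HComp2 :: "'b \<Rightarrow> 'b \<Rightarrow> 'b \<Rightarrow> 'b \<Rightarrow> 'c \<Rightarrow> 'c \<Rightarrow> 'c"
  Assoc :: "'b \<Rightarrow> 'b \<Rightarrow> 'b \<Rightarrow> 'c"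
  LUnit :: "'b \<Rightarrow> 'c"
  RUnit :: "'b \<Rightarrow> 'c"

text \<open>The two equations \<open>q \<bullet> \<mu> = \<tau> \<bullet> q\<close> and \<open>p \<bullet> \<tau> = \<mu> \<bullet> p\<close>, with the constraints of the
  bicategory made explicit.\<close>

definition morita_context ::
  "('a, 'b, 'c, 'z) bicategory_scheme \<Rightarrow> 'a \<Rightarrow> 'a \<Rightarrow> 'b \<Rightarrow> 'b \<Rightarrow> 'c \<Rightarrow> 'c \<Rightarrow> bool" where
  "morita_context B a b p q \<mu> \<tau> \<longleftrightarrow>
     a \<in> Cell0 B \<and> b \<in> Cell0 B \<and> p \<in> hom1 B a b \<and> q \<in> hom1 B b a \<and>
     \<mu> \<in> Cell2 B (p \<bullet>\<^bsub>B\<^esub> q) (Unit1 B a) \<and>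
     \<tau> \<in> Cell2 B (q \<bullet>\<^bsub>B\<^esub> p) (Unit1 B b) \<and>
     RUnit B q \<star>\<^bsub>B\<^esub> HComp2 B q q (p \<bullet>\<^bsub>B\<^esub> q) (Unit1 B a) (Id2 B q) \<mu> \<star>\<^bsub>B\<^esub> Assoc B q p q =
       LUnit B q \<star>\<^bsub>B\<^esub> HComp2 B (q \<bullet>\<^bsub>B\<^esub> p) (Unit1 B b) q q \<tau> (Id2 B q) \<and>
     RUnit B p \<star>\<^bsub>B\<^esub> HComp2 B p p (q \<bullet>\<^bsub>B\<^esub> p) (Unit1 B b) (Id2 B p) \<tau> \<star>\<^bsub>B\<^esub> Assoc B p q p =
       LUnit B p \<star>\<^bsub>B\<^esub> HComp2 B (p \<bullet>\<^bsub>B\<^esub> q) (Unit1 B a) p p \<mu> (Id2 B p)"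


section \<open>The bicategory of bimodules\<close>

record ('o, 'm) alg =
  Car :: "'o"
  Mul :: "'m"
  Uni :: "'m"

record ('o, 'm) bimod =
  LAlg :: "('o, 'm) alg"
  RAlg :: "('o, 'm) alg"
  BCar :: "'o"
  LAct :: "'m"
  RAct :: "'m"

context
  fixes V :: "('o, 'm, 'z) monoidal_category_scheme" (structure)
begin

definition is_algebra :: "('o, 'm) alg \<Rightarrow> bool" where
  "is_algebra R \<longleftrightarrow>
     Car R \<in> Obj V \<and> Mul R \<in> hom V (Car R \<otimes> Car R) (Car R) \<and> Uni R \<in> hom V (Unt V) (Car R) \<and>
     Mul R \<cdot> (Mul R \<odot> Idn V (Car R)) =
       Mul R \<cdot> (Idn V (Car R) \<odot> Mul R) \<cdot> Asc V (Car R) (Car R) (Car R) \<and>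
     Mul R \<cdot> (Uni R \<odot> Idn V (Car R)) = Lun V (Car R) \<and>
     Mul R \<cdot> (Idn V (Car R) \<odot> Uni R) = Run V (Car R)"

definition is_bimodule :: "('o, 'm) bimod \<Rightarrow> bool" where
  "is_bimodule X \<longleftrightarrow>
     (let R = LAlg X; S = RAlg X; x = BCar X in
       is_algebra R \<and> is_algebra S \<and> x \<in> Obj V \<and>
       LAct X \<in> hom V (Car R \<otimes> x) x \<and> RAct X \<in> hom V (x \<otimes> Car S) x \<and>
       LAct X \<cdot> (Mul R \<odot> Idn V x) =
         LAct X \<cdot> (Idn V (Car R) \<odot> LAct X) \<cdot> Asc V (Car R) (Car R) x \<and>
       LAct X \<cdot> (Uni R \<odot> Idn V x) = Lun V x \<and>
       RAct X \<cdot> (RAct X \<odot> Idn V (Car S)) =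
         RAct X \<cdot> (Idn V x \<odot> Mul S) \<cdot> Asc V x (Car S) (Car S) \<and>
       RAct X \<cdot> (Idn V x \<odot> Uni S) = Run V x \<and>
       RAct X \<cdot> (LAct X \<odot> Idn V (Car S)) =
         LAct X \<cdot> (Idn V (Car R) \<odot> RAct X) \<cdot> Asc V (Car R) x (Car S))"

definition bimod_maps :: "('o, 'm) bimod \<Rightarrow> ('o, 'm) bimod \<Rightarrow> 'm set" where
  "bimod_maps X Y =
     {f \<in> hom V (BCar X) (BCar Y).
        is_bimodule X \<and> is_bimodule Y \<and> LAlg X = LAlg Y \<and> RAlg X = RAlg Y \<and>
        f \<cdot> LAct X = LAct Y \<cdot> (Idn V (Car (LAlg X)) \<odot> f) \<and>
        f \<cdot> RAct X = RAct Y \<cdot> (f \<odot> Idn V (Car (RAlg X)))}"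

definition regular_bimod :: "('o, 'm) alg \<Rightarrow> ('o, 'm) bimod" where
  "regular_bimod R = \<lparr>LAlg = R, RAlg = R, BCar = Car R, LAct = Mul R, RAct = Mul R\<rparr>"

text \<open>The chosen projection \<open>X \<otimes> Y \<rightarrow> X \<otimes>\<^sub>S Y\<close>, where \<open>S = RAlg X = LAlg Y\<close>.\<close>

definition proj :: "('o, 'm) bimod \<Rightarrow> ('o, 'm) bimod \<Rightarrow> 'm" where
  "proj X Y = (SOME e. is_coequalizer V
     (RAct X \<odot> Idn V (BCar Y))
     ((Idn V (BCar X) \<odot> LAct Y) \<cdot> Asc V (BCar X) (Car (RAlg X)) (BCar Y))
     e)"

text \<open>In the following definitions the morphism \<open>k\<close> is unique because the projections and their
  tensor products with an object are coequalizers.\<close>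

definition bimod_tensor :: "('o, 'm) bimod \<Rightarrow> ('o, 'm) bimod \<Rightarrow> ('o, 'm) bimod" where
  "bimod_tensor X Y =
     (let r = Car (LAlg X); x = BCar X; y = BCar Y; t = Car (RAlg Y);
          \<pi> = proj X Y; xy = Cod V \<pi>
      in \<lparr>LAlg = LAlg X, RAlg = RAlg Y, BCar = xy,
          LAct = (THE k. k \<in> hom V (r \<otimes> xy) xy \<and>
            k \<cdot> (Idn V r \<odot> \<pi>) = \<pi> \<cdot> (LAct X \<odot> Idn V y) \<cdot> iso_inv V (Asc V r x y)),
          RAct = (THE k. k \<in> hom V (xy \<otimes> t) xy \<and>
            k \<cdot> (\<pi> \<odot> Idn V t) = \<pi> \<cdot> (Idn V x \<odot> RAct Y) \<cdot> Asc V x y t)\<rparr>)"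

definition map_tensor ::
  "('o, 'm) bimod \<Rightarrow> ('o, 'm) bimod \<Rightarrow> ('o, 'm) bimod \<Rightarrow> ('o, 'm) bimod \<Rightarrow> 'm \<Rightarrow> 'm \<Rightarrow> 'm" where
  "map_tensor X X' Y Y' \<phi> \<psi> =
     (THE k. k \<in> hom V (Cod V (proj X Y)) (Cod V (proj X' Y')) \<and>
        k \<cdot> proj X Y = proj X' Y' \<cdot> (\<phi> \<odot> \<psi>))"

definition bimod_assoc :: "('o, 'm) bimod \<Rightarrow> ('o, 'm) bimod \<Rightarrow> ('o, 'm) bimod \<Rightarrow> 'm" where
  "bimod_assoc X Y Z =
     (THE k. k \<in> hom V (BCar (bimod_tensor (bimod_tensor X Y) Z))
                       (BCar (bimod_tensor X (bimod_tensor Y Z))) \<and>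
        k \<cdot> proj (bimod_tensor X Y) Z \<cdot> (proj X Y \<odot> Idn V (BCar Z)) =
          proj X (bimod_tensor Y Z) \<cdot> (Idn V (BCar X) \<odot> proj Y Z) \<cdot> Asc V (BCar X) (BCar Y) (BCar Z))"

definition bimod_lunit :: "('o, 'm) bimod \<Rightarrow> 'm" where
  "bimod_lunit X =
     (THE k. k \<in> hom V (BCar (bimod_tensor (regular_bimod (LAlg X)) X)) (BCar X) \<and>
        k \<cdot> proj (regular_bimod (LAlg X)) X = LAct X)"

definition bimod_runit :: "('o, 'm) bimod \<Rightarrow> 'm" where
  "bimod_runit X =
     (THE k. k \<in> hom V (BCar (bimod_tensor X (regular_bimod (RAlg X)))) (BCar X) \<and>
        k \<cdot> proj X (regular_bimod (RAlg X)) = RAct X)"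

definition Bim :: "(('o, 'm) alg, ('o, 'm) bimod, 'm) bicategory" where
  "Bim =
     \<lparr>Cell0 = {R. is_algebra R},
      Cell1 = {X. is_bimodule X},
      Src = LAlg,
      Trg = RAlg,
      Unit1 = regular_bimod,
      HComp1 = bimod_tensor,
      Cell2 = bimod_maps,
      Id2 = (\<lambda>X. Idn V (BCar X)),
      VComp = Cmp V,
      HComp2 = map_tensor,
      Assoc = bimod_assoc,
      LUnit = bimod_lunit,
      RUnit = bimod_runit\<rparr>"

end


section \<open>Enriched categories\<close>

text \<open>\<open>ECmp x y z : EHom y z \<otimes> EHom x y \<rightarrow> EHom x z\<close> is composition in applicative order.\<close>

record ('b, 'o, 'm) enriched_category =
  EObj :: "'b set"
  EHom :: "'b \<Rightarrow> 'b \<Rightarrow> 'o"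
  EId :: "'b \<Rightarrow> 'm"
  ECmp :: "'b \<Rightarrow> 'b \<Rightarrow> 'b \<Rightarrow> 'm"

locale enriched_category = monoidal_category V
  for V :: "('o, 'm, 'z) monoidal_category_scheme" (structure) +
  fixes C :: "('b, 'o, 'm) enriched_category"
  assumes EHom_in_Obj: "\<lbrakk>x \<in> EObj C; y \<in> EObj C\<rbrakk> \<Longrightarrow> EHom C x y \<in> Obj V"
    and EId_in_hom: "x \<in> EObj C \<Longrightarrow> EId C x \<in> hom V (Unt V) (EHom C x x)"
    and ECmp_in_hom: "\<lbrakk>x \<in> EObj C; y \<in> EObj C; z \<in> EObj C\<rbrakk>
                        \<Longrightarrow> ECmp C x y z \<in> hom V (EHom C y z \<otimes> EHom C x y) (EHom C x z)"
    and ECmp_assoc: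
      "\<lbrakk>w \<in> EObj C; x \<in> EObj C; y \<in> EObj C; z \<in> EObj C\<rbrakk>
         \<Longrightarrow> ECmp C w x z \<cdot> (ECmp C x y z \<odot> Idn V (EHom C w x)) =
             ECmp C w y z \<cdot> (Idn V (EHom C y z) \<odot> ECmp C w x y)
               \<cdot> Asc V (EHom C y z) (EHom C x y) (EHom C w x)"
    and ECmp_EId_left: "\<lbrakk>x \<in> EObj C; y \<in> EObj C\<rbrakk>
                          \<Longrightarrow> ECmp C x y y \<cdot> (EId C y \<odot> Idn V (EHom C x y)) = Lun V (EHom C x y)"
    and ECmp_EId_right: "\<lbrakk>x \<in> EObj C; y \<in> EObj C\<rbrakk>
                           \<Longrightarrow> ECmp C x x y \<cdot> (Idn V (EHom C x y) \<odot> EId C x) = Run V (EHom C x y)"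

context
  fixes V :: "('o, 'm, 'z) monoidal_category_scheme" (structure)
begin

text \<open>The morphism \<open>I \<rightarrow> z\<close> obtained from \<open>h : x \<otimes> y \<rightarrow> z\<close> and elements \<open>\<alpha> : I \<rightarrow> x\<close>,
  \<open>\<beta> : I \<rightarrow> y\<close>.\<close>

definition apply2 :: "'m \<Rightarrow> 'm \<Rightarrow> 'm \<Rightarrow> 'm" where
  "apply2 h \<alpha> \<beta> = h \<cdot> (\<alpha> \<odot> \<beta>) \<cdot> iso_inv V (Lun V (Unt V))"

text \<open>Composition in the underlying ordinary category of \<open>C\<close>, whose morphisms \<open>x \<rightarrow> y\<close> are the
  elements \<open>I \<rightarrow> EHom C x y\<close>.\<close>

definition ucomp :: "('b, 'o, 'm) enriched_category \<Rightarrow> 'b \<Rightarrow> 'b \<Rightarrow> 'b \<Rightarrow> 'm \<Rightarrow> 'm \<Rightarrow> 'm" where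
  "ucomp C x y z \<beta> \<alpha> = apply2 (ECmp C x y z) \<beta> \<alpha>"

definition is_uinverse :: "('b, 'o, 'm) enriched_category \<Rightarrow> 'b \<Rightarrow> 'b \<Rightarrow> 'm \<Rightarrow> 'm \<Rightarrow> bool" where
  "is_uinverse C x y \<alpha> \<beta> \<longleftrightarrow>
     \<alpha> \<in> hom V (Unt V) (EHom C x y) \<and> \<beta> \<in> hom V (Unt V) (EHom C y x) \<and>
     ucomp C x y x \<beta> \<alpha> = EId C x \<and> ucomp C y x y \<alpha> \<beta> = EId C y"

definition uinv :: "('b, 'o, 'm) enriched_category \<Rightarrow> 'b \<Rightarrow> 'b \<Rightarrow> 'm \<Rightarrow> 'm" where
  "uinv C x y \<alpha> = (THE \<beta>. is_uinverse C x y \<alpha> \<beta>)"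

text \<open>\<open>postcomp C x y z \<beta> : EHom C x y \<rightarrow> EHom C x z\<close> for an element \<open>\<beta>\<close> of \<open>EHom C y z\<close>, and
  \<open>precomp C x y z \<alpha> : EHom C y z \<rightarrow> EHom C x z\<close> for an element \<open>\<alpha>\<close> of \<open>EHom C x y\<close>.\<close>

definition postcomp :: "('b, 'o, 'm) enriched_category \<Rightarrow> 'b \<Rightarrow> 'b \<Rightarrow> 'b \<Rightarrow> 'm \<Rightarrow> 'm" where
  "postcomp C x y z \<beta> =
     ECmp C x y z \<cdot> (\<beta> \<odot> Idn V (EHom C x y)) \<cdot> iso_inv V (Lun V (EHom C x y))"

definition precomp :: "('b, 'o, 'm) enriched_category \<Rightarrow> 'b \<Rightarrow> 'b \<Rightarrow> 'b \<Rightarrow> 'm \<Rightarrow> 'm" where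
  "precomp C x y z \<alpha> =
     ECmp C x y z \<cdot> (Idn V (EHom C y z) \<odot> \<alpha>) \<cdot> iso_inv V (Run V (EHom C y z))"

definition enriched_functor ::
  "('b, 'o, 'm) enriched_category \<Rightarrow> ('c, 'o, 'm) enriched_category
     \<Rightarrow> ('b \<Rightarrow> 'c) \<Rightarrow> ('b \<Rightarrow> 'b \<Rightarrow> 'm) \<Rightarrow> bool" where
  "enriched_functor C D F0 F \<longleftrightarrow>
     (\<forall>x \<in> EObj C. F0 x \<in> EObj D) \<and>
     (\<forall>x \<in> EObj C. \<forall>y \<in> EObj C. F x y \<in> hom V (EHom C x y) (EHom D (F0 x) (F0 y))) \<and>
     (\<forall>x \<in> EObj C. F x x \<cdot> EId C x = EId D (F0 x)) \<and>
     (\<forall>x \<in> EObj C. \<forall>y \<in> EObj C. \<forall>z \<in> EObj C.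
        F x z \<cdot> ECmp C x y z = ECmp D (F0 x) (F0 y) (F0 z) \<cdot> (F y z \<odot> F x y))"

text \<open>Natural isomorphisms \<open>\<eta> : F \<rightarrow> G\<close> of enriched functors \<open>F, G : C \<rightarrow> D\<close>.\<close>

definition enriched_nat_iso ::
  "('b, 'o, 'm) enriched_category \<Rightarrow> ('c, 'o, 'm) enriched_category
     \<Rightarrow> ('b \<Rightarrow> 'c) \<Rightarrow> ('b \<Rightarrow> 'b \<Rightarrow> 'm) \<Rightarrow> ('b \<Rightarrow> 'c) \<Rightarrow> ('b \<Rightarrow> 'b \<Rightarrow> 'm) \<Rightarrow> ('b \<Rightarrow> 'm) \<Rightarrow> bool" where
  "enriched_nat_iso C D F0 F G0 G \<eta> \<longleftrightarrow>
     (\<forall>x \<in> EObj C. \<exists>\<theta>. is_uinverse D (F0 x) (G0 x) (\<eta> x) \<theta>) \<and>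
     (\<forall>x \<in> EObj C. \<forall>y \<in> EObj C.
        postcomp D (F0 x) (F0 y) (G0 y) (\<eta> y) \<cdot> F x y =
        precomp D (F0 x) (G0 x) (G0 y) (\<eta> x) \<cdot> G x y)"

end

context
  fixes V :: "('o, 'm, 'z) braided_category_scheme" (structure)
begin

text \<open>The exchange \<open>(a \<otimes> b) \<otimes> (c \<otimes> d) \<rightarrow> (a \<otimes> c) \<otimes> (b \<otimes> d)\<close> by means of \<open>Brd b c\<close>.\<close>

definition exchange :: "'o \<Rightarrow> 'o \<Rightarrow> 'o \<Rightarrow> 'o \<Rightarrow> 'm" where
  "exchange a b c d =
     iso_inv V (Asc V a c (b \<otimes> d))
     \<cdot> (Idn V a \<odot> (Asc V c b d \<cdot> (Brd V b c \<odot> Idn V d) \<cdot> iso_inv V (Asc V b c d)))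
     \<cdot> Asc V a b (c \<otimes> d)"

definition etensor ::
  "('b, 'o, 'm) enriched_category \<Rightarrow> ('c, 'o, 'm) enriched_category
     \<Rightarrow> ('b \<times> 'c, 'o, 'm) enriched_category" where
  "etensor C D =
     \<lparr>EObj = EObj C \<times> EObj D,
      EHom = (\<lambda>(x, y) (x', y'). EHom C x x' \<otimes> EHom D y y'),
      EId = (\<lambda>(x, y). (EId C x \<odot> EId D y) \<cdot> iso_inv V (Lun V (Unt V))),
      ECmp = (\<lambda>(x, y) (x', y') (x'', y'').
        (ECmp C x x' x'' \<odot> ECmp D y y' y'')
        \<cdot> exchange (EHom C x' x'') (EHom D y' y'') (EHom C x x') (EHom D y y'))\<rparr>"

end


section \<open>Enriched bicategories\<close>

text \<open>For parallel 1-cells, \<open>Hom2 f g\<close> is the object of 2-cells \<open>f \<rightarrow> g\<close>;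
  \<open>VCmp f g h : Hom2 g h \<otimes> Hom2 f g \<rightarrow> Hom2 f h\<close> is vertical and
  \<open>HCmp f f' g g' : Hom2 f f' \<otimes> Hom2 g g' \<rightarrow> Hom2 (f \<bullet> g) (f' \<bullet> g')\<close> horizontal composition. The
  constraints are elements \<open>EAssoc f g h : I \<rightarrow> Hom2 ((f \<bullet> g) \<bullet> h) (f \<bullet> (g \<bullet> h))\<close>, and similarly
  for the units.\<close>

record ('a, 'b, 'o, 'm) enriched_bicategory = "('a, 'b) cells" +
  Hom2 :: "'b \<Rightarrow> 'b \<Rightarrow> 'o"
  VId :: "'b \<Rightarrow> 'm"
  VCmp :: "'b \<Rightarrow> 'b \<Rightarrow> 'b \<Rightarrow> 'm"
  HCmp :: "'b \<Rightarrow> 'b \<Rightarrow> 'b \<Rightarrow> 'b \<Rightarrow> 'm"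
  EAssoc :: "'b \<Rightarrow> 'b \<Rightarrow> 'b \<Rightarrow> 'm"
  ELUnit :: "'b \<Rightarrow> 'm"
  ERUnit :: "'b \<Rightarrow> 'm"

definition HomCat ::
  "('a, 'b, 'o, 'm) enriched_bicategory \<Rightarrow> 'a \<Rightarrow> 'a \<Rightarrow> ('b, 'o, 'm) enriched_category" where
  "HomCat \<B> a b = \<lparr>EObj = hom1 \<B> a b, EHom = Hom2 \<B>, EId = VId \<B>, ECmp = VCmp \<B>\<rparr>"

context
  fixes V :: "('o, 'm, 'z) monoidal_category_scheme" (structure)
    and \<B> :: "('a, 'b, 'o, 'm) enriched_bicategory"
begin

text \<open>\<open>lwhisker g f f' : Hom2 f f' \<rightarrow> Hom2 (g \<bullet> f) (g \<bullet> f')\<close> is horizontal composition with the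
  identity of \<open>g\<close> on the left; \<open>rwhisker f f' g : Hom2 f f' \<rightarrow> Hom2 (f \<bullet> g) (f' \<bullet> g)\<close> on the
  right.\<close>

definition lwhisker :: "'b \<Rightarrow> 'b \<Rightarrow> 'b \<Rightarrow> 'm" where
  "lwhisker g f f' =
     HCmp \<B> g g f f' \<cdot> (VId \<B> g \<odot> Idn V (Hom2 \<B> f f')) \<cdot> iso_inv V (Lun V (Hom2 \<B> f f'))"

definition rwhisker :: "'b \<Rightarrow> 'b \<Rightarrow> 'b \<Rightarrow> 'm" where
  "rwhisker f f' g =
     HCmp \<B> f f' g g \<cdot> (Idn V (Hom2 \<B> f f') \<odot> VId \<B> g) \<cdot> iso_inv V (Run V (Hom2 \<B> f f'))"

end

locale enriched_bicategory = braided_category V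
  for V :: "('o, 'm, 'z) braided_category_scheme" (structure) +
  fixes \<B> :: "('a, 'b, 'o, 'm) enriched_bicategory"
  assumes Src_in_Cell0: "f \<in> Cell1 \<B> \<Longrightarrow> Src \<B> f \<in> Cell0 \<B>"
    and Trg_in_Cell0: "f \<in> Cell1 \<B> \<Longrightarrow> Trg \<B> f \<in> Cell0 \<B>"
    and Unit1_in_hom1: "a \<in> Cell0 \<B> \<Longrightarrow> Unit1 \<B> a \<in> hom1 \<B> a a"
    and HomCat_enriched:
      "\<lbrakk>a \<in> Cell0 \<B>; b \<in> Cell0 \<B>\<rbrakk> \<Longrightarrow> enriched_category V (HomCat \<B> a b)"
    and HCmp_functor:
      "\<lbrakk>a \<in> Cell0 \<B>; b \<in> Cell0 \<B>; c \<in> Cell0 \<B>\<rbrakk>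
         \<Longrightarrow> enriched_functor V (etensor V (HomCat \<B> a b) (HomCat \<B> b c)) (HomCat \<B> a c)
               (\<lambda>(f, g). f \<bullet>\<^bsub>\<B>\<^esub> g)
               (\<lambda>(f, g) (f', g'). HCmp \<B> f f' g g')"
    and EAssoc_nat_iso:
      "\<lbrakk>a \<in> Cell0 \<B>; b \<in> Cell0 \<B>; c \<in> Cell0 \<B>; d \<in> Cell0 \<B>\<rbrakk>
         \<Longrightarrow> enriched_nat_iso V
               (etensor V (etensor V (HomCat \<B> a b) (HomCat \<B> b c)) (HomCat \<B> c d)) (HomCat \<B> a d)
               (\<lambda>((f, g), h). (f \<bullet>\<^bsub>\<B>\<^esub> g) \<bullet>\<^bsub>\<B>\<^esub> h)
               (\<lambda>((f, g), h) ((f', g'), h').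
                  HCmp \<B> (f \<bullet>\<^bsub>\<B>\<^esub> g) (f' \<bullet>\<^bsub>\<B>\<^esub> g') h h'
                  \<cdot> (HCmp \<B> f f' g g' \<odot> Idn V (Hom2 \<B> h h')))
               (\<lambda>((f, g), h). f \<bullet>\<^bsub>\<B>\<^esub> (g \<bullet>\<^bsub>\<B>\<^esub> h))
               (\<lambda>((f, g), h) ((f', g'), h').
                  HCmp \<B> f f' (g \<bullet>\<^bsub>\<B>\<^esub> h) (g' \<bullet>\<^bsub>\<B>\<^esub> h')
                  \<cdot> (Idn V (Hom2 \<B> f f') \<odot> HCmp \<B> g g' h h')
                  \<cdot> Asc V (Hom2 \<B> f f') (Hom2 \<B> g g') (Hom2 \<B> h h'))
               (\<lambda>((f, g), h). EAssoc \<B> f g h)"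
    and ELUnit_nat_iso:
      "\<lbrakk>a \<in> Cell0 \<B>; b \<in> Cell0 \<B>\<rbrakk>
         \<Longrightarrow> enriched_nat_iso V (HomCat \<B> a b) (HomCat \<B> a b)
               (\<lambda>f. Unit1 \<B> a \<bullet>\<^bsub>\<B>\<^esub> f) (lwhisker V \<B> (Unit1 \<B> a))
               (\<lambda>f. f) (\<lambda>f f'. Idn V (Hom2 \<B> f f'))
               (ELUnit \<B>)"
    and ERUnit_nat_iso:
      "\<lbrakk>a \<in> Cell0 \<B>; b \<in> Cell0 \<B>\<rbrakk>
         \<Longrightarrow> enriched_nat_iso V (HomCat \<B> a b) (HomCat \<B> a b)
               (\<lambda>f. f \<bullet>\<^bsub>\<B>\<^esub> Unit1 \<B> b) (\<lambda>f f'. rwhisker V \<B> f f' (Unit1 \<B> b))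
               (\<lambda>f. f) (\<lambda>f f'. Idn V (Hom2 \<B> f f'))
               (ERUnit \<B>)"
    and EAssoc_pentagon:
      "\<lbrakk>f \<in> hom1 \<B> a b; g \<in> hom1 \<B> b c; h \<in> hom1 \<B> c d; k \<in> hom1 \<B> d e\<rbrakk>
         \<Longrightarrow> (let fg = f \<bullet>\<^bsub>\<B>\<^esub> g; gh = g \<bullet>\<^bsub>\<B>\<^esub> h; hk = h \<bullet>\<^bsub>\<B>\<^esub> k in
               ucomp V (HomCat \<B> a e) ((fg \<bullet>\<^bsub>\<B>\<^esub> h) \<bullet>\<^bsub>\<B>\<^esub> k) (fg \<bullet>\<^bsub>\<B>\<^esub> hk) (f \<bullet>\<^bsub>\<B>\<^esub> (g \<bullet>\<^bsub>\<B>\<^esub> hk))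
                 (EAssoc \<B> f g hk) (EAssoc \<B> fg h k) =
               ucomp V (HomCat \<B> a e)
                 ((fg \<bullet>\<^bsub>\<B>\<^esub> h) \<bullet>\<^bsub>\<B>\<^esub> k) (f \<bullet>\<^bsub>\<B>\<^esub> (gh \<bullet>\<^bsub>\<B>\<^esub> k)) (f \<bullet>\<^bsub>\<B>\<^esub> (g \<bullet>\<^bsub>\<B>\<^esub> hk))
                 (lwhisker V \<B> f (gh \<bullet>\<^bsub>\<B>\<^esub> k) (g \<bullet>\<^bsub>\<B>\<^esub> hk) \<cdot> EAssoc \<B> g h k)
                 (ucomp V (HomCat \<B> a e)
                   ((fg \<bullet>\<^bsub>\<B>\<^esub> h) \<bullet>\<^bsub>\<B>\<^esub> k) ((f \<bullet>\<^bsub>\<B>\<^esub> gh) \<bullet>\<^bsub>\<B>\<^esub> k) (f \<bullet>\<^bsub>\<B>\<^esub> (gh \<bullet>\<^bsub>\<B>\<^esub> k))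
                   (EAssoc \<B> f gh k)
                   (rwhisker V \<B> (fg \<bullet>\<^bsub>\<B>\<^esub> h) (f \<bullet>\<^bsub>\<B>\<^esub> gh) k \<cdot> EAssoc \<B> f g h)))"
    and EUnit_triangle:
      "\<lbrakk>f \<in> hom1 \<B> a b; g \<in> hom1 \<B> b c\<rbrakk>
         \<Longrightarrow> (let u = Unit1 \<B> b in
               ucomp V (HomCat \<B> a c) ((f \<bullet>\<^bsub>\<B>\<^esub> u) \<bullet>\<^bsub>\<B>\<^esub> g) (f \<bullet>\<^bsub>\<B>\<^esub> (u \<bullet>\<^bsub>\<B>\<^esub> g)) (f \<bullet>\<^bsub>\<B>\<^esub> g)
                 (lwhisker V \<B> f (u \<bullet>\<^bsub>\<B>\<^esub> g) g \<cdot> ELUnit \<B> g) (EAssoc \<B> f u g) =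
               rwhisker V \<B> (f \<bullet>\<^bsub>\<B>\<^esub> u) f g \<cdot> ERUnit \<B> f)"


section \<open>The Morita context of a pair of 1-cells\<close>

definition end_algebra :: "('b, 'o, 'm) enriched_category \<Rightarrow> 'b \<Rightarrow> ('o, 'm) alg" where
  "end_algebra C x = \<lparr>Car = EHom C x x, Mul = ECmp C x x x, Uni = EId C x\<rparr>"

context
  fixes V :: "('o, 'm, 'z) braided_category_scheme" (structure)
begin

text \<open>Whenever factors have to be permuted, the inverse braiding \<open>swap x y : x \<otimes> y \<rightarrow> y \<otimes> x\<close> is
  used. With the interchange law of an enriched bicategory formulated by means of the braiding
  itself, the actions below would not commute with each other for the other choice, unless the
  braiding is a symmetry (when both choices agree).\<close>

definition swap :: "'o \<Rightarrow> 'o \<Rightarrow> 'm" where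
  "swap x y = iso_inv V (Brd V y x)"

definition op_algebra :: "('o, 'm) alg \<Rightarrow> ('o, 'm) alg" where
  "op_algebra R = R\<lparr>Mul := Mul R \<cdot> swap (Car R) (Car R)\<rparr>"

context
  fixes \<B> :: "('a, 'b, 'o, 'm) enriched_bicategory"
    and a b :: 'a
    and p q :: 'b
begin

definition ctx_Q :: "('o, 'm) alg" where
  "ctx_Q = end_algebra (HomCat \<B> b a) q"

definition ctx_P :: "('o, 'm) alg" where
  "ctx_P = op_algebra (end_algebra (HomCat \<B> a b) p)"

text \<open>In terms of elements, the actions are \<open>f n = (f \<bullet> p) \<circ> n\<close> and \<open>n g = (q \<bullet> g) \<circ> n\<close> for
  \<open>n : B \<rightarrow> q \<bullet> p\<close>, and \<open>g m = m \<circ> (g \<bullet> q)\<close> and \<open>m f = m \<circ> (p \<bullet> f)\<close> for \<open>m : p \<bullet> q \<rightarrow> A\<close>,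
  where \<open>f : q \<rightarrow> q\<close> and \<open>g : p \<rightarrow> p\<close>.\<close>

definition ctx_N :: "('o, 'm) bimod" where
  "ctx_N =
     (let u = Unit1 \<B> b; qp = q \<bullet>\<^bsub>\<B>\<^esub> p; n = Hom2 \<B> u qp
      in \<lparr>LAlg = ctx_Q, RAlg = ctx_P, BCar = n,
          LAct = VCmp \<B> u qp qp \<cdot> (rwhisker V \<B> q q p \<odot> Idn V n),
          RAct = VCmp \<B> u qp qp \<cdot> (lwhisker V \<B> q p p \<odot> Idn V n) \<cdot> swap n (Hom2 \<B> p p)\<rparr>)"

definition ctx_M :: "('o, 'm) bimod" where
  "ctx_M =
     (let u = Unit1 \<B> a; pq = p \<bullet>\<^bsub>\<B>\<^esub> q; m = Hom2 \<B> pq u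
      in \<lparr>LAlg = ctx_P, RAlg = ctx_Q, BCar = m,
          LAct = VCmp \<B> pq pq u \<cdot> (Idn V m \<odot> rwhisker V \<B> p p q) \<cdot> swap (Hom2 \<B> p p) m,
          RAct = VCmp \<B> pq pq u \<cdot> (Idn V m \<odot> lwhisker V \<B> p q q)\<rparr>)"

text \<open>\<open>triangle0 : N \<otimes> M \<rightarrow> Q\<close> sends \<open>n \<otimes> m\<close> to \<open>(q \<bullet> m) \<circ> (n \<bullet> q)\<close>, that is, to the composite
  of the constraints with
  \<open>q \<rightarrow> B \<bullet> q \<rightarrow> (q \<bullet> p) \<bullet> q \<rightarrow> q \<bullet> (p \<bullet> q) \<rightarrow> q \<bullet> A \<rightarrow> q\<close>.\<close>

definition triangle0 :: 'm where
  "triangle0 =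
     (let C = HomCat \<B> b a; ua = Unit1 \<B> a; ub = Unit1 \<B> b;
          pq = p \<bullet>\<^bsub>\<B>\<^esub> q; qp = q \<bullet>\<^bsub>\<B>\<^esub> p;
          n = Hom2 \<B> ub qp; m = Hom2 \<B> pq ua
      in precomp V C q (ub \<bullet>\<^bsub>\<B>\<^esub> q) q (uinv V C (ub \<bullet>\<^bsub>\<B>\<^esub> q) q (ELUnit \<B> q))
         \<cdot> postcomp V C (ub \<bullet>\<^bsub>\<B>\<^esub> q) (q \<bullet>\<^bsub>\<B>\<^esub> ua) q (ERUnit \<B> q)
         \<cdot> VCmp \<B> (ub \<bullet>\<^bsub>\<B>\<^esub> q) (qp \<bullet>\<^bsub>\<B>\<^esub> q) (q \<bullet>\<^bsub>\<B>\<^esub> ua)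
         \<cdot> ((precomp V C (qp \<bullet>\<^bsub>\<B>\<^esub> q) (q \<bullet>\<^bsub>\<B>\<^esub> pq) (q \<bullet>\<^bsub>\<B>\<^esub> ua) (EAssoc \<B> q p q)
              \<cdot> lwhisker V \<B> q pq ua)
            \<odot> rwhisker V \<B> ub qp q)
         \<cdot> swap n m)"

text \<open>\<open>blacktriangle0 : M \<otimes> N \<rightarrow> P\<close> sends \<open>m \<otimes> n\<close> to \<open>(m \<bullet> p) \<circ> (p \<bullet> n)\<close>, that is, to the
  composite of the constraints with
  \<open>p \<rightarrow> p \<bullet> B \<rightarrow> p \<bullet> (q \<bullet> p) \<rightarrow> (p \<bullet> q) \<bullet> p \<rightarrow> A \<bullet> p \<rightarrow> p\<close>.\<close>

definition blacktriangle0 :: 'm where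
  "blacktriangle0 =
     (let C = HomCat \<B> a b; ua = Unit1 \<B> a; ub = Unit1 \<B> b;
          pq = p \<bullet>\<^bsub>\<B>\<^esub> q; qp = q \<bullet>\<^bsub>\<B>\<^esub> p
      in precomp V C p (p \<bullet>\<^bsub>\<B>\<^esub> ub) p (uinv V C (p \<bullet>\<^bsub>\<B>\<^esub> ub) p (ERUnit \<B> p))
         \<cdot> postcomp V C (p \<bullet>\<^bsub>\<B>\<^esub> ub) (ua \<bullet>\<^bsub>\<B>\<^esub> p) p (ELUnit \<B> p)
         \<cdot> VCmp \<B> (p \<bullet>\<^bsub>\<B>\<^esub> ub) (p \<bullet>\<^bsub>\<B>\<^esub> qp) (ua \<bullet>\<^bsub>\<B>\<^esub> p)
         \<cdot> ((precomp V C (p \<bullet>\<^bsub>\<B>\<^esub> qp) (pq \<bullet>\<^bsub>\<B>\<^esub> p) (ua \<bullet>\<^bsub>\<B>\<^esub> p)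
                (uinv V C (pq \<bullet>\<^bsub>\<B>\<^esub> p) (p \<bullet>\<^bsub>\<B>\<^esub> qp) (EAssoc \<B> p q p))
              \<cdot> rwhisker V \<B> pq ua p)
            \<odot> lwhisker V \<B> p ub qp))"

end

end

end

(*
Vertical composition of 2-cells is used in two forms: g \<circ> f, given by the composition of the enriched
hom-categories, and f ; g, the same composition precomposed with the inverse braiding. For f : x \<rightarrow> x'
and g : y \<rightarrow> y' the interchange law then reads
(f \<bullet> y') \<circ> (x \<bullet> g) = f \<bullet> g = (f \<bullet> y) ; (x' \<bullet> g),
and the two compositions associate with each other along every square on which they agree. The braiding
thereby disappears from all equations between the actions and the two pairings.

The associativity constraint of the base is removed in the same spirit. A morphism from a tensor product of
several objects to X is regarded as an element of X with a list of stages. Bilinear operations act on elements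
strictly associatively, because concatenation of lists is strictly associative. An equation of morphisms
follows from the equation of elements obtained from epimorphisms that remain epimorphisms after tensoring,
such as identities and the projections onto the tensor products over an algebra.
*)

theory Submission
  imports Defs
begin

section \<open>Categories and monoidal categories\<close>

text \<open>Each law lists its arguments in one fixed order on both sides, whereas vertical
  composition in applicative order reverses them whenever a later argument is applied after an
  earlier one: n g applies g after n. The operation \<open>;\<close> removes this reversal, so the
  right action of P on N, the left action of P on M, the product of P and the pairing of N with M
  are expressed by it, and the stages never have to be permuted. Where \<open>;\<close> meets
  ordinary composition, the law comes from an interchange square, and a single hexagon explains why
  such a square suffices: moving one factor past two others splits into two crossings, one absorbed
  by the square and one present on the other side. The inverse braiding is the right choice because
  the two orders of whiskering differ by exactly one \<open>Brd\<close>. The two Morita equations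
  come from interchanging the two copies of n, respectively of m; what surrounds these steps is
  naturality and coherence of the constraints. Constraints have no stages, so both compositions
  treat them alike and they move freely.\<close>

context category
begin

lemma in_hom_iff: "f \<in> hom V x y \<longleftrightarrow> f \<in> Arr V \<and> Dom V f = x \<and> Cod V f = y"
  by (simp add: hom_def)

lemma Dom_in_Obj [simp]: "f \<in> Arr V \<Longrightarrow> Dom V f \<in> Obj V"
  and Cod_in_Obj [simp]: "f \<in> Arr V \<Longrightarrow> Cod V f \<in> Obj V"
  by (auto intro: dom_in_Obj cod_in_Obj)

lemma Idn_simps [simp]:
  assumes "x \<in> Obj V"
  shows "Idn V x \<in> Arr V" "Dom V (Idn V x) = x" "Cod V (Idn V x) = x"
  using Idn_in_hom[OF assms] by (auto simp: in_hom_iff)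

text \<open>The axioms speak of \<open>hom V x y\<close>. Restated through \<open>Arr\<close>,
  \<open>Dom\<close> and \<open>Cod\<close> they let the simplifier compute typing conditions
  instead of having to guess the objects.\<close>

lemma Cmp_simps [simp]:
  assumes "f \<in> Arr V" "g \<in> Arr V" "Dom V g = Cod V f"
  shows "g \<cdot> f \<in> Arr V" "Dom V (g \<cdot> f) = Dom V f" "Cod V (g \<cdot> f) = Cod V g"
  using Cmp_in_hom[of f "Dom V f" "Cod V f" g "Cod V g"] assms by (auto simp: in_hom_iff)

lemma Idn_Cmp [simp]: "f \<in> Arr V \<Longrightarrow> Cod V f = x \<Longrightarrow> Idn V x \<cdot> f = f"
  and Cmp_Idn [simp]: "f \<in> Arr V \<Longrightarrow> Dom V f = x \<Longrightarrow> f \<cdot> Idn V x = f"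
  using Cmp_Idn_left[of f "Dom V f" "Cod V f"] Cmp_Idn_right[of f "Dom V f" "Cod V f"]
  by (auto simp: in_hom_iff)

lemma Cmp_Cmp [simp]:
  "\<lbrakk>f \<in> Arr V; g \<in> Arr V; h \<in> Arr V; Dom V g = Cod V f; Dom V h = Cod V g\<rbrakk>
     \<Longrightarrow> (h \<cdot> g) \<cdot> f = h \<cdot> (g \<cdot> f)"
  using Cmp_assoc[of f "Dom V f" "Cod V f" g "Cod V g" h "Cod V h"] by (auto simp: in_hom_iff)

text \<open>Composites are normalised to the right by \<open>Cmp_Cmp\<close>, so an equation for
  \<open>g \<cdot> f\<close> no longer matches inside a longer composite; this form does.\<close>

lemma Cmp_extend:
  "\<lbrakk>g \<cdot> f = k; f \<in> Arr V; g \<in> Arr V; Dom V g = Cod V f; h \<in> Arr V; Cod V h = Dom V f\<rbrakk>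
     \<Longrightarrow> g \<cdot> (f \<cdot> h) = k \<cdot> h"
  by auto

section \<open>Inverses and cancellation of isomorphisms\<close>

lemma is_inverse_unique:
  assumes "is_inverse V f g" "is_inverse V f h" shows "g = h"
proof -
  have "g = g \<cdot> (f \<cdot> h)" using assms by (auto simp: is_inverse_def in_hom_iff)
  also have "\<dots> = (g \<cdot> f) \<cdot> h"
    using assms by (subst Cmp_Cmp) (auto simp: is_inverse_def in_hom_iff)
  also have "\<dots> = h" using assms by (auto simp: is_inverse_def in_hom_iff)
  finally show ?thesis .
qed

lemma iso_inv_eqI: "is_inverse V f g \<Longrightarrow> iso_inv V f = g"
  unfolding iso_inv_def by (blast intro: the_equality is_inverse_unique)

lemma is_inverse_iso_inv: "is_iso V f \<Longrightarrow> is_inverse V f (iso_inv V f)"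
  using iso_inv_eqI by (auto simp: is_iso_def)

lemma is_isoI:
  "\<lbrakk>f \<in> Arr V; g \<in> Arr V; Dom V g = Cod V f; Cod V g = Dom V f;
    g \<cdot> f = Idn V (Dom V f); f \<cdot> g = Idn V (Cod V f)\<rbrakk> \<Longrightarrow> is_iso V f"
  by (auto simp: is_iso_def is_inverse_def in_hom_iff)

lemma iso_inv_equality:
  "\<lbrakk>f \<in> Arr V; g \<in> Arr V; Dom V g = Cod V f; Cod V g = Dom V f;
    g \<cdot> f = Idn V (Dom V f); f \<cdot> g = Idn V (Cod V f)\<rbrakk> \<Longrightarrow> iso_inv V f = g"
  by (rule iso_inv_eqI) (auto simp: is_inverse_def in_hom_iff)

lemma is_iso_Arr: "is_iso V f \<Longrightarrow> f \<in> Arr V"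
  by (auto simp: is_iso_def is_inverse_def)

lemma iso_inv_simps [simp]:
  assumes "is_iso V f"
  shows "iso_inv V f \<in> Arr V" "Dom V (iso_inv V f) = Cod V f" "Cod V (iso_inv V f) = Dom V f"
    "iso_inv V f \<cdot> f = Idn V (Dom V f)" "f \<cdot> iso_inv V f = Idn V (Cod V f)"
  using is_inverse_iso_inv[OF assms] by (auto simp: is_inverse_def in_hom_iff)

lemma iso_inv_cancel [simp]:
  assumes "is_iso V f" "k \<in> Arr V"
  shows "Cod V k = Dom V f \<Longrightarrow> iso_inv V f \<cdot> (f \<cdot> k) = k"
    "Cod V k = Cod V f \<Longrightarrow> f \<cdot> (iso_inv V f \<cdot> k) = k"
  using assms is_iso_Arr by (simp_all flip: Cmp_Cmp)

lemma is_iso_Idn [simp]: "x \<in> Obj V \<Longrightarrow> is_iso V (Idn V x)"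
  by (rule is_isoI[where g = "Idn V x"]) auto

lemma is_iso_iso_inv [simp]: "is_iso V f \<Longrightarrow> is_iso V (iso_inv V f)"
  by (rule is_isoI[where g = f]) (auto simp: is_iso_Arr)

lemma iso_inv_iso_inv [simp]: "is_iso V f \<Longrightarrow> iso_inv V (iso_inv V f) = f"
  by (rule iso_inv_equality) (auto simp: is_iso_Arr)

lemma is_iso_Cmp [simp]:
  assumes "is_iso V f" "is_iso V g" "Dom V g = Cod V f"
  shows "is_iso V (g \<cdot> f)"
  using assms is_iso_Arr by (intro is_isoI[where g = "iso_inv V f \<cdot> iso_inv V g"]) auto

lemma iso_inv_Cmp:
  assumes "is_iso V f" "is_iso V g" "Dom V g = Cod V f"
  shows "iso_inv V (g \<cdot> f) = iso_inv V f \<cdot> iso_inv V g"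
  using assms is_iso_Arr by (intro iso_inv_equality) auto

lemma iso_cancel_left:
  assumes "is_iso V f" "g \<in> Arr V" "h \<in> Arr V" "Cod V g = Dom V f" "Cod V h = Dom V f"
  shows "f \<cdot> g = f \<cdot> h \<longleftrightarrow> g = h"
  using assms iso_inv_cancel(1) by metis

lemma iso_cancel_right:
  assumes "is_iso V f" "g \<in> Arr V" "h \<in> Arr V" "Dom V g = Cod V f" "Dom V h = Cod V f"
  shows "g \<cdot> f = h \<cdot> f \<longleftrightarrow> g = h"
proof
  assume "g \<cdot> f = h \<cdot> f"
  then have "(g \<cdot> f) \<cdot> iso_inv V f = (h \<cdot> f) \<cdot> iso_inv V f" by simp
  then show "g = h" using assms is_iso_Arr by simp
qed simp

lemma iso_move_left:
  "\<lbrakk>f \<cdot> g = h; is_iso V f; g \<in> Arr V; Cod V g = Dom V f\<rbrakk> \<Longrightarrow> g = iso_inv V f \<cdot> h"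
  by auto

lemma iso_move_right:
  "\<lbrakk>g \<cdot> f = h; is_iso V f; g \<in> Arr V; Dom V g = Cod V f\<rbrakk> \<Longrightarrow> g = h \<cdot> iso_inv V f"
  by (auto simp: is_iso_Arr)

end

context monoidal_category
begin

lemma Unt_Obj [simp]: "Unt V \<in> Obj V"
  by (rule Unt_in_Obj)

lemma TenO_Obj [simp]: "x \<in> Obj V \<Longrightarrow> y \<in> Obj V \<Longrightarrow> x \<otimes> y \<in> Obj V"
  by (rule TenO_in_Obj)

lemma TenA_simps [simp]:
  assumes "f \<in> Arr V" "g \<in> Arr V"
  shows "f \<odot> g \<in> Arr V" "Dom V (f \<odot> g) = Dom V f \<otimes> Dom V g" "Cod V (f \<odot> g) = Cod V f \<otimes> Cod V g"
  using TenA_in_hom[of f "Dom V f" "Cod V f" g "Dom V g" "Cod V g"] assms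
  by (auto simp: in_hom_iff)

lemma TenA_Idn_Idn [simp]: "x \<in> Obj V \<Longrightarrow> y \<in> Obj V \<Longrightarrow> Idn V x \<odot> Idn V y = Idn V (x \<otimes> y)"
  by (rule TenA_Idn)

text \<open>Oriented so that neighbouring tensor products merge into one. Steps that need the
  factors separated state the unmerged form explicitly.\<close>

lemma TenA_TenA [simp]:
  assumes "f \<in> Arr V" "f' \<in> Arr V" "Dom V f' = Cod V f" "g \<in> Arr V" "g' \<in> Arr V" "Dom V g' = Cod V g"
  shows "(f' \<odot> g') \<cdot> (f \<odot> g) = (f' \<cdot> f) \<odot> (g' \<cdot> g)"
  using TenA_Cmp[of f "Dom V f" "Cod V f" f' "Cod V f'" g "Dom V g" "Cod V g" g' "Cod V g'"] assms
  by (simp add: in_hom_iff)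

lemma TenA_TenA_extend [simp]:
  assumes "f \<in> Arr V" "f' \<in> Arr V" "Dom V f' = Cod V f" "g \<in> Arr V" "g' \<in> Arr V" "Dom V g' = Cod V g"
    "k \<in> Arr V" "Cod V k = Dom V f \<otimes> Dom V g"
  shows "(f' \<odot> g') \<cdot> ((f \<odot> g) \<cdot> k) = ((f' \<cdot> f) \<odot> (g' \<cdot> g)) \<cdot> k"
  using assms by (subst Cmp_Cmp[symmetric]) auto

lemma is_iso_TenA [simp]:
  assumes "is_iso V f" "is_iso V g" shows "is_iso V (f \<odot> g)"
  using assms is_iso_Arr by (intro is_isoI[where g = "iso_inv V f \<odot> iso_inv V g"]) auto

lemma iso_inv_TenA [simp]:
  assumes "is_iso V f" "is_iso V g" shows "iso_inv V (f \<odot> g) = iso_inv V f \<odot> iso_inv V g"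
  using assms is_iso_Arr by (intro iso_inv_equality) auto

lemma iso_inv_Idn [simp]: "x \<in> Obj V \<Longrightarrow> iso_inv V (Idn V x) = Idn V x"
  by (rule iso_inv_equality) auto

lemma Asc_simps [simp]:
  assumes "x \<in> Obj V" "y \<in> Obj V" "z \<in> Obj V"
  shows "Asc V x y z \<in> Arr V" "Dom V (Asc V x y z) = (x \<otimes> y) \<otimes> z"
    "Cod V (Asc V x y z) = x \<otimes> (y \<otimes> z)" "is_iso V (Asc V x y z)"
  using Asc_in_hom[OF assms] Asc_iso[OF assms] by (auto simp: in_hom_iff)

lemma Lun_simps [simp]:
  assumes "x \<in> Obj V"
  shows "Lun V x \<in> Arr V" "Dom V (Lun V x) = Unt V \<otimes> x" "Cod V (Lun V x) = x" "is_iso V (Lun V x)"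
  using Lun_in_hom[OF assms] Lun_iso[OF assms] by (auto simp: in_hom_iff)

lemma Run_simps [simp]:
  assumes "x \<in> Obj V"
  shows "Run V x \<in> Arr V" "Dom V (Run V x) = x \<otimes> Unt V" "Cod V (Run V x) = x" "is_iso V (Run V x)"
  using Run_in_hom[OF assms] Run_iso[OF assms] by (auto simp: in_hom_iff)

lemma Asc_nat:
  assumes "f \<in> Arr V" "g \<in> Arr V" "h \<in> Arr V" "Cod V f = x" "Cod V g = y" "Cod V h = z"
  shows "Asc V x y z \<cdot> ((f \<odot> g) \<odot> h) =
         (f \<odot> (g \<odot> h)) \<cdot> Asc V (Dom V f) (Dom V g) (Dom V h)"
  using Asc_natural[of f "Dom V f" "Cod V f" g "Dom V g" "Cod V g" h "Dom V h" "Cod V h"] assms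
  by (simp add: in_hom_iff)

lemma Asc_inv_nat:
  assumes "f \<in> Arr V" "g \<in> Arr V" "h \<in> Arr V" "Cod V f = x" "Cod V g = y" "Cod V h = z"
  shows "iso_inv V (Asc V x y z) \<cdot> (f \<odot> (g \<odot> h)) =
         ((f \<odot> g) \<odot> h) \<cdot> iso_inv V (Asc V (Dom V f) (Dom V g) (Dom V h))"
proof -
  have "f \<odot> (g \<odot> h) = (Asc V x y z \<cdot> ((f \<odot> g) \<odot> h)) \<cdot> iso_inv V (Asc V (Dom V f) (Dom V g) (Dom V h))"
    using assms Asc_nat[OF assms] by auto
  then show ?thesis using assms by auto
qed

lemma Lun_nat: "f \<in> Arr V \<Longrightarrow> Cod V f = x \<Longrightarrow> Lun V x \<cdot> (Idn V (Unt V) \<odot> f) = f \<cdot> Lun V (Dom V f)"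
  using Lun_natural[of f "Dom V f" "Cod V f"] by (auto simp: in_hom_iff)

lemma Run_nat: "f \<in> Arr V \<Longrightarrow> Cod V f = x \<Longrightarrow> Run V x \<cdot> (f \<odot> Idn V (Unt V)) = f \<cdot> Run V (Dom V f)"
  using Run_natural[of f "Dom V f" "Cod V f"] by (auto simp: in_hom_iff)

lemma Lun_inv_nat:
  assumes "f \<in> Arr V" "Dom V f = x"
  shows "(Idn V (Unt V) \<odot> f) \<cdot> iso_inv V (Lun V x) = iso_inv V (Lun V (Cod V f)) \<cdot> f"
proof -
  have "Lun V (Cod V f) \<cdot> ((Idn V (Unt V) \<odot> f) \<cdot> iso_inv V (Lun V x))
      = (Lun V (Cod V f) \<cdot> (Idn V (Unt V) \<odot> f)) \<cdot> iso_inv V (Lun V x)"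
    using assms by (subst Cmp_Cmp) auto
  also have "\<dots> = f" using assms by (auto simp: Lun_nat)
  finally show ?thesis using assms by (subst iso_cancel_left[of "Lun V (Cod V f)", symmetric]) auto
qed

lemma Run_inv_nat:
  assumes "f \<in> Arr V" "Dom V f = x"
  shows "(f \<odot> Idn V (Unt V)) \<cdot> iso_inv V (Run V x) = iso_inv V (Run V (Cod V f)) \<cdot> f"
proof -
  have "Run V (Cod V f) \<cdot> ((f \<odot> Idn V (Unt V)) \<cdot> iso_inv V (Run V x))
      = (Run V (Cod V f) \<cdot> (f \<odot> Idn V (Unt V))) \<cdot> iso_inv V (Run V x)"
    using assms by (subst Cmp_Cmp) auto
  also have "\<dots> = f" using assms by (auto simp: Run_nat)
  finally show ?thesis using assms by (subst iso_cancel_left[of "Run V (Cod V f)", symmetric]) auto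
qed

section \<open>Coherence of the unit constraints of a monoidal category\<close>

lemma Unt_TenA_cancel:
  assumes "f \<in> Arr V" "g \<in> Arr V" "Dom V f = Dom V g" "Cod V f = Cod V g"
    "Idn V (Unt V) \<odot> f = Idn V (Unt V) \<odot> g"
  shows "f = g"
proof -
  have "f \<cdot> Lun V (Dom V f) = g \<cdot> Lun V (Dom V f)"
    using assms Lun_nat[of f] Lun_nat[of g] by metis
  then show ?thesis using assms by (subst (asm) iso_cancel_right) auto
qed

lemma TenA_Unt_cancel:
  assumes "f \<in> Arr V" "g \<in> Arr V" "Dom V f = Dom V g" "Cod V f = Cod V g"
    "f \<odot> Idn V (Unt V) = g \<odot> Idn V (Unt V)"
  shows "f = g"
proof -
  have "f \<cdot> Run V (Dom V f) = g \<cdot> Run V (Dom V f)"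
    using assms Run_nat[of f] Run_nat[of g] by metis
  then show ?thesis using assms by (subst (asm) iso_cancel_right) auto
qed

lemma Run_TenO_Unt: "x \<in> Obj V \<Longrightarrow> Run V (x \<otimes> Unt V) = Run V x \<odot> Idn V (Unt V)"
  using Run_nat[of "Run V x" x] iso_cancel_left[of "Run V x" "Run V (x \<otimes> Unt V)" "Run V x \<odot> Idn V (Unt V)"]
  by auto

text \<open>Kelly's argument: tensoring with the unit is faithful, and after tensoring the equation
  follows from the pentagon with two units and two instances of the triangle.\<close>

lemma Lun_TenO:
  assumes [simp]: "x \<in> Obj V" "y \<in> Obj V"
  shows "Lun V (x \<otimes> y) \<cdot> Asc V (Unt V) x y = Lun V x \<odot> Idn V y"
proof (rule Unt_TenA_cancel)
  let ?I = "Unt V"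
  let ?u = "Asc V ?I (?I \<otimes> x) y \<cdot> (Asc V ?I ?I x \<odot> Idn V y)"
  have "(Idn V ?I \<odot> (Lun V (x \<otimes> y) \<cdot> Asc V ?I x y)) \<cdot> ?u
      = (Idn V ?I \<odot> Lun V (x \<otimes> y)) \<cdot> ((Idn V ?I \<odot> Asc V ?I x y) \<cdot> ?u)"
    by simp
  also have "\<dots> = (Idn V ?I \<odot> Lun V (x \<otimes> y)) \<cdot> (Asc V ?I ?I (x \<otimes> y) \<cdot> Asc V (?I \<otimes> ?I) x y)"
    by (subst pentagon) auto
  also have "\<dots> = ((Idn V ?I \<odot> Lun V (x \<otimes> y)) \<cdot> Asc V ?I ?I (x \<otimes> y)) \<cdot> Asc V (?I \<otimes> ?I) x y"
    by simp
  also have "\<dots> = (Run V ?I \<odot> (Idn V x \<odot> Idn V y)) \<cdot> Asc V (?I \<otimes> ?I) x y"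
    by (subst triangle) auto
  also have "\<dots> = Asc V ?I x y \<cdot> ((Run V ?I \<odot> Idn V x) \<odot> Idn V y)"
    by (subst Asc_nat) auto
  also have "\<dots> = Asc V ?I x y \<cdot> (((Idn V ?I \<odot> Lun V x) \<cdot> Asc V ?I ?I x) \<odot> Idn V y)"
    by (subst triangle) auto
  also have "\<dots> = Asc V ?I x y \<cdot> (((Idn V ?I \<odot> Lun V x) \<odot> Idn V y) \<cdot> (Asc V ?I ?I x \<odot> Idn V y))"
    by simp
  also have "\<dots> = (Asc V ?I x y \<cdot> ((Idn V ?I \<odot> Lun V x) \<odot> Idn V y)) \<cdot> (Asc V ?I ?I x \<odot> Idn V y)"
    by (subst Cmp_Cmp) auto
  also have "\<dots> = (Idn V ?I \<odot> (Lun V x \<odot> Idn V y)) \<cdot> ?u"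
    by (subst Asc_nat) auto
  finally show "Idn V ?I \<odot> (Lun V (x \<otimes> y) \<cdot> Asc V ?I x y) = Idn V ?I \<odot> (Lun V x \<odot> Idn V y)"
    by (subst (asm) iso_cancel_right) auto
qed auto

text \<open>The mirror image of the argument for \<open>Lun_TenO\<close>, with the two units on the
  right.\<close>

lemma Run_TenO:
  assumes [simp]: "x \<in> Obj V" "y \<in> Obj V"
  shows "(Idn V x \<odot> Run V y) \<cdot> Asc V x y (Unt V) = Run V (x \<otimes> y)"
proof (rule TenA_Unt_cancel)
  let ?I = "Unt V"
  have "Asc V x y ?I \<cdot> (((Idn V x \<odot> Run V y) \<cdot> Asc V x y ?I) \<odot> Idn V ?I)
      = Asc V x y ?I \<cdot> (((Idn V x \<odot> Run V y) \<odot> Idn V ?I) \<cdot> (Asc V x y ?I \<odot> Idn V ?I))"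
    by simp
  also have "\<dots> = (Asc V x y ?I \<cdot> ((Idn V x \<odot> Run V y) \<odot> Idn V ?I)) \<cdot> (Asc V x y ?I \<odot> Idn V ?I)"
    by (subst Cmp_Cmp) auto
  also have "\<dots> = (Idn V x \<odot> (Run V y \<odot> Idn V ?I)) \<cdot> Asc V x (y \<otimes> ?I) ?I \<cdot> (Asc V x y ?I \<odot> Idn V ?I)"
    by (subst Asc_nat) auto
  also have "\<dots> = (Idn V x \<odot> ((Idn V y \<odot> Lun V ?I) \<cdot> Asc V y ?I ?I)) \<cdot> Asc V x (y \<otimes> ?I) ?I \<cdot> (Asc V x y ?I \<odot> Idn V ?I)"
    by (subst triangle) auto
  also have "\<dots> = (Idn V x \<odot> (Idn V y \<odot> Lun V ?I)) \<cdot> ((Idn V x \<odot> Asc V y ?I ?I) \<cdot> Asc V x (y \<otimes> ?I) ?I \<cdot> (Asc V x y ?I \<odot> Idn V ?I))"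
    by simp
  also have "\<dots> = (Idn V x \<odot> (Idn V y \<odot> Lun V ?I)) \<cdot> (Asc V x y (?I \<otimes> ?I) \<cdot> Asc V (x \<otimes> y) ?I ?I)"
    by (subst pentagon) auto
  also have "\<dots> = ((Idn V x \<odot> (Idn V y \<odot> Lun V ?I)) \<cdot> Asc V x y (?I \<otimes> ?I)) \<cdot> Asc V (x \<otimes> y) ?I ?I"
    by (subst Cmp_Cmp) auto
  also have "\<dots> = (Asc V x y ?I \<cdot> ((Idn V x \<odot> Idn V y) \<odot> Lun V ?I)) \<cdot> Asc V (x \<otimes> y) ?I ?I"
    by (subst Asc_nat) auto
  also have "\<dots> = Asc V x y ?I \<cdot> ((Idn V (x \<otimes> y) \<odot> Lun V ?I) \<cdot> Asc V (x \<otimes> y) ?I ?I)"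
    by simp
  also have "\<dots> = Asc V x y ?I \<cdot> (Run V (x \<otimes> y) \<odot> Idn V ?I)"
    by (subst triangle) auto
  finally show "((Idn V x \<odot> Run V y) \<cdot> Asc V x y ?I) \<odot> Idn V ?I = Run V (x \<otimes> y) \<odot> Idn V ?I"
    by (subst (asm) iso_cancel_left) auto
qed auto

text \<open>The triangle at two units and \<open>Run_TenO\<close> express the same arrow, once
  through \<open>Lun\<close> and once through \<open>Run\<close>; faithfulness of tensoring with the
  unit finishes the proof.\<close>

lemma Lun_Unt: "Lun V (Unt V) = Run V (Unt V)"
proof (rule Unt_TenA_cancel)
  let ?I = "Unt V"
  have "(Idn V ?I \<odot> Lun V ?I) \<cdot> Asc V ?I ?I ?I = Run V ?I \<odot> Idn V ?I"
    by (rule triangle) auto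
  also have "\<dots> = (Idn V ?I \<odot> Run V ?I) \<cdot> Asc V ?I ?I ?I"
    using Run_TenO[of ?I ?I] Run_TenO_Unt[of ?I] by simp
  finally show "Idn V ?I \<odot> Lun V ?I = Idn V ?I \<odot> Run V ?I"
    by (subst (asm) iso_cancel_right) auto
qed auto

lemma TenA_Lun_Asc_inv:
  assumes "x \<in> Obj V" "y \<in> Obj V"
  shows "(Lun V x \<odot> Idn V y) \<cdot> iso_inv V (Asc V (Unt V) x y) = Lun V (x \<otimes> y)"
  using iso_move_right[OF Lun_TenO[OF assms]] assms by simp

lemma Asc_TenA_Lun_inv:
  assumes "x \<in> Obj V" "y \<in> Obj V"
  shows "Asc V (Unt V) x y \<cdot> (iso_inv V (Lun V x) \<odot> Idn V y) = iso_inv V (Lun V (x \<otimes> y))"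
proof -
  have "iso_inv V (Lun V (x \<otimes> y)) = iso_inv V ((Lun V x \<odot> Idn V y) \<cdot> iso_inv V (Asc V (Unt V) x y))"
    using assms by (simp add: TenA_Lun_Asc_inv)
  also have "\<dots> = Asc V (Unt V) x y \<cdot> (iso_inv V (Lun V x) \<odot> Idn V y)"
    using assms by (subst iso_inv_Cmp) auto
  finally show ?thesis by simp
qed

lemma TenA_Run_Asc_inv:
  assumes "x \<in> Obj V" "y \<in> Obj V"
  shows "(Run V x \<odot> Idn V y) \<cdot> iso_inv V (Asc V x (Unt V) y) = Idn V x \<odot> Lun V y"
  using iso_move_right[OF triangle[OF assms]] assms by simp

lemma Asc_TenA_Run_inv:
  assumes "x \<in> Obj V" "y \<in> Obj V"
  shows "Asc V x (Unt V) y \<cdot> (iso_inv V (Run V x) \<odot> Idn V y) = Idn V x \<odot> iso_inv V (Lun V y)"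
proof -
  have "Idn V x \<odot> iso_inv V (Lun V y) = iso_inv V (Idn V x \<odot> Lun V y)" using assms by simp
  also have "\<dots> = iso_inv V ((Run V x \<odot> Idn V y) \<cdot> iso_inv V (Asc V x (Unt V) y))"
    using assms by (simp add: TenA_Run_Asc_inv)
  also have "\<dots> = Asc V x (Unt V) y \<cdot> (iso_inv V (Run V x) \<odot> Idn V y)"
    using assms by (subst iso_inv_Cmp) auto
  finally show ?thesis by simp
qed

end

section \<open>Generalised elements\<close>

context category
begin

definition epi :: "'m \<Rightarrow> bool" where
  "epi e \<longleftrightarrow> e \<in> Arr V \<and>
     (\<forall>f \<in> Arr V. \<forall>g \<in> Arr V. Dom V f = Cod V e \<and> Dom V g = Cod V e \<and> f \<cdot> e = g \<cdot> e \<longrightarrow> f = g)"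

lemma epiD: "\<lbrakk>f \<cdot> e = g \<cdot> e; epi e; f \<in> Arr V; g \<in> Arr V; Dom V f = Cod V e; Dom V g = Cod V e\<rbrakk> \<Longrightarrow> f = g"
  by (auto simp: epi_def)

lemma epi_iso: "is_iso V e \<Longrightarrow> epi e"
  by (auto simp: epi_def is_iso_Arr iso_cancel_right)

lemma epi_Cmp:
  assumes "epi f" "epi g" "Dom V g = Cod V f" shows "epi (g \<cdot> f)"
  unfolding epi_def
proof (intro conjI ballI impI)
  fix h k assume "h \<in> Arr V" "k \<in> Arr V"
    and "Dom V h = Cod V (g \<cdot> f) \<and> Dom V k = Cod V (g \<cdot> f) \<and> h \<cdot> g \<cdot> f = k \<cdot> g \<cdot> f"
  then have "(h \<cdot> g) \<cdot> f = (k \<cdot> g) \<cdot> f" "h \<in> Arr V" "k \<in> Arr V" "Dom V h = Cod V g" "Dom V k = Cod V g"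
    using assms by (auto simp: epi_def)
  then have "h \<cdot> g = k \<cdot> g" using assms by (auto simp: epi_def intro: epiD[of _ f])
  then show "h = k" using assms \<open>h \<in> Arr V\<close> \<open>k \<in> Arr V\<close> \<open>Dom V h = Cod V g\<close> \<open>Dom V k = Cod V g\<close>
    by (auto intro: epiD[of _ g])
qed (use assms in \<open>auto simp: epi_def\<close>)

text \<open>This serves to move associativity and unit constraints off an epimorphism:
  \<open>e'\<close> is e composed with v and the inverse of u.\<close>

lemma epi_conjugate:
  assumes "epi e" "v \<cdot> e = e' \<cdot> u" "is_iso V u" "is_iso V v" "e' \<in> Arr V"
    "Dom V v = Cod V e" "Dom V e' = Cod V u"
  shows "epi e'"
proof -
  have e: "e \<in> Arr V" "u \<in> Arr V" "v \<in> Arr V" using assms is_iso_Arr by (auto simp: epi_def)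
  have "e' = (e' \<cdot> u) \<cdot> iso_inv V u" using assms e by simp
  also have "\<dots> = (v \<cdot> e) \<cdot> iso_inv V u" using assms by simp
  finally have e': "e' = (v \<cdot> e) \<cdot> iso_inv V u" .
  have "Dom V (v \<cdot> e) = Dom V e" "Dom V (e' \<cdot> u) = Dom V u" using e assms(5,6,7) by auto
  then have "Dom V e = Dom V u" using assms(2) by simp
  then have "epi ((v \<cdot> e) \<cdot> iso_inv V u)"
    using assms(1,3,4,6) e by (intro epi_Cmp[OF epi_iso epi_Cmp[OF _ epi_iso]]) auto
  then show ?thesis using e' by simp
qed

lemma epi_coequalizer:
  assumes "is_coequalizer V f g e" shows "epi e"
  unfolding epi_def
proof (intro conjI ballI impI)
  have 1: "f \<in> Arr V" "g \<in> Arr V" "Dom V g = Dom V f" "Cod V g = Cod V f" "e \<in> Arr V"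
    "Dom V e = Cod V f" "e \<cdot> f = e \<cdot> g"
    and univ: "\<And>z h. \<lbrakk>h \<in> hom V (Cod V f) z; h \<cdot> f = h \<cdot> g\<rbrakk>
      \<Longrightarrow> \<exists>!k. k \<in> hom V (Cod V e) z \<and> k \<cdot> e = h"
    using assms by (auto simp: is_coequalizer_def in_hom_iff)
  show "e \<in> Arr V" by fact
  fix h k assume h: "h \<in> Arr V" "k \<in> Arr V"
    and hk: "Dom V h = Cod V e \<and> Dom V k = Cod V e \<and> h \<cdot> e = k \<cdot> e"
  then have "Cod V (h \<cdot> e) = Cod V (k \<cdot> e)" by simp
  moreover have "Cod V (h \<cdot> e) = Cod V h" "Cod V (k \<cdot> e) = Cod V k"
    using 1(5) h hk by (blast intro: Cmp_simps)+
  ultimately have "Cod V h = Cod V k" by simp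
  moreover have "\<exists>!l. l \<in> hom V (Cod V e) (Cod V h) \<and> l \<cdot> e = h \<cdot> e"
    using 1 h(1) conjunct1[OF hk] by (intro univ) (auto simp: in_hom_iff)
  moreover have "h \<in> hom V (Cod V e) (Cod V h) \<and> h \<cdot> e = h \<cdot> e"
    "k \<in> hom V (Cod V e) (Cod V k) \<and> k \<cdot> e = h \<cdot> e" using h hk by (auto simp: in_hom_iff)
  ultimately show "h = k" by metis
qed

end

context monoidal_category
begin

text \<open>Tensoring on both sides at once makes the class closed under tensoring on either side;
  the chosen bracketing is immaterial by \<open>epi_conjugate\<close>.\<close>

definition stably_epi :: "'m \<Rightarrow> bool" where
  "stably_epi e \<longleftrightarrow> e \<in> Arr V \<and> (\<forall>z \<in> Obj V. \<forall>w \<in> Obj V. epi ((Idn V z \<odot> e) \<odot> Idn V w))"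

lemma stably_epi_Arr: "stably_epi e \<Longrightarrow> e \<in> Arr V"
  by (simp add: stably_epi_def)

lemma stably_epi_iso: "is_iso V e \<Longrightarrow> stably_epi e"
  by (simp add: stably_epi_def epi_iso is_iso_Arr)

text \<open>The case z = w = I, with the units removed by naturality of \<open>Lun\<close> and
  \<open>Run\<close>.\<close>

lemma stably_epi_epi:
  assumes "stably_epi e" shows "epi e"
proof -
  have e [simp]: "e \<in> Arr V" using assms by (rule stably_epi_Arr)
  have 0: "Lun V (Cod V e) \<cdot> Run V (Unt V \<otimes> Cod V e) \<cdot> ((Idn V (Unt V) \<odot> e) \<odot> Idn V (Unt V))
      = e \<cdot> Lun V (Dom V e) \<cdot> Run V (Unt V \<otimes> Dom V e)"
    using Cmp_extend[OF Lun_nat[of e "Cod V e"], of "Run V (Unt V \<otimes> Dom V e)"]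
    by (simp add: Run_nat)
  show ?thesis
    by (rule epi_conjugate[of "(Idn V (Unt V) \<odot> e) \<odot> Idn V (Unt V)"
      "Lun V (Cod V e) \<cdot> Run V (Unt V \<otimes> Cod V e)" e "Lun V (Dom V e) \<cdot> Run V (Unt V \<otimes> Dom V e)"])
      (use assms 0 in \<open>auto simp: stably_epi_def\<close>)
qed

lemma stably_epi_Cmp:
  assumes "stably_epi f" "stably_epi g" "Dom V g = Cod V f" shows "stably_epi (g \<cdot> f)"
  unfolding stably_epi_def
proof (intro conjI ballI)
  have 1: "f \<in> Arr V" "g \<in> Arr V" using assms by (auto simp: stably_epi_def)
  then show "g \<cdot> f \<in> Arr V" using assms by simp
  fix z w assume "z \<in> Obj V" "w \<in> Obj V"
  then have "epi (((Idn V z \<odot> g) \<odot> Idn V w) \<cdot> ((Idn V z \<odot> f) \<odot> Idn V w))"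
    using assms 1 by (intro epi_Cmp) (auto simp: stably_epi_def)
  then show "epi ((Idn V z \<odot> (g \<cdot> f)) \<odot> Idn V w)"
    using assms 1 \<open>z \<in> Obj V\<close> \<open>w \<in> Obj V\<close> by simp
qed

lemma stably_epi_TenA_left:
  assumes "stably_epi e" and [simp]: "x \<in> Obj V" shows "stably_epi (Idn V x \<odot> e)"
  unfolding stably_epi_def
proof (intro conjI ballI)
  have e [simp]: "e \<in> Arr V" using assms by (auto simp: stably_epi_def)
  show "Idn V x \<odot> e \<in> Arr V" by simp
  fix z w assume [simp]: "z \<in> Obj V" "w \<in> Obj V"
  have 0: "Asc V z x (Cod V e) \<cdot> (Idn V (z \<otimes> x) \<odot> e) = (Idn V z \<odot> (Idn V x \<odot> e)) \<cdot> Asc V z x (Dom V e)"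
    using Asc_nat[of "Idn V z" "Idn V x" e z x "Cod V e"] by simp
  show "epi ((Idn V z \<odot> (Idn V x \<odot> e)) \<odot> Idn V w)"
    by (rule epi_conjugate[of "(Idn V (z \<otimes> x) \<odot> e) \<odot> Idn V w" "Asc V z x (Cod V e) \<odot> Idn V w" _
      "Asc V z x (Dom V e) \<odot> Idn V w"])
      (use assms 0 in \<open>auto simp: stably_epi_def\<close>)
qed

lemma stably_epi_TenA_right:
  assumes "stably_epi e" and [simp]: "x \<in> Obj V" shows "stably_epi (e \<odot> Idn V x)"
  unfolding stably_epi_def
proof (intro conjI ballI)
  have e [simp]: "e \<in> Arr V" using assms by (auto simp: stably_epi_def)
  show "e \<odot> Idn V x \<in> Arr V" by simp
  fix z w assume [simp]: "z \<in> Obj V" "w \<in> Obj V"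
  have 1: "Asc V z (Cod V e) x \<cdot> ((Idn V z \<odot> e) \<odot> Idn V x) = (Idn V z \<odot> (e \<odot> Idn V x)) \<cdot> Asc V z (Dom V e) x"
    using Asc_nat[of "Idn V z" e "Idn V x" z "Cod V e" x] by simp
  have 2: "iso_inv V (Asc V (z \<otimes> Cod V e) x w) \<cdot> ((Idn V z \<odot> e) \<odot> Idn V (x \<otimes> w))
      = (((Idn V z \<odot> e) \<odot> Idn V x) \<odot> Idn V w) \<cdot> iso_inv V (Asc V (z \<otimes> Dom V e) x w)"
    using Asc_inv_nat[of "Idn V z \<odot> e" "Idn V x" "Idn V w" "z \<otimes> Cod V e" x w] by simp
  have "epi (((Idn V z \<odot> e) \<odot> Idn V x) \<odot> Idn V w)"
    by (rule epi_conjugate[of "(Idn V z \<odot> e) \<odot> Idn V (x \<otimes> w)" "iso_inv V (Asc V (z \<otimes> Cod V e) x w)" _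
      "iso_inv V (Asc V (z \<otimes> Dom V e) x w)"])
      (use assms 2 in \<open>auto simp: stably_epi_def\<close>)
  then show "epi ((Idn V z \<odot> (e \<odot> Idn V x)) \<odot> Idn V w)"
    by (rule epi_conjugate[of _ "Asc V z (Cod V e) x \<odot> Idn V w" _ "Asc V z (Dom V e) x \<odot> Idn V w"])
      (use 1 in auto)
qed

lemma stably_epi_TenA:
  assumes "stably_epi e" "stably_epi f" shows "stably_epi (e \<odot> f)"
proof -
  have [simp]: "e \<in> Arr V" "f \<in> Arr V" using assms by (auto simp: stably_epi_def)
  \<comment> \<open>A tensor product of two arrows is a composite of two one-sided ones.\<close>
  have "stably_epi ((e \<odot> Idn V (Cod V f)) \<cdot> (Idn V (Dom V e) \<odot> f))"
    using assms by (intro stably_epi_Cmp stably_epi_TenA_left stably_epi_TenA_right) auto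
  then show ?thesis by simp
qed

text \<open>Bracketed to the right and closed by the unit. Concatenation of lists is strictly
  associative; its comparison with the tensor product is left to \<open>split\<close>.\<close>

primrec ten :: "'o list \<Rightarrow> 'o" where
  "ten [] = Unt V"
| "ten (x # xs) = x \<otimes> ten xs"

text \<open>The coherence isomorphism from \<open>ten (xs @ ys)\<close> to
  \<open>ten xs \<otimes> ten ys\<close>. It points in this direction because elements are maps out
  of \<open>ten\<close>.\<close>

primrec split :: "'o list \<Rightarrow> 'o list \<Rightarrow> 'm" where
  "split [] ys = iso_inv V (Lun V (ten ys))"
| "split (x # xs) ys = iso_inv V (Asc V x (ten xs) (ten ys)) \<cdot> (Idn V x \<odot> split xs ys)"

lemma ten_Obj [simp]: "set xs \<subseteq> Obj V \<Longrightarrow> ten xs \<in> Obj V"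
  by (induction xs) auto

lemma split_simps [simp]:
  assumes "set xs \<subseteq> Obj V" "set ys \<subseteq> Obj V"
  shows "split xs ys \<in> Arr V" "Dom V (split xs ys) = ten (xs @ ys)"
    "Cod V (split xs ys) = ten xs \<otimes> ten ys" "is_iso V (split xs ys)"
proof -
  have "split xs ys \<in> Arr V \<and> Dom V (split xs ys) = ten (xs @ ys) \<and>
     Cod V (split xs ys) = ten xs \<otimes> ten ys \<and> is_iso V (split xs ys)"
    using assms by (induction xs) auto
  then show "split xs ys \<in> Arr V" "Dom V (split xs ys) = ten (xs @ ys)"
    "Cod V (split xs ys) = ten xs \<otimes> ten ys" "is_iso V (split xs ys)" by auto
qed

text \<open>Base case by \<open>Lun_Unt\<close>, step by \<open>Run_TenO\<close>. It turns a
  constant in the right argument of \<open>bil\<close> into a right unit constraint.\<close>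

lemma split_Nil: "set xs \<subseteq> Obj V \<Longrightarrow> split xs [] = iso_inv V (Run V (ten xs))"
proof (induction xs)
  case Nil
  then show ?case by (simp add: Lun_Unt)
next
  case (Cons x xs)
  then have x [simp]: "x \<in> Obj V" "ten xs \<in> Obj V" by auto
  have "iso_inv V (Run V (x \<otimes> ten xs)) = iso_inv V ((Idn V x \<odot> Run V (ten xs)) \<cdot> Asc V x (ten xs) (Unt V))"
    by (simp add: Run_TenO)
  also have "\<dots> = iso_inv V (Asc V x (ten xs) (Unt V)) \<cdot> (Idn V x \<odot> iso_inv V (Run V (ten xs)))"
    by (subst iso_inv_Cmp) auto
  finally show ?case using Cons by simp
qed

text \<open>The one coherence statement behind strict associativity of elements: the two ways of
  splitting a threefold list differ by \<open>Asc\<close>. The empty list uses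
  \<open>Lun_TenO\<close>, the induction step the pentagon.\<close>

lemma split_split:
  assumes "set xs \<subseteq> Obj V" "set ys \<subseteq> Obj V" "set zs \<subseteq> Obj V"
  shows "Asc V (ten xs) (ten ys) (ten zs) \<cdot> (split xs ys \<odot> Idn V (ten zs)) \<cdot> split (xs @ ys) zs =
         (Idn V (ten xs) \<odot> split ys zs) \<cdot> split xs (ys @ zs)"
  using assms
proof (induction xs)
  case Nil
  let ?Y = "ten ys" and ?Z = "ten zs" and ?I = "Unt V"
  have [simp]: "?Y \<in> Obj V" "?Z \<in> Obj V" using Nil by auto
  have "Lun V (?Y \<otimes> ?Z) \<cdot> Asc V ?I ?Y ?Z \<cdot> (iso_inv V (Lun V ?Y) \<odot> Idn V ?Z) = Idn V (?Y \<otimes> ?Z)"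
    using Cmp_extend[OF Lun_TenO[of ?Y ?Z], of "iso_inv V (Lun V ?Y) \<odot> Idn V ?Z"] by simp
  then have "Asc V ?I ?Y ?Z \<cdot> (iso_inv V (Lun V ?Y) \<odot> Idn V ?Z) = iso_inv V (Lun V (?Y \<otimes> ?Z)) \<cdot> Idn V (?Y \<otimes> ?Z)"
    by (rule iso_move_left) auto
  then have "Asc V ?I ?Y ?Z \<cdot> (iso_inv V (Lun V ?Y) \<odot> Idn V ?Z) = iso_inv V (Lun V (?Y \<otimes> ?Z))"
    by simp
  then have "Asc V ?I ?Y ?Z \<cdot> (iso_inv V (Lun V ?Y) \<odot> Idn V ?Z) \<cdot> split ys zs
     = iso_inv V (Lun V (?Y \<otimes> ?Z)) \<cdot> split ys zs"
    using Nil by (intro Cmp_extend) auto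
  then show ?case using Nil Lun_inv_nat[of "split ys zs" "ten (ys @ zs)"] by simp
next
  case (Cons x xs)
  let ?X = "ten xs" and ?Y = "ten ys" and ?Z = "ten zs"
  let ?iA = "\<lambda>x y z. iso_inv V (Asc V x y z)"
  have [simp]: "?Y \<in> Obj V" "?Z \<in> Obj V" "?X \<in> Obj V" "x \<in> Obj V" "set xs \<subseteq> Obj V" "set ys \<subseteq> Obj V"
    "set zs \<subseteq> Obj V" "ten (xs @ ys) \<in> Obj V" using Cons by auto
  \<comment> \<open>The pentagon rearranged for the inverse associators that the recursion of
    \<open>split\<close> produces.\<close>
  have pent: "Asc V (x \<otimes> ?X) ?Y ?Z \<cdot> (?iA x ?X ?Y \<odot> Idn V ?Z) \<cdot> ?iA x (?X \<otimes> ?Y) ?Z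
      = ?iA x ?X (?Y \<otimes> ?Z) \<cdot> (Idn V x \<odot> Asc V ?X ?Y ?Z)"
  proof -
    have "Asc V x ?X (?Y \<otimes> ?Z) \<cdot> (Asc V (x \<otimes> ?X) ?Y ?Z \<cdot> (?iA x ?X ?Y \<odot> Idn V ?Z) \<cdot> ?iA x (?X \<otimes> ?Y) ?Z)
      = (Asc V x ?X (?Y \<otimes> ?Z) \<cdot> Asc V (x \<otimes> ?X) ?Y ?Z) \<cdot> (?iA x ?X ?Y \<odot> Idn V ?Z) \<cdot> ?iA x (?X \<otimes> ?Y) ?Z"
      by simp
    also have "\<dots> = Idn V x \<odot> Asc V ?X ?Y ?Z"
      by (subst pentagon) auto
    finally show ?thesis by (rule iso_move_left) auto
  qed
  have "Asc V (x \<otimes> ?X) ?Y ?Z \<cdot> ((?iA x ?X ?Y \<cdot> (Idn V x \<odot> split xs ys)) \<odot> Idn V ?Z)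
           \<cdot> ?iA x (ten (xs @ ys)) ?Z \<cdot> (Idn V x \<odot> split (xs @ ys) zs)
      = Asc V (x \<otimes> ?X) ?Y ?Z \<cdot> (?iA x ?X ?Y \<odot> Idn V ?Z) \<cdot> (((Idn V x \<odot> split xs ys) \<odot> Idn V ?Z)
           \<cdot> ?iA x (ten (xs @ ys)) ?Z) \<cdot> (Idn V x \<odot> split (xs @ ys) zs)"
    by simp
  also have "((Idn V x \<odot> split xs ys) \<odot> Idn V ?Z) \<cdot> ?iA x (ten (xs @ ys)) ?Z
      = ?iA x (?X \<otimes> ?Y) ?Z \<cdot> (Idn V x \<odot> (split xs ys \<odot> Idn V ?Z))"
    using Asc_inv_nat[of "Idn V x" "split xs ys" "Idn V ?Z" x "?X \<otimes> ?Y" ?Z] by simp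
  also have "Asc V (x \<otimes> ?X) ?Y ?Z \<cdot> (?iA x ?X ?Y \<odot> Idn V ?Z) \<cdot>
        (?iA x (?X \<otimes> ?Y) ?Z \<cdot> (Idn V x \<odot> (split xs ys \<odot> Idn V ?Z))) \<cdot> (Idn V x \<odot> split (xs @ ys) zs)
      = (Asc V (x \<otimes> ?X) ?Y ?Z \<cdot> (?iA x ?X ?Y \<odot> Idn V ?Z) \<cdot> ?iA x (?X \<otimes> ?Y) ?Z)
         \<cdot> (Idn V x \<odot> ((split xs ys \<odot> Idn V ?Z) \<cdot> split (xs @ ys) zs))"
    by simp
  also have "\<dots> = ?iA x ?X (?Y \<otimes> ?Z) \<cdot> (Idn V x \<odot> (Asc V ?X ?Y ?Z \<cdot> (split xs ys \<odot> Idn V ?Z) \<cdot> split (xs @ ys) zs))"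
    unfolding pent by simp
  also have "\<dots> = ?iA x ?X (?Y \<otimes> ?Z) \<cdot> (Idn V x \<odot> (Idn V ?X \<odot> split ys zs)) \<cdot> (Idn V x \<odot> split xs (ys @ zs))"
    using Cons by simp
  also have "\<dots> = (?iA x ?X (?Y \<otimes> ?Z) \<cdot> (Idn V x \<odot> (Idn V ?X \<odot> split ys zs))) \<cdot> (Idn V x \<odot> split xs (ys @ zs))"
    by (subst Cmp_Cmp) auto
  also have "\<dots> = (Idn V (x \<otimes> ?X) \<odot> split ys zs) \<cdot> ?iA x ?X (ten (ys @ zs)) \<cdot> (Idn V x \<odot> split xs (ys @ zs))"
    by (subst Asc_inv_nat) auto
  finally show ?case by simp
qed

section \<open>Elements with stages and bilinear operations on them\<close>

definition elem :: "'o list \<times> 'm \<Rightarrow> bool" where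
  "elem a \<longleftrightarrow> set (fst a) \<subseteq> Obj V \<and> snd a \<in> Arr V \<and> Dom V (snd a) = ten (fst a)"

definition obj :: "'o list \<times> 'm \<Rightarrow> 'o" where
  "obj a = Cod V (snd a)"

definition app :: "'m \<Rightarrow> 'o list \<times> 'm \<Rightarrow> 'o list \<times> 'm" where
  "app f a = (fst a, f \<cdot> snd a)"

definition bil :: "'m \<Rightarrow> 'o list \<times> 'm \<Rightarrow> 'o list \<times> 'm \<Rightarrow> 'o list \<times> 'm" where
  "bil r a b = (fst a @ fst b, r \<cdot> (snd a \<odot> snd b) \<cdot> split (fst a) (fst b))"

text \<open>The generic element. Its single stage x has tensor product x \<otimes> I, so
  \<open>Run\<close> stands for the identity.\<close>

definition gen :: "'o \<Rightarrow> 'o list \<times> 'm" where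
  "gen x = ([x], Run V x)"

text \<open>Without stages an element is a map out of the unit, that is, an element in the usual
  sense.\<close>

definition con :: "'m \<Rightarrow> 'o list \<times> 'm" where
  "con e = ([], e)"

definition dense :: "'o list \<times> 'm \<Rightarrow> bool" where
  "dense a \<longleftrightarrow> elem a \<and> stably_epi (snd a)"

lemma elem_obj [simp]: "elem a \<Longrightarrow> obj a \<in> Obj V"
  by (simp add: elem_def obj_def)

lemma elem_app [simp]: "elem a \<Longrightarrow> f \<in> Arr V \<Longrightarrow> Dom V f = obj a \<Longrightarrow> elem (app f a)"
  and obj_app [simp]: "elem a \<Longrightarrow> f \<in> Arr V \<Longrightarrow> Dom V f = obj a \<Longrightarrow> obj (app f a) = Cod V f"
  by (simp_all add: elem_def obj_def app_def)

lemma elem_bil [simp]: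
  "\<lbrakk>elem a; elem b; r \<in> Arr V; Dom V r = obj a \<otimes> obj b\<rbrakk> \<Longrightarrow> elem (bil r a b)"
  and obj_bil [simp]:
  "\<lbrakk>elem a; elem b; r \<in> Arr V; Dom V r = obj a \<otimes> obj b\<rbrakk> \<Longrightarrow> obj (bil r a b) = Cod V r"
  by (simp_all add: elem_def obj_def bil_def)

lemma elem_gen [simp]: "x \<in> Obj V \<Longrightarrow> elem (gen x)" "x \<in> Obj V \<Longrightarrow> obj (gen x) = x"
  by (simp_all add: elem_def gen_def obj_def)

lemma elem_con [simp]: "e \<in> Arr V \<Longrightarrow> Dom V e = Unt V \<Longrightarrow> elem (con e)" "obj (con e) = Cod V e"
  by (simp_all add: elem_def con_def obj_def)

lemma dense_elem [simp]: "dense a \<Longrightarrow> elem a"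
  by (simp add: dense_def)

lemma dense_gen [simp]: "x \<in> Obj V \<Longrightarrow> dense (gen x)"
  by (simp add: dense_def gen_def stably_epi_iso elem_def)

lemma dense_bil:
  assumes "dense a" "dense b" "stably_epi r" "Dom V r = obj a \<otimes> obj b"
  shows "dense (bil r a b)"
proof -
  have a: "set (fst a) \<subseteq> Obj V" "snd a \<in> Arr V" "Dom V (snd a) = ten (fst a)"
    "set (fst b) \<subseteq> Obj V" "snd b \<in> Arr V" "Dom V (snd b) = ten (fst b)" "r \<in> Arr V"
    using assms by (auto simp: dense_def elem_def stably_epi_Arr)
  have "stably_epi (r \<cdot> (snd a \<odot> snd b) \<cdot> split (fst a) (fst b))"
    using assms a by (intro stably_epi_Cmp stably_epi_TenA stably_epi_iso[of "split _ _"])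
      (auto simp: dense_def obj_def)
  then show ?thesis using a assms by (auto simp: dense_def elem_def obj_def bil_def)
qed

lemma app_bil [simp]:
  "\<lbrakk>elem a; elem b; r \<in> Arr V; Dom V r = obj a \<otimes> obj b; f \<in> Arr V; Dom V f = Cod V r\<rbrakk>
     \<Longrightarrow> app f (bil r a b) = bil (f \<cdot> r) a b"
  by (simp add: bil_def app_def elem_def obj_def)

lemma bil_app_left:
  "\<lbrakk>elem a; elem b; f \<in> Arr V; Dom V f = obj a; r \<in> Arr V; Dom V r = Cod V f \<otimes> obj b\<rbrakk>
     \<Longrightarrow> bil r (app f a) b = bil (r \<cdot> (f \<odot> Idn V (obj b))) a b"
  by (simp add: bil_def app_def elem_def obj_def)

lemma bil_app_right:
  "\<lbrakk>elem a; elem b; f \<in> Arr V; Dom V f = obj b; r \<in> Arr V; Dom V r = obj a \<otimes> Cod V f\<rbrakk>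
     \<Longrightarrow> bil r a (app f b) = bil (r \<cdot> (Idn V (obj a) \<odot> f)) a b"
  by (simp add: bil_def app_def elem_def obj_def)

lemma bil_TenA:
  assumes "elem x" "elem y" "f \<in> Arr V" "Dom V f = obj x" "g \<in> Arr V" "Dom V g = obj y"
    "r \<in> Arr V" "Dom V r = Cod V f \<otimes> Cod V g"
  shows "bil (r \<cdot> (f \<odot> g)) x y = bil r (app f x) (app g y)"
  using assms by (simp add: bil_def app_def elem_def obj_def)

lemma app_app: "\<lbrakk>elem a; f \<in> Arr V; Dom V f = obj a; g \<in> Arr V; Dom V g = Cod V f\<rbrakk>
   \<Longrightarrow> app g (app f a) = app (g \<cdot> f) a"
  by (simp add: app_def elem_def obj_def)

lemma app_Idn: "elem a \<Longrightarrow> obj a = x \<Longrightarrow> app (Idn V x) a = a"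
  by (auto simp: app_def elem_def obj_def prod_eq_iff)

text \<open>Fixing a constant argument makes a bilinear operation linear. The resulting map has the
  shape of \<open>postcomp\<close> and \<open>lwhisker\<close>; \<open>bil_con_right\<close>
  produces that of \<open>precomp\<close> and \<open>rwhisker\<close>.\<close>

lemma bil_con_left:
  assumes "e \<in> Arr V" "Dom V e = Unt V" "elem b" "r \<in> Arr V" "Dom V r = Cod V e \<otimes> obj b"
  shows "bil r (con e) b = app (r \<cdot> (e \<odot> Idn V (obj b)) \<cdot> iso_inv V (Lun V (obj b))) b"
proof -
  let ?f = "snd b"
  have b: "?f \<in> Arr V" "Dom V ?f = ten (fst b)" "obj b = Cod V ?f" "set (fst b) \<subseteq> Obj V"
    using assms by (auto simp: elem_def obj_def)
  have "(e \<odot> ?f) \<cdot> iso_inv V (Lun V (Dom V ?f))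
      = (e \<odot> Idn V (obj b)) \<cdot> ((Idn V (Unt V) \<odot> ?f) \<cdot> iso_inv V (Lun V (Dom V ?f)))"
    using assms b by simp
  also have "\<dots> = (e \<odot> Idn V (obj b)) \<cdot> (iso_inv V (Lun V (obj b)) \<cdot> ?f)"
    using b Lun_inv_nat[of ?f "Dom V ?f"] by simp
  finally have "(e \<odot> ?f) \<cdot> iso_inv V (Lun V (ten (fst b)))
    = (e \<odot> Idn V (obj b)) \<cdot> (iso_inv V (Lun V (obj b)) \<cdot> ?f)" using b by simp
  then show ?thesis using assms b by (simp add: bil_def app_def con_def)
qed

lemma bil_con_right:
  assumes "e \<in> Arr V" "Dom V e = Unt V" "elem a" "r \<in> Arr V" "Dom V r = obj a \<otimes> Cod V e"
  shows "bil r a (con e) = app (r \<cdot> (Idn V (obj a) \<odot> e) \<cdot> iso_inv V (Run V (obj a))) a"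
proof -
  let ?f = "snd a"
  have b: "?f \<in> Arr V" "Dom V ?f = ten (fst a)" "obj a = Cod V ?f" "set (fst a) \<subseteq> Obj V"
    using assms by (auto simp: elem_def obj_def)
  have "(?f \<odot> e) \<cdot> iso_inv V (Run V (Dom V ?f))
      = (Idn V (obj a) \<odot> e) \<cdot> ((?f \<odot> Idn V (Unt V)) \<cdot> iso_inv V (Run V (Dom V ?f)))"
    using assms b by simp
  also have "\<dots> = (Idn V (obj a) \<odot> e) \<cdot> (iso_inv V (Run V (obj a)) \<cdot> ?f)"
    using b Run_inv_nat[of ?f "Dom V ?f"] by simp
  finally have "(?f \<odot> e) \<cdot> iso_inv V (Run V (ten (fst a)))
    = (Idn V (obj a) \<odot> e) \<cdot> (iso_inv V (Run V (obj a)) \<cdot> ?f)" using b by simp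
  then show ?thesis using assms b by (simp add: bil_def app_def con_def split_Nil)
qed

text \<open>Both bracketings are brought to a common right factor made of the three elements and
  \<open>split\<close>, so that only coefficients remain to be compared. For the other bracketing
  this is where \<open>split_split\<close> enters.\<close>

lemma bil_assoc_left:
  assumes "elem a" "elem b" "elem c" "s \<in> Arr V" "Dom V s = obj a \<otimes> obj b"
    "r \<in> Arr V" "Dom V r = Cod V s \<otimes> obj c"
  shows "snd (bil r (bil s a b) c) = (r \<cdot> (s \<odot> Idn V (obj c))) \<cdot> ((snd a \<odot> snd b) \<odot> snd c)
    \<cdot> (split (fst a) (fst b) \<odot> Idn V (ten (fst c))) \<cdot> split (fst a @ fst b) (fst c)"
  using assms by (simp add: bil_def elem_def obj_def)

lemma bil_assoc_right:
  assumes "elem a" "elem b" "elem c" "s \<in> Arr V" "Dom V s = obj b \<otimes> obj c"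
    "r \<in> Arr V" "Dom V r = obj a \<otimes> Cod V s"
  shows "snd (bil r a (bil s b c)) = (r \<cdot> (Idn V (obj a) \<odot> s) \<cdot> Asc V (obj a) (obj b) (obj c))
    \<cdot> ((snd a \<odot> snd b) \<odot> snd c) \<cdot> (split (fst a) (fst b) \<odot> Idn V (ten (fst c))) \<cdot> split (fst a @ fst b) (fst c)"
proof -
  have [simp]: "snd a \<in> Arr V" "Dom V (snd a) = ten (fst a)" "obj a = Cod V (snd a)" "set (fst a) \<subseteq> Obj V"
     "snd b \<in> Arr V" "Dom V (snd b) = ten (fst b)" "obj b = Cod V (snd b)" "set (fst b) \<subseteq> Obj V"
     "snd c \<in> Arr V" "Dom V (snd c) = ten (fst c)" "obj c = Cod V (snd c)" "set (fst c) \<subseteq> Obj V"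
    using assms by (auto simp: elem_def obj_def)
  have [simp]: "s \<in> Arr V" "Dom V s = Cod V (snd b) \<otimes> Cod V (snd c)"
    "r \<in> Arr V" "Dom V r = Cod V (snd a) \<otimes> Cod V s" using assms by auto
  let ?s = "split (fst a) (fst b) \<odot> Idn V (ten (fst c))" and ?t = "split (fst a @ fst b) (fst c)"
  have "snd (bil r a (bil s b c)) = r \<cdot> (Idn V (obj a) \<odot> s) \<cdot> (snd a \<odot> (snd b \<odot> snd c))
        \<cdot> (Idn V (ten (fst a)) \<odot> split (fst b) (fst c)) \<cdot> split (fst a) (fst b @ fst c)"
    by (simp add: bil_def)
  also have "(Idn V (ten (fst a)) \<odot> split (fst b) (fst c)) \<cdot> split (fst a) (fst b @ fst c)
      = Asc V (ten (fst a)) (ten (fst b)) (ten (fst c)) \<cdot> ?s \<cdot> ?t"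
    by (simp add: split_split)
  also have "(snd a \<odot> (snd b \<odot> snd c)) \<cdot> Asc V (ten (fst a)) (ten (fst b)) (ten (fst c)) \<cdot> ?s \<cdot> ?t
     = ((snd a \<odot> (snd b \<odot> snd c)) \<cdot> Asc V (ten (fst a)) (ten (fst b)) (ten (fst c))) \<cdot> ?s \<cdot> ?t"
    by (subst Cmp_Cmp) auto
  also have "(snd a \<odot> (snd b \<odot> snd c)) \<cdot> Asc V (ten (fst a)) (ten (fst b)) (ten (fst c))
     = Asc V (obj a) (obj b) (obj c) \<cdot> ((snd a \<odot> snd b) \<odot> snd c)"
    by (subst Asc_nat) auto
  finally show ?thesis by simp
qed

text \<open>Removes \<open>Asc\<close>: a law that holds up to the associator becomes a rebracketing
  of elements. \<open>bil_assoc_cancel\<close> is the way back.\<close>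

lemma bil_assoc:
  assumes "r \<cdot> (s \<odot> Idn V (obj c)) = r' \<cdot> (Idn V (obj a) \<odot> s') \<cdot> Asc V (obj a) (obj b) (obj c)"
    and "elem a" "elem b" "elem c"
    "s \<in> Arr V" "Dom V s = obj a \<otimes> obj b" "r \<in> Arr V" "Dom V r = Cod V s \<otimes> obj c"
    "s' \<in> Arr V" "Dom V s' = obj b \<otimes> obj c" "r' \<in> Arr V" "Dom V r' = obj a \<otimes> Cod V s'"
  shows "bil r (bil s a b) c = bil r' a (bil s' b c)"
  using assms bil_assoc_left[of a b c s r] bil_assoc_right[of a b c s' r']
  by (intro prod_eqI) (auto simp: bil_def)

section \<open>From equations of elements back to equations of morphisms\<close>

lemma app_dense_cancel:
  assumes "app f a = app g a" "dense a" "f \<in> Arr V" "g \<in> Arr V" "Dom V f = obj a" "Dom V g = obj a"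
  shows "f = g"
  using assms by (auto simp: app_def dense_def obj_def intro: epiD[of _ "snd a"] stably_epi_epi)

lemma bil_dense_cancel:
  assumes "bil r a b = bil s a b" "dense a" "dense b" "r \<in> Arr V" "s \<in> Arr V"
    "Dom V r = obj a \<otimes> obj b" "Dom V s = obj a \<otimes> obj b"
  shows "r = s"
proof (rule app_dense_cancel)
  let ?p = "bil (Idn V (obj a \<otimes> obj b)) a b"
  show "app r ?p = app s ?p" using assms by simp
  show "dense ?p" using assms by (intro dense_bil stably_epi_iso) auto
qed (use assms in auto)

lemma bil_assoc_cancel:
  assumes "bil r (bil s a b) c = bil r' a (bil s' b c)"
    and "dense a" "dense b" "dense c"
    "s \<in> Arr V" "Dom V s = obj a \<otimes> obj b" "r \<in> Arr V" "Dom V r = Cod V s \<otimes> obj c"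
    "s' \<in> Arr V" "Dom V s' = obj b \<otimes> obj c" "r' \<in> Arr V" "Dom V r' = obj a \<otimes> Cod V s'"
  shows "r \<cdot> (s \<odot> Idn V (obj c)) = r' \<cdot> (Idn V (obj a) \<odot> s') \<cdot> Asc V (obj a) (obj b) (obj c)"
proof (rule epiD)
  \<comment> \<open>The common right factor of both bracketings; density of the three elements makes
    it an epimorphism.\<close>
  let ?e = "((snd a \<odot> snd b) \<odot> snd c) \<cdot> (split (fst a) (fst b) \<odot> Idn V (ten (fst c))) \<cdot> split (fst a @ fst b) (fst c)"
  show "(r \<cdot> (s \<odot> Idn V (obj c))) \<cdot> ?e = (r' \<cdot> (Idn V (obj a) \<odot> s') \<cdot> Asc V (obj a) (obj b) (obj c)) \<cdot> ?e"
    using assms bil_assoc_left[of a b c s r] bil_assoc_right[of a b c s' r'] by simp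
  have a: "set (fst a) \<subseteq> Obj V" "set (fst b) \<subseteq> Obj V" "set (fst c) \<subseteq> Obj V"
    "Dom V (snd a) = ten (fst a)" "Dom V (snd b) = ten (fst b)" "Dom V (snd c) = ten (fst c)"
    "stably_epi (snd a)" "stably_epi (snd b)" "stably_epi (snd c)"
    using assms by (auto simp: dense_def elem_def)
  then have "stably_epi ((snd a \<odot> snd b) \<odot> snd c)" by (intro stably_epi_TenA)
  moreover have "is_iso V ((split (fst a) (fst b) \<odot> Idn V (ten (fst c))) \<cdot> split (fst a @ fst b) (fst c))"
    using a by (intro is_iso_Cmp is_iso_TenA) auto
  ultimately show "epi ?e"
    using a by (intro stably_epi_epi stably_epi_Cmp[OF stably_epi_iso]) (auto simp: stably_epi_Arr)
qed (use assms in \<open>auto simp: dense_def elem_def obj_def\<close>)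

lemma bil_lunit_cancel:
  assumes "bil r (con e) a = a" "dense a" "e \<in> Arr V" "Dom V e = Unt V"
    "r \<in> Arr V" "Dom V r = Cod V e \<otimes> obj a" "Cod V r = obj a"
  shows "r \<cdot> (e \<odot> Idn V (obj a)) = Lun V (obj a)"
proof -
  have "r \<cdot> (e \<odot> Idn V (obj a)) \<cdot> iso_inv V (Lun V (obj a)) = Idn V (obj a)"
    using assms by (intro app_dense_cancel[of _ a]) (auto simp: bil_con_left app_Idn)
  then have "(r \<cdot> (e \<odot> Idn V (obj a))) \<cdot> iso_inv V (Lun V (obj a)) = Lun V (obj a) \<cdot> iso_inv V (Lun V (obj a))"
    using assms by simp
  then show ?thesis using assms by (subst (asm) iso_cancel_right) auto
qed

lemma bil_runit_cancel:
  assumes "bil r a (con e) = a" "dense a" "e \<in> Arr V" "Dom V e = Unt V"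
    "r \<in> Arr V" "Dom V r = obj a \<otimes> Cod V e" "Cod V r = obj a"
  shows "r \<cdot> (Idn V (obj a) \<odot> e) = Run V (obj a)"
proof -
  have "r \<cdot> (Idn V (obj a) \<odot> e) \<cdot> iso_inv V (Run V (obj a)) = Idn V (obj a)"
    using assms by (intro app_dense_cancel[of _ a]) (auto simp: bil_con_right app_Idn)
  then have "(r \<cdot> (Idn V (obj a) \<odot> e)) \<cdot> iso_inv V (Run V (obj a)) = Run V (obj a) \<cdot> iso_inv V (Run V (obj a))"
    using assms by simp
  then show ?thesis using assms by (subst (asm) iso_cancel_right) auto
qed

end

section \<open>Bimodules and Morita contexts\<close>

context monoidal_category
begin

text \<open>The universal bilinear operation: \<open>bil r a b\<close> is
  \<open>app r (pair a b)\<close>.\<close>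

abbreviation pair :: "'o list \<times> 'm \<Rightarrow> 'o list \<times> 'm \<Rightarrow> 'o list \<times> 'm" where
  "pair a b \<equiv> bil (Idn V (obj a \<otimes> obj b)) a b"

lemma dense_pair: "dense a \<Longrightarrow> dense b \<Longrightarrow> dense (pair a b)"
  by (intro dense_bil stably_epi_iso) auto

section \<open>Algebras, bimodules and bimodule maps in terms of elements\<close>

lemma is_algebra_simps:
  assumes "is_algebra V R"
  shows "Car R \<in> Obj V" "Mul R \<in> Arr V" "Dom V (Mul R) = Car R \<otimes> Car R" "Cod V (Mul R) = Car R"
    "Uni R \<in> Arr V" "Dom V (Uni R) = Unt V" "Cod V (Uni R) = Car R"
  using assms by (auto simp: is_algebra_def in_hom_iff)

text \<open>One dense element can fill all places of a law, since concatenation keeps the stages of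
  its copies apart.\<close>

lemma is_algebraI:
  assumes "Mul R \<in> Arr V" "Dom V (Mul R) = Car R \<otimes> Car R" "Cod V (Mul R) = Car R"
    "Uni R \<in> Arr V" "Dom V (Uni R) = Unt V" "Cod V (Uni R) = Car R"
    and "dense a" "obj a = Car R"
    and "bil (Mul R) (bil (Mul R) a a) a = bil (Mul R) a (bil (Mul R) a a)"
    "bil (Mul R) (con (Uni R)) a = a" "bil (Mul R) a (con (Uni R)) = a"
  shows "is_algebra V R"
  using assms bil_assoc_cancel[of "Mul R" "Mul R" a a a "Mul R" "Mul R"]
    bil_lunit_cancel[of "Mul R" "Uni R" a] bil_runit_cancel[of "Mul R" a "Uni R"] elem_obj[of a]
  by (auto simp: is_algebra_def in_hom_iff)

lemma is_bimodule_simps: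
  assumes "is_bimodule V X"
  shows "is_algebra V (LAlg X)" "is_algebra V (RAlg X)" "BCar X \<in> Obj V"
    "LAct X \<in> Arr V" "Dom V (LAct X) = Car (LAlg X) \<otimes> BCar X" "Cod V (LAct X) = BCar X"
    "RAct X \<in> Arr V" "Dom V (RAct X) = BCar X \<otimes> Car (RAlg X)" "Cod V (RAct X) = BCar X"
    "Car (LAlg X) \<in> Obj V" "Mul (LAlg X) \<in> Arr V"
    "Dom V (Mul (LAlg X)) = Car (LAlg X) \<otimes> Car (LAlg X)" "Cod V (Mul (LAlg X)) = Car (LAlg X)"
    "Uni (LAlg X) \<in> Arr V" "Dom V (Uni (LAlg X)) = Unt V" "Cod V (Uni (LAlg X)) = Car (LAlg X)"
    "Car (RAlg X) \<in> Obj V" "Mul (RAlg X) \<in> Arr V"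
    "Dom V (Mul (RAlg X)) = Car (RAlg X) \<otimes> Car (RAlg X)" "Cod V (Mul (RAlg X)) = Car (RAlg X)"
    "Uni (RAlg X) \<in> Arr V" "Dom V (Uni (RAlg X)) = Unt V" "Cod V (Uni (RAlg X)) = Car (RAlg X)"
  using assms is_algebra_simps[of "LAlg X"] is_algebra_simps[of "RAlg X"]
  by (auto simp: is_bimodule_def Let_def in_hom_iff)

lemma bimodule_assoc:
  assumes X: "is_bimodule V X" and x: "elem x" "obj x = BCar X"
  shows
    "\<And>a b. \<lbrakk>elem a; elem b; obj a = Car (LAlg X); obj b = Car (LAlg X)\<rbrakk>
       \<Longrightarrow> bil (LAct X) (bil (Mul (LAlg X)) a b) x = bil (LAct X) a (bil (LAct X) b x)"
    "\<And>s t. \<lbrakk>elem s; elem t; obj s = Car (RAlg X); obj t = Car (RAlg X)\<rbrakk>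
       \<Longrightarrow> bil (RAct X) (bil (RAct X) x s) t = bil (RAct X) x (bil (Mul (RAlg X)) s t)"
    "\<And>a s. \<lbrakk>elem a; elem s; obj a = Car (LAlg X); obj s = Car (RAlg X)\<rbrakk>
       \<Longrightarrow> bil (RAct X) (bil (LAct X) a x) s = bil (LAct X) a (bil (RAct X) x s)"
  using x X by (auto intro!: bil_assoc simp: is_bimodule_simps[OF X]) (auto simp: is_bimodule_def Let_def)

lemma bimodule_unit:
  assumes X: "is_bimodule V X" and x: "elem x" "obj x = BCar X"
  shows "bil (LAct X) (con (Uni (LAlg X))) x = x" "bil (RAct X) x (con (Uni (RAlg X))) = x"
proof -
  have "LAct X \<cdot> (Uni (LAlg X) \<odot> Idn V (BCar X)) = Lun V (BCar X)"
    "RAct X \<cdot> (Idn V (BCar X) \<odot> Uni (RAlg X)) = Run V (BCar X)"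
    using X by (auto simp: is_bimodule_def Let_def)
  then have "(LAct X \<cdot> (Uni (LAlg X) \<odot> Idn V (BCar X))) \<cdot> iso_inv V (Lun V (BCar X)) = Idn V (BCar X)"
    "(RAct X \<cdot> (Idn V (BCar X) \<odot> Uni (RAlg X))) \<cdot> iso_inv V (Run V (BCar X)) = Idn V (BCar X)"
    using is_bimodule_simps(3)[OF X] by simp_all
  then show "bil (LAct X) (con (Uni (LAlg X))) x = x" "bil (RAct X) x (con (Uni (RAlg X))) = x"
    using x by (simp_all add: bil_con_left bil_con_right is_bimodule_simps[OF X] app_Idn)
qed

text \<open>Formulated for arbitrary dense elements because the convenient one in a tensor product
  over an algebra is the projection of two generators, not \<open>gen\<close>.\<close>

lemma is_bimoduleI:
  assumes "is_algebra V (LAlg X)" "is_algebra V (RAlg X)"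
    and "LAct X \<in> Arr V" "Dom V (LAct X) = Car (LAlg X) \<otimes> BCar X" "Cod V (LAct X) = BCar X"
    and "RAct X \<in> Arr V" "Dom V (RAct X) = BCar X \<otimes> Car (RAlg X)" "Cod V (RAct X) = BCar X"
    and "dense a" "obj a = Car (LAlg X)" "dense x" "obj x = BCar X" "dense s" "obj s = Car (RAlg X)"
    and "bil (LAct X) (bil (Mul (LAlg X)) a a) x = bil (LAct X) a (bil (LAct X) a x)"
    and "bil (RAct X) (bil (RAct X) x s) s = bil (RAct X) x (bil (Mul (RAlg X)) s s)"
    and "bil (RAct X) (bil (LAct X) a x) s = bil (LAct X) a (bil (RAct X) x s)"
    and "bil (LAct X) (con (Uni (LAlg X))) x = x" "bil (RAct X) x (con (Uni (RAlg X))) = x"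
  shows "is_bimodule V X"
  using assms is_algebra_simps[OF assms(1)] is_algebra_simps[OF assms(2)] elem_obj[of x]
    bil_assoc_cancel[of "LAct X" "Mul (LAlg X)" a a x "LAct X" "LAct X"]
    bil_assoc_cancel[of "RAct X" "RAct X" x s s "RAct X" "Mul (RAlg X)"]
    bil_assoc_cancel[of "RAct X" "LAct X" a x s "LAct X" "RAct X"]
    bil_lunit_cancel[of "LAct X" "Uni (LAlg X)" x] bil_runit_cancel[of "RAct X" x "Uni (RAlg X)"]
  by (auto simp: is_bimodule_def Let_def in_hom_iff)

lemma bimod_maps_simps:
  assumes "f \<in> bimod_maps V X Y"
  shows "f \<in> Arr V" "Dom V f = BCar X" "Cod V f = BCar Y" "is_bimodule V X" "is_bimodule V Y"
    "LAlg Y = LAlg X" "RAlg Y = RAlg X"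
  using assms by (auto simp: bimod_maps_def in_hom_iff)

lemma bimod_maps_app:
  assumes f: "f \<in> bimod_maps V X Y" and x: "elem x" "obj x = BCar X"
  shows "\<And>a. elem a \<Longrightarrow> obj a = Car (LAlg X) \<Longrightarrow> app f (bil (LAct X) a x) = bil (LAct Y) a (app f x)"
    "\<And>s. elem s \<Longrightarrow> obj s = Car (RAlg X) \<Longrightarrow> app f (bil (RAct X) x s) = bil (RAct Y) (app f x) s"
proof -
  note S = bimod_maps_simps[OF f] is_bimodule_simps[OF bimod_maps_simps(4)[OF f]]
    is_bimodule_simps[OF bimod_maps_simps(5)[OF f]]
  have E: "f \<cdot> LAct X = LAct Y \<cdot> (Idn V (Car (LAlg X)) \<odot> f)"
    "f \<cdot> RAct X = RAct Y \<cdot> (f \<odot> Idn V (Car (RAlg X)))"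
    using f by (auto simp: bimod_maps_def)
  fix a assume a: "elem a" "obj a = Car (LAlg X)"
  have "app f (bil (LAct X) a x) = bil (f \<cdot> LAct X) a x" using x a S by simp
  also have "\<dots> = bil (LAct Y) a (app f x)" unfolding E using x a S by (simp add: bil_app_right)
  finally show "app f (bil (LAct X) a x) = bil (LAct Y) a (app f x)" .
next
  note S = bimod_maps_simps[OF f] is_bimodule_simps[OF bimod_maps_simps(4)[OF f]]
    is_bimodule_simps[OF bimod_maps_simps(5)[OF f]]
  have E: "f \<cdot> RAct X = RAct Y \<cdot> (f \<odot> Idn V (Car (RAlg X)))"
    using f by (auto simp: bimod_maps_def)
  fix a assume a: "elem a" "obj a = Car (RAlg X)"
  have "app f (bil (RAct X) x a) = bil (f \<cdot> RAct X) x a" using x a S by simp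
  also have "\<dots> = bil (RAct Y) (app f x) a" unfolding E using x a S by (simp add: bil_app_left)
  finally show "app f (bil (RAct X) x a) = bil (RAct Y) (app f x) a" .
qed

lemma bimod_mapsI:
  assumes X: "is_bimodule V X" and Y: "is_bimodule V Y" and L: "LAlg X = LAlg Y" "RAlg X = RAlg Y"
    and f: "f \<in> Arr V" "Dom V f = BCar X" "Cod V f = BCar Y"
    and d: "dense a" "obj a = Car (LAlg X)" "dense x" "obj x = BCar X" "dense s" "obj s = Car (RAlg X)"
    and E: "app f (bil (LAct X) a x) = bil (LAct Y) a (app f x)"
      "app f (bil (RAct X) x s) = bil (RAct Y) (app f x) s"
  shows "f \<in> bimod_maps V X Y"
proof -
  note S = is_bimodule_simps[OF X] is_bimodule_simps[OF Y]
  have "f \<cdot> LAct X = LAct Y \<cdot> (Idn V (Car (LAlg X)) \<odot> f)"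
    by (rule bil_dense_cancel[of _ a x])
      (use E(1) d f L S in \<open>simp_all add: bil_app_right\<close>)
  moreover have "f \<cdot> RAct X = RAct Y \<cdot> (f \<odot> Idn V (Car (RAlg X)))"
    by (rule bil_dense_cancel[of _ x s])
      (use E(2) d f L S in \<open>simp_all add: bil_app_left\<close>)
  ultimately show ?thesis using X Y L f by (auto simp: bimod_maps_def in_hom_iff)
qed

lemma regular_bimod_simps [simp]:
  "LAlg (regular_bimod R) = R" "RAlg (regular_bimod R) = R" "BCar (regular_bimod R) = Car R"
  "LAct (regular_bimod R) = Mul R" "RAct (regular_bimod R) = Mul R"
  by (simp_all add: regular_bimod_def)

lemma is_bimodule_regular: "is_algebra V R \<Longrightarrow> is_bimodule V (regular_bimod R)"
  by (simp add: is_bimodule_def is_algebra_def)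

text \<open>With r a right action, this evaluates one leg of the coequalizer pair behind
  \<open>proj\<close>; \<open>app_Idn_TenA_pair\<close> evaluates the other.\<close>

lemma app_TenA_Idn_pair:
  assumes "elem x" "elem s" "elem y" "r \<in> Arr V" "Dom V r = obj x \<otimes> obj s"
  shows "app (r \<odot> Idn V (obj y)) (pair (pair x s) y) = pair (bil r x s) y"
proof -
  have "pair (bil r x s) y = bil (Idn V (Cod V r \<otimes> obj y)) (app r (pair x s)) y"
    using assms by simp
  also have "\<dots> = bil (r \<odot> Idn V (obj y)) (pair x s) y"
    using assms by (subst bil_app_left) auto
  finally show ?thesis using assms by simp
qed

lemma app_Idn_TenA_pair:
  assumes "elem x" "elem s" "elem y" "r \<in> Arr V" "Dom V r = obj s \<otimes> obj y"
  shows "app ((Idn V (obj x) \<odot> r) \<cdot> Asc V (obj x) (obj s) (obj y)) (pair (pair x s) y) = pair x (bil r s y)"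
proof -
  have "bil ((Idn V (obj x) \<odot> r) \<cdot> Asc V (obj x) (obj s) (obj y)) (pair x s) y = pair x (bil r s y)"
    using assms by (intro bil_assoc) auto
  then show ?thesis using assms by simp
qed

end

context monoidal_category_with_coequalizers
begin

text \<open>A tensored coequalizer is again a coequalizer, hence an epimorphism. Preservation by the
  tensor product is used here and in \<open>proj_factor_left\<close> and
  \<open>proj_factor_right\<close>.\<close>

lemma stably_epi_coequalizer:
  assumes "is_coequalizer V f g e" shows "stably_epi e"
  unfolding stably_epi_def
  using assms epi_coequalizer[OF tensor_right_preserves[OF tensor_left_preserves[OF assms]]]
  by (auto simp: is_coequalizer_def in_hom_iff)

lemma coequalizer_factor:
  assumes "is_coequalizer V f g e" "h \<in> Arr V" "Dom V h = Cod V f" "h \<cdot> f = h \<cdot> g"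
  shows "\<exists>!k. k \<in> hom V (Cod V e) (Cod V h) \<and> k \<cdot> e = h"
  using assms by (auto simp: is_coequalizer_def in_hom_iff)

section \<open>Universal property of the tensor product over an algebra\<close>

context
  fixes X Y :: "('o, 'm) bimod"
  assumes X: "is_bimodule V X" and Y: "is_bimodule V Y" and XY: "RAlg X = LAlg Y"
begin

private lemmas actions = is_bimodule_simps[OF X] is_bimodule_simps[OF Y] XY

lemma proj_coequalizer: "is_coequalizer V (RAct X \<odot> Idn V (BCar Y))
     ((Idn V (BCar X) \<odot> LAct Y) \<cdot> Asc V (BCar X) (Car (RAlg X)) (BCar Y)) (proj V X Y)"
  unfolding proj_def
  by (rule someI_ex, rule coequalizer_exists[of _ "(BCar X \<otimes> Car (RAlg X)) \<otimes> BCar Y" "BCar X \<otimes> BCar Y"])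
    (use actions in \<open>auto simp: in_hom_iff\<close>)

lemma proj_simps:
  "proj V X Y \<in> Arr V" "Dom V (proj V X Y) = BCar X \<otimes> BCar Y" "stably_epi (proj V X Y)"
  using proj_coequalizer stably_epi_coequalizer[OF proj_coequalizer] actions
  by (auto simp: is_coequalizer_def in_hom_iff)

lemma proj_balanced:
  assumes "elem x" "elem s" "elem y" "obj x = BCar X" "obj s = Car (RAlg X)" "obj y = BCar Y"
  shows "bil (proj V X Y) (bil (RAct X) x s) y = bil (proj V X Y) x (bil (LAct Y) s y)"
  using proj_coequalizer actions proj_simps assms
  by (intro bil_assoc) (auto simp: is_coequalizer_def)

context
  fixes xs ys ss :: "'o list \<times> 'm"
  assumes xs: "dense xs" "obj xs = BCar X" and ys: "dense ys" "obj ys = BCar Y"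
    and ss: "dense ss" "obj ss = Car (RAlg X)"
begin

text \<open>The two legs agree after h as soon as they agree on one dense triple, so balancedness
  need only be tested there.\<close>

lemma proj_factor:
  assumes "h \<in> Arr V" "Dom V h = BCar X \<otimes> BCar Y"
    and "bil h (bil (RAct X) xs ss) ys = bil h xs (bil (LAct Y) ss ys)"
  shows "\<exists>!k. k \<in> hom V (Cod V (proj V X Y)) (Cod V h) \<and> k \<cdot> proj V X Y = h"
proof (rule coequalizer_factor[OF proj_coequalizer])
  show "h \<cdot> (RAct X \<odot> Idn V (BCar Y)) =
      h \<cdot> (Idn V (BCar X) \<odot> LAct Y) \<cdot> Asc V (BCar X) (Car (RAlg X)) (BCar Y)"
    using bil_assoc_cancel[of h "RAct X" xs ss ys h "LAct Y"] assms xs ys ss actions by simp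
qed (use assms actions in auto)

text \<open>The universal property with a further variable on the left, needed to define the left
  action on the tensor product.\<close>

lemma proj_factor_left:
  assumes "h \<in> Arr V" "Dom V h = r \<otimes> (BCar X \<otimes> BCar Y)" "r \<in> Obj V" "dense rs" "obj rs = r"
    and "bil h rs (pair (bil (RAct X) xs ss) ys) = bil h rs (pair xs (bil (LAct Y) ss ys))"
  shows "\<exists>!k. k \<in> hom V (r \<otimes> Cod V (proj V X Y)) (Cod V h) \<and> k \<cdot> (Idn V r \<odot> proj V X Y) = h"
proof -
  let ?f = "RAct X \<odot> Idn V (BCar Y)"
    and ?g = "(Idn V (BCar X) \<odot> LAct Y) \<cdot> Asc V (BCar X) (Car (RAlg X)) (BCar Y)"
  \<comment> \<open>A dense element of the common source of the two legs.\<close>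
  let ?t = "pair (pair xs ss) ys"
  have t: "dense ?t" by (intro dense_pair xs ss ys)
  have "bil (h \<cdot> (Idn V r \<odot> ?f)) rs ?t = bil h rs (app ?f ?t)"
    using assms(1-5) xs ys ss actions by (subst bil_app_right) auto
  also have "\<dots> = bil h rs (pair (bil (RAct X) xs ss) ys)"
    using app_TenA_Idn_pair[of xs ss ys "RAct X"] xs ys ss actions by simp
  also have "\<dots> = bil h rs (app ?g ?t)"
    using app_Idn_TenA_pair[of xs ss ys "LAct Y"] xs ys ss actions assms(6) by simp
  also have "\<dots> = bil (h \<cdot> (Idn V r \<odot> ?g)) rs ?t"
    using assms(1-5) xs ys ss actions by (subst bil_app_right) auto
  finally have "h \<cdot> (Idn V r \<odot> ?f) = h \<cdot> (Idn V r \<odot> ?g)"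
    by (rule bil_dense_cancel[OF _ _ t]) (use assms(1-5) xs ys ss actions in auto)
  then show ?thesis
    using coequalizer_factor[OF tensor_left_preserves[OF proj_coequalizer, of r], of h] assms(1-3) actions proj_simps
    by simp
qed

text \<open>The version with a variable on the right serves the right action and also the
  associativity constraint, where the variable is the third bimodule.\<close>

lemma proj_factor_right:
  assumes "h \<in> Arr V" "Dom V h = (BCar X \<otimes> BCar Y) \<otimes> r" "r \<in> Obj V" "dense rs" "obj rs = r"
    and "bil h (pair (bil (RAct X) xs ss) ys) rs = bil h (pair xs (bil (LAct Y) ss ys)) rs"
  shows "\<exists>!k. k \<in> hom V (Cod V (proj V X Y) \<otimes> r) (Cod V h) \<and> k \<cdot> (proj V X Y \<odot> Idn V r) = h"
proof -
  let ?f = "RAct X \<odot> Idn V (BCar Y)"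
    and ?g = "(Idn V (BCar X) \<odot> LAct Y) \<cdot> Asc V (BCar X) (Car (RAlg X)) (BCar Y)"
  let ?t = "pair (pair xs ss) ys"
  have t: "dense ?t" by (intro dense_pair xs ss ys)
  have "bil (h \<cdot> (?f \<odot> Idn V r)) ?t rs = bil h (app ?f ?t) rs"
    using assms(1-5) xs ys ss actions by (subst bil_app_left) auto
  also have "\<dots> = bil h (pair (bil (RAct X) xs ss) ys) rs"
    using app_TenA_Idn_pair[of xs ss ys "RAct X"] xs ys ss actions by simp
  also have "\<dots> = bil h (app ?g ?t) rs"
    using app_Idn_TenA_pair[of xs ss ys "LAct Y"] xs ys ss actions assms(6) by simp
  also have "\<dots> = bil (h \<cdot> (?g \<odot> Idn V r)) ?t rs"
    using assms(1-5) xs ys ss actions by (subst bil_app_left) auto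
  finally have "h \<cdot> (?f \<odot> Idn V r) = h \<cdot> (?g \<odot> Idn V r)"
    by (rule bil_dense_cancel[OF _ t]) (use assms(1-5) xs ys ss actions in auto)
  then show ?thesis
    using coequalizer_factor[OF tensor_right_preserves[OF proj_coequalizer, of r], of h] assms(1-3) actions proj_simps
    by simp
qed

end

end

lemma pair_lact:
  assumes "elem a" "elem x" "elem y" "l \<in> Arr V" "Dom V l = obj a \<otimes> obj x"
    "p \<in> Arr V" "Dom V p = Cod V l \<otimes> obj y"
  shows "bil (p \<cdot> (l \<odot> Idn V (obj y)) \<cdot> iso_inv V (Asc V (obj a) (obj x) (obj y))) a (pair x y) = bil p (bil l a x) y"
  by (rule bil_assoc[symmetric]) (use assms in auto)

lemma pair_ract:
  assumes "elem x" "elem y" "elem t" "r \<in> Arr V" "Dom V r = obj y \<otimes> obj t"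
    "p \<in> Arr V" "Dom V p = obj x \<otimes> Cod V r"
  shows "bil (p \<cdot> (Idn V (obj x) \<odot> r) \<cdot> Asc V (obj x) (obj y) (obj t)) (pair x y) t = bil p x (bil r y t)"
  by (rule bil_assoc) (use assms in auto)

lemma bimod_tensor_simps [simp]:
  "LAlg (bimod_tensor V X Y) = LAlg X" "RAlg (bimod_tensor V X Y) = RAlg Y"
  "BCar (bimod_tensor V X Y) = Cod V (proj V X Y)"
  by (simp_all add: bimod_tensor_def Let_def)

section \<open>Actions on the tensor product over an algebra\<close>

context
  fixes X Y :: "('o, 'm) bimod"
  assumes X: "is_bimodule V X" and Y: "is_bimodule V Y" and XY: "RAlg X = LAlg Y"
begin

private lemmas actions_proj = is_bimodule_simps[OF X] is_bimodule_simps[OF Y] XY proj_simps[OF X Y XY]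

text \<open>The description in \<open>bimod_tensor\<close> is well defined because the left action
  of X commutes with its right action and therefore respects the relation imposed by
  \<open>proj\<close>.\<close>

lemma LAct_bimod_tensor:
  "LAct (bimod_tensor V X Y) \<in> hom V (Car (LAlg X) \<otimes> Cod V (proj V X Y)) (Cod V (proj V X Y)) \<and>
   LAct (bimod_tensor V X Y) \<cdot> (Idn V (Car (LAlg X)) \<odot> proj V X Y) =
     proj V X Y \<cdot> (LAct X \<odot> Idn V (BCar Y)) \<cdot> iso_inv V (Asc V (Car (LAlg X)) (BCar X) (BCar Y))"
proof -
  let ?h = "proj V X Y \<cdot> (LAct X \<odot> Idn V (BCar Y)) \<cdot> iso_inv V (Asc V (Car (LAlg X)) (BCar X) (BCar Y))"
  let ?a = "gen (Car (LAlg X))" and ?x = "gen (BCar X)" and ?s = "gen (Car (RAlg X))" and ?y = "gen (BCar Y)"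
  have P: "bil ?h ?a (pair x y) = bil (proj V X Y) (bil (LAct X) ?a x) y"
    if "elem x" "elem y" "obj x = BCar X" "obj y = BCar Y" for x y
    using pair_lact[of ?a x y "LAct X" "proj V X Y"] that actions_proj by simp
  have "bil ?h ?a (pair (bil (RAct X) ?x ?s) ?y)
      = bil (proj V X Y) (bil (RAct X) (bil (LAct X) ?a ?x) ?s) ?y"
    using actions_proj by (subst P) (auto simp: bimodule_assoc(3)[OF X])
  also have "\<dots> = bil ?h ?a (pair ?x (bil (LAct Y) ?s ?y))"
    using actions_proj by (subst P) (auto simp: proj_balanced[OF X Y XY])
  finally have "\<exists>!k. k \<in> hom V (Car (LAlg X) \<otimes> Cod V (proj V X Y)) (Cod V ?h) \<and>
      k \<cdot> (Idn V (Car (LAlg X)) \<odot> proj V X Y) = ?h"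
    by (intro proj_factor_left[OF X Y XY, of ?x ?y ?s _ _ ?a]) (use actions_proj in auto)
  from theI'[OF this] show ?thesis using actions_proj by (simp add: bimod_tensor_def Let_def)
qed

text \<open>As for the left action, now because the two actions of Y commute.\<close>

lemma RAct_bimod_tensor:
  "RAct (bimod_tensor V X Y) \<in> hom V (Cod V (proj V X Y) \<otimes> Car (RAlg Y)) (Cod V (proj V X Y)) \<and>
   RAct (bimod_tensor V X Y) \<cdot> (proj V X Y \<odot> Idn V (Car (RAlg Y))) =
     proj V X Y \<cdot> (Idn V (BCar X) \<odot> RAct Y) \<cdot> Asc V (BCar X) (BCar Y) (Car (RAlg Y))"
proof -
  let ?h = "proj V X Y \<cdot> (Idn V (BCar X) \<odot> RAct Y) \<cdot> Asc V (BCar X) (BCar Y) (Car (RAlg Y))"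
  let ?t = "gen (Car (RAlg Y))" and ?x = "gen (BCar X)" and ?s = "gen (Car (RAlg X))" and ?y = "gen (BCar Y)"
  have P: "bil ?h (pair x y) ?t = bil (proj V X Y) x (bil (RAct Y) y ?t)"
    if "elem x" "elem y" "obj x = BCar X" "obj y = BCar Y" for x y
    using pair_ract[of x y ?t "RAct Y" "proj V X Y"] that actions_proj by simp
  have "bil ?h (pair (bil (RAct X) ?x ?s) ?y) ?t
      = bil (proj V X Y) ?x (bil (LAct Y) ?s (bil (RAct Y) ?y ?t))"
    using actions_proj by (subst P) (auto simp: proj_balanced[OF X Y XY])
  also have "\<dots> = bil ?h (pair ?x (bil (LAct Y) ?s ?y)) ?t"
    using actions_proj by (subst P) (auto simp: bimodule_assoc(3)[OF Y])
  finally have "\<exists>!k. k \<in> hom V (Cod V (proj V X Y) \<otimes> Car (RAlg Y)) (Cod V ?h) \<and>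
      k \<cdot> (proj V X Y \<odot> Idn V (Car (RAlg Y))) = ?h"
    by (intro proj_factor_right[OF X Y XY, of ?x ?y ?s _ _ ?t]) (use actions_proj in auto)
  from theI'[OF this] show ?thesis using actions_proj by (simp add: bimod_tensor_def Let_def)
qed

lemma bimod_tensor_Act_simps:
  "LAct (bimod_tensor V X Y) \<in> Arr V"
  "Dom V (LAct (bimod_tensor V X Y)) = Car (LAlg X) \<otimes> Cod V (proj V X Y)"
  "Cod V (LAct (bimod_tensor V X Y)) = Cod V (proj V X Y)"
  "RAct (bimod_tensor V X Y) \<in> Arr V"
  "Dom V (RAct (bimod_tensor V X Y)) = Cod V (proj V X Y) \<otimes> Car (RAlg Y)"
  "Cod V (RAct (bimod_tensor V X Y)) = Cod V (proj V X Y)"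
  using LAct_bimod_tensor RAct_bimod_tensor by (auto simp: in_hom_iff)

lemma bimod_tensor_act:
  assumes "elem x" "elem y" "obj x = BCar X" "obj y = BCar Y"
  shows "\<And>a. elem a \<Longrightarrow> obj a = Car (LAlg X) \<Longrightarrow>
      bil (LAct (bimod_tensor V X Y)) a (bil (proj V X Y) x y) = bil (proj V X Y) (bil (LAct X) a x) y"
    "\<And>t. elem t \<Longrightarrow> obj t = Car (RAlg Y) \<Longrightarrow>
      bil (RAct (bimod_tensor V X Y)) (bil (proj V X Y) x y) t = bil (proj V X Y) x (bil (RAct Y) y t)"
proof -
  have E: "bil (proj V X Y) x y = app (proj V X Y) (pair x y)" using actions_proj assms by simp
  fix a assume a: "elem a" "obj a = Car (LAlg X)"
  have "bil (LAct (bimod_tensor V X Y)) a (app (proj V X Y) (pair x y))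
      = bil (LAct (bimod_tensor V X Y) \<cdot> (Idn V (Car (LAlg X)) \<odot> proj V X Y)) a (pair x y)"
    using actions_proj a assms bimod_tensor_Act_simps by (subst bil_app_right) auto
  then show "bil (LAct (bimod_tensor V X Y)) a (bil (proj V X Y) x y) = bil (proj V X Y) (bil (LAct X) a x) y"
    unfolding E[symmetric] using LAct_bimod_tensor pair_lact[of a x y "LAct X" "proj V X Y"] actions_proj assms a by simp
next
  have E: "bil (proj V X Y) x y = app (proj V X Y) (pair x y)" using actions_proj assms by simp
  fix a assume a: "elem a" "obj a = Car (RAlg Y)"
  have "bil (RAct (bimod_tensor V X Y)) (app (proj V X Y) (pair x y)) a
      = bil (RAct (bimod_tensor V X Y) \<cdot> (proj V X Y \<odot> Idn V (Car (RAlg Y)))) (pair x y) a"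
    using actions_proj a assms bimod_tensor_Act_simps by (subst bil_app_left) auto
  then show "bil (RAct (bimod_tensor V X Y)) (bil (proj V X Y) x y) a = bil (proj V X Y) x (bil (RAct Y) y a)"
    unfolding E[symmetric] using RAct_bimod_tensor pair_ract[of x y a "RAct Y" "proj V X Y"] actions_proj assms a by simp
qed

lemma is_bimodule_bimod_tensor: "is_bimodule V (bimod_tensor V X Y)"
proof -
  let ?a = "gen (Car (LAlg X))" and ?x = "gen (BCar X)" and ?y = "gen (BCar Y)" and ?t = "gen (Car (RAlg Y))"
  \<comment> \<open>Dense because the projection is stably epi; on it the actions are computed by
    those of X and Y, which carries the laws over.\<close>
  let ?w = "bil (proj V X Y) ?x ?y"
  have "dense ?w" using actions_proj by (intro dense_bil) auto
  then show ?thesis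
    using actions_proj bimod_tensor_Act_simps
    by (intro is_bimoduleI[of _ ?a ?w ?t])
      (auto simp: bimod_tensor_act bimodule_assoc[OF X] bimodule_assoc[OF Y] bimodule_unit[OF X] bimodule_unit[OF Y])
qed

end

text \<open>Balancedness of the candidate uses right linearity of f, then the relation in the
  target, then left linearity of g.\<close>

lemma map_tensor:
  assumes f: "f \<in> bimod_maps V X X'" and g: "g \<in> bimod_maps V Y Y'" and XY: "RAlg X = LAlg Y"
  shows "map_tensor V X X' Y Y' f g \<in> hom V (Cod V (proj V X Y)) (Cod V (proj V X' Y')) \<and>
    map_tensor V X X' Y Y' f g \<cdot> proj V X Y = proj V X' Y' \<cdot> (f \<odot> g)"
proof -
  note F = bimod_maps_simps[OF f] and G = bimod_maps_simps[OF g]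
  note X = F(4) and X' = F(5) and Y = G(4) and Y' = G(5)
  have XY': "RAlg X' = LAlg Y'" using XY F G by simp
  note S = is_bimodule_simps[OF X] is_bimodule_simps[OF Y] proj_simps[OF X Y XY] proj_simps[OF X' Y' XY']
  let ?h = "proj V X' Y' \<cdot> (f \<odot> g)"
  let ?x = "gen (BCar X)" and ?s = "gen (Car (RAlg X))" and ?y = "gen (BCar Y)"
  have P: "bil ?h x y = bil (proj V X' Y') (app f x) (app g y)"
    if "elem x" "elem y" "obj x = BCar X" "obj y = BCar Y" for x y
    using that S F(1-3) G(1-3) by (intro bil_TenA) auto
  have "bil ?h (bil (RAct X) ?x ?s) ?y = bil (proj V X' Y') (bil (RAct X') (app f ?x) ?s) (app g ?y)"
    using S XY by (subst P) (auto simp: bimod_maps_app[OF f] simp del: app_bil)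
  also have "\<dots> = bil (proj V X' Y') (app f ?x) (bil (LAct Y') ?s (app g ?y))"
    by (rule proj_balanced[OF X' Y' XY']) (use S XY F(1-3,7) G(1-3) in auto)
  also have "\<dots> = bil ?h ?x (bil (LAct Y) ?s ?y)"
    using S XY by (subst P) (auto simp: bimod_maps_app[OF g] simp del: app_bil)
  finally have "\<exists>!k. k \<in> hom V (Cod V (proj V X Y)) (Cod V ?h) \<and> k \<cdot> proj V X Y = ?h"
    by (intro proj_factor[OF X Y XY, of ?x ?y ?s]) (use S F(1-3) G(1-3) in auto)
  from theI'[OF this] show ?thesis using S F(1-3) G(1-3) by (simp add: map_tensor_def)
qed

lemma app_map_tensor:
  assumes f: "f \<in> bimod_maps V X X'" and g: "g \<in> bimod_maps V Y Y'" and XY: "RAlg X = LAlg Y"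
    and x: "elem x" "obj x = BCar X" and y: "elem y" "obj y = BCar Y"
  shows "app (map_tensor V X X' Y Y' f g) (bil (proj V X Y) x y) = bil (proj V X' Y') (app f x) (app g y)"
proof -
  note F = bimod_maps_simps[OF f] and G = bimod_maps_simps[OF g]
  have XY': "RAlg X' = LAlg Y'" using XY F G by simp
  note S = proj_simps[OF F(4) G(4) XY] proj_simps[OF F(5) G(5) XY']
  show ?thesis
    using map_tensor[OF f g XY] S x y F(1-3) G(1-3) bil_TenA[of x y f g "proj V X' Y'"]
    by (simp add: in_hom_iff)
qed

text \<open>The source is a quotient of a quotient, so the map is found in two steps: h factors the
  candidate through the tensored inner projection, and k factors h through the outer one. Uniqueness
  holds because the composite of both projections is an epimorphism.\<close>

lemma bimod_assoc:
  assumes X: "is_bimodule V X" and Y: "is_bimodule V Y" and Z: "is_bimodule V Z"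
    and XY: "RAlg X = LAlg Y" and YZ: "RAlg Y = LAlg Z"
  shows "bimod_assoc V X Y Z \<in> hom V (Cod V (proj V (bimod_tensor V X Y) Z)) (Cod V (proj V X (bimod_tensor V Y Z)))
    \<and> bimod_assoc V X Y Z \<cdot> proj V (bimod_tensor V X Y) Z \<cdot> (proj V X Y \<odot> Idn V (BCar Z)) =
      proj V X (bimod_tensor V Y Z) \<cdot> (Idn V (BCar X) \<odot> proj V Y Z) \<cdot> Asc V (BCar X) (BCar Y) (BCar Z)"
proof -
  let ?XY = "bimod_tensor V X Y" and ?YZ = "bimod_tensor V Y Z"
  note T = is_bimodule_bimod_tensor[OF X Y XY] and U = is_bimodule_bimod_tensor[OF Y Z YZ]
  have TZ: "RAlg ?XY = LAlg Z" and XU: "RAlg X = LAlg ?YZ" using XY YZ by simp_all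
  note S = is_bimodule_simps[OF X] is_bimodule_simps[OF Y] is_bimodule_simps[OF Z]
    proj_simps[OF X Y XY] proj_simps[OF Y Z YZ] proj_simps[OF T Z TZ] proj_simps[OF X U XU]
    bimod_tensor_Act_simps[OF X Y XY] bimod_tensor_Act_simps[OF Y Z YZ]
  let ?x = "gen (BCar X)" and ?y = "gen (BCar Y)" and ?z = "gen (BCar Z)"
    and ?s = "gen (Car (RAlg X))" and ?t = "gen (Car (RAlg Y))"
  let ?g = "proj V X ?YZ \<cdot> (Idn V (BCar X) \<odot> proj V Y Z) \<cdot> Asc V (BCar X) (BCar Y) (BCar Z)"
  have g: "bil ?g (pair x y) z = bil (proj V X ?YZ) x (bil (proj V Y Z) y z)"
    if "elem x" "elem y" "elem z" "obj x = BCar X" "obj y = BCar Y" "obj z = BCar Z" for x y z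
    using pair_ract[of x y z "proj V Y Z" "proj V X ?YZ"] that S by simp
  \<comment> \<open>The scalar s crosses the outer projection of the target, whose second factor it
    meets through the left action of Y.\<close>
  have U1: "bil (proj V X ?YZ) (bil (RAct X) ?x ?s) (bil (proj V Y Z) ?y ?z)
     = bil (proj V X ?YZ) ?x (bil (proj V Y Z) (bil (LAct Y) ?s ?y) ?z)"
    using proj_balanced[OF X U XU, of ?x ?s "bil (proj V Y Z) ?y ?z"] S XY
    by (simp add: bimod_tensor_act[OF Y Z YZ])
  have "bil ?g (pair (bil (RAct X) ?x ?s) ?y) ?z = bil ?g (pair ?x (bil (LAct Y) ?s ?y)) ?z"
    using S XY U1 by (subst (1 2) g) auto
  then have "\<exists>!k. k \<in> hom V (Cod V (proj V X Y) \<otimes> BCar Z) (Cod V ?g) \<and> k \<cdot> (proj V X Y \<odot> Idn V (BCar Z)) = ?g"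
    by (intro proj_factor_right[OF X Y XY, of ?x ?y ?s _ _ ?z]) (use S in auto)
  then obtain h where h: "h \<in> hom V (Cod V (proj V X Y) \<otimes> BCar Z) (Cod V ?g)"
    "h \<cdot> (proj V X Y \<odot> Idn V (BCar Z)) = ?g" by blast
  have h': "bil h (bil (proj V X Y) x y) z = bil (proj V X ?YZ) x (bil (proj V Y Z) y z)"
    if "elem x" "elem y" "elem z" "obj x = BCar X" "obj y = BCar Y" "obj z = BCar Z" for x y z
  proof -
    have "bil h (app (proj V X Y) (pair x y)) z = bil (h \<cdot> (proj V X Y \<odot> Idn V (BCar Z))) (pair x y) z"
      using h(1) that S by (subst bil_app_left) (auto simp: in_hom_iff)
    then have "bil h (app (proj V X Y) (pair x y)) z = bil (proj V X ?YZ) x (bil (proj V Y Z) y z)"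
      unfolding h(2) g[OF that] .
    then show ?thesis using that S by simp
  qed
  \<comment> \<open>A dense element of the inner tensor product, on which balancedness over the
    second algebra can be tested.\<close>
  let ?w = "bil (proj V X Y) ?x ?y"
  have w: "dense ?w" using S by (intro dense_bil) auto
  have "bil h (bil (RAct ?XY) ?w ?t) ?z = bil (proj V X ?YZ) ?x (bil (proj V Y Z) (bil (RAct Y) ?y ?t) ?z)"
    using S h' by (simp add: bimod_tensor_act[OF X Y XY])
  also have "\<dots> = bil h ?w (bil (LAct Z) ?t ?z)"
    using S h' proj_balanced[OF Y Z YZ, of ?y ?t ?z] YZ by simp
  finally have "\<exists>!k. k \<in> hom V (Cod V (proj V ?XY Z)) (Cod V h) \<and> k \<cdot> proj V ?XY Z = h"
    by (intro proj_factor[OF T Z TZ, of ?w ?z ?t]) (use S w h in \<open>auto simp: in_hom_iff\<close>)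
  then obtain k where k: "k \<in> hom V (Cod V (proj V ?XY Z)) (Cod V h)" "k \<cdot> proj V ?XY Z = h" by blast
  have "\<exists>!k. k \<in> hom V (Cod V (proj V ?XY Z)) (Cod V (proj V X ?YZ)) \<and>
        k \<cdot> proj V ?XY Z \<cdot> (proj V X Y \<odot> Idn V (BCar Z)) = ?g"
  proof (rule ex1I)
    have "(k \<cdot> proj V ?XY Z) \<cdot> (proj V X Y \<odot> Idn V (BCar Z)) = ?g" using k h by simp
    then show "k \<in> hom V (Cod V (proj V ?XY Z)) (Cod V (proj V X ?YZ)) \<and>
        k \<cdot> proj V ?XY Z \<cdot> (proj V X Y \<odot> Idn V (BCar Z)) = ?g"
      using k(1) h(1) S by (simp add: in_hom_iff)
    fix k' assume k': "k' \<in> hom V (Cod V (proj V ?XY Z)) (Cod V (proj V X ?YZ)) \<and>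
        k' \<cdot> proj V ?XY Z \<cdot> (proj V X Y \<odot> Idn V (BCar Z)) = ?g"
    have e: "stably_epi (proj V ?XY Z \<cdot> (proj V X Y \<odot> Idn V (BCar Z)))"
      using S by (intro stably_epi_Cmp stably_epi_TenA stably_epi_iso[OF is_iso_Idn]) auto
    show "k' = k"
      by (rule epiD[OF _ stably_epi_epi[OF e]])
        (use k' k(1) h(1) S \<open>(k \<cdot> proj V ?XY Z) \<cdot> (proj V X Y \<odot> Idn V (BCar Z)) = ?g\<close> in \<open>auto simp: in_hom_iff\<close>)
  qed
  from theI'[OF this] show ?thesis by (simp add: bimod_assoc_def)
qed

lemma app_bimod_assoc:
  assumes X: "is_bimodule V X" and Y: "is_bimodule V Y" and Z: "is_bimodule V Z"
    and XY: "RAlg X = LAlg Y" and YZ: "RAlg Y = LAlg Z"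
    and x: "elem x" "elem y" "elem z" "obj x = BCar X" "obj y = BCar Y" "obj z = BCar Z"
  shows "app (bimod_assoc V X Y Z) (bil (proj V (bimod_tensor V X Y) Z) (bil (proj V X Y) x y) z) =
    bil (proj V X (bimod_tensor V Y Z)) x (bil (proj V Y Z) y z)"
proof -
  let ?XY = "bimod_tensor V X Y" and ?YZ = "bimod_tensor V Y Z" and ?k = "bimod_assoc V X Y Z"
  note T = is_bimodule_bimod_tensor[OF X Y XY] and U = is_bimodule_bimod_tensor[OF Y Z YZ]
  have TZ: "RAlg ?XY = LAlg Z" and XU: "RAlg X = LAlg ?YZ" using XY YZ by simp_all
  note S = is_bimodule_simps[OF X] is_bimodule_simps[OF Y] is_bimodule_simps[OF Z]
    proj_simps[OF X Y XY] proj_simps[OF Y Z YZ] proj_simps[OF T Z TZ] proj_simps[OF X U XU]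
  note A = bimod_assoc[OF X Y Z XY YZ]
  have "app ?k (bil (proj V ?XY Z) (bil (proj V X Y) x y) z) = bil (?k \<cdot> proj V ?XY Z) (bil (proj V X Y) x y) z"
    using A S x by (simp add: in_hom_iff)
  also have "\<dots> = bil (proj V X ?YZ) x (bil (proj V Y Z) y z)"
    by (rule bil_assoc) (use A S x in \<open>auto simp: in_hom_iff\<close>)
  finally show ?thesis .
qed

text \<open>Associativity of the left action says exactly that \<open>LAct X\<close> is balanced, so
  it descends to the tensor product. The right action is treated in the same way by
  \<open>bimod_runit\<close>.\<close>

lemma bimod_lunit:
  assumes X: "is_bimodule V X"
  shows "bimod_lunit V X \<in> hom V (Cod V (proj V (regular_bimod (LAlg X)) X)) (BCar X) \<and>
    bimod_lunit V X \<cdot> proj V (regular_bimod (LAlg X)) X = LAct X"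
proof -
  note S = is_bimodule_simps[OF X]
  note R = is_bimodule_regular[OF S(1)]
  have RX: "RAlg (regular_bimod (LAlg X)) = LAlg X" by simp
  let ?a = "gen (Car (LAlg X))"
  have "\<exists>!k. k \<in> hom V (Cod V (proj V (regular_bimod (LAlg X)) X)) (Cod V (LAct X)) \<and>
      k \<cdot> proj V (regular_bimod (LAlg X)) X = LAct X"
    by (rule proj_factor[OF R X RX, of ?a "gen (BCar X)" ?a]) (use S in \<open>auto simp: bimodule_assoc[OF X]\<close>)
  from theI'[OF this] show ?thesis using S by (simp add: bimod_lunit_def)
qed

lemma bimod_runit:
  assumes X: "is_bimodule V X"
  shows "bimod_runit V X \<in> hom V (Cod V (proj V X (regular_bimod (RAlg X)))) (BCar X) \<and>
    bimod_runit V X \<cdot> proj V X (regular_bimod (RAlg X)) = RAct X"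
proof -
  note S = is_bimodule_simps[OF X]
  note R = is_bimodule_regular[OF S(2)]
  have XR: "RAlg X = LAlg (regular_bimod (RAlg X))" by simp
  let ?a = "gen (Car (RAlg X))"
  have "\<exists>!k. k \<in> hom V (Cod V (proj V X (regular_bimod (RAlg X)))) (Cod V (RAct X)) \<and>
      k \<cdot> proj V X (regular_bimod (RAlg X)) = RAct X"
    by (rule proj_factor[OF X R XR, of "gen (BCar X)" ?a ?a]) (use S in \<open>auto simp: bimodule_assoc[OF X]\<close>)
  from theI'[OF this] show ?thesis using S by (simp add: bimod_runit_def)
qed

text \<open>The factor k exists by \<open>bal\<close>. Its linearity is tested on the projection of
  x and y, where k takes the value of t and the actions are those of X and Y.\<close>

lemma induced_bimod_map:
  assumes X: "is_bimodule V X" and Y: "is_bimodule V Y"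
    and XY: "RAlg X = LAlg Y" "LAlg X = R" "RAlg Y = R"
    and t: "t \<in> Arr V" "Dom V t = BCar X \<otimes> BCar Y" "Cod V t = Car R"
    and d: "dense x" "obj x = BCar X" "dense y" "obj y = BCar Y" "dense r" "obj r = Car R"
      "dense s" "obj s = Car (RAlg X)"
    and bal: "bil t (bil (RAct X) x s) y = bil t x (bil (LAct Y) s y)"
    and lin: "bil t (bil (LAct X) r x) y = bil (Mul R) r (bil t x y)"
      "bil t x (bil (RAct Y) y r) = bil (Mul R) (bil t x y) r"
  shows "\<exists>k \<in> bimod_maps V (bimod_tensor V X Y) (regular_bimod R). k \<cdot> proj V X Y = t"
proof -
  let ?T = "bimod_tensor V X Y"
  note S = is_bimodule_simps[OF X] is_bimodule_simps[OF Y] XY proj_simps[OF X Y XY(1)]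
    bimod_tensor_Act_simps[OF X Y XY(1)]
  have "\<exists>!k. k \<in> hom V (Cod V (proj V X Y)) (Cod V t) \<and> k \<cdot> proj V X Y = t"
    by (rule proj_factor[OF X Y XY(1) d(1,2,3,4,7,8) t(1,2) bal])
  then obtain k where "k \<in> hom V (Cod V (proj V X Y)) (Cod V t)" and k: "k \<cdot> proj V X Y = t" by blast
  then have k': "k \<in> Arr V" "Dom V k = Cod V (proj V X Y)" "Cod V k = Car R" using t by (auto simp: in_hom_iff)
  have K: "app k (bil (proj V X Y) u v) = bil t u v" if "elem u" "elem v" "obj u = BCar X" "obj v = BCar Y" for u v
    using that k k' S by simp
  let ?w = "bil (proj V X Y) x y"
  have "k \<in> bimod_maps V ?T (regular_bimod R)"
  proof (rule bimod_mapsI[of _ _ _ r ?w r])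
    show "app k (bil (LAct ?T) r ?w) = bil (LAct (regular_bimod R)) r (app k ?w)"
      using lin d S K by (simp add: bimod_tensor_act[OF X Y XY(1)] del: app_bil)
    show "app k (bil (RAct ?T) ?w r) = bil (RAct (regular_bimod R)) (app k ?w) r"
      using lin d S K by (simp add: bimod_tensor_act[OF X Y XY(1)] del: app_bil)
    show "dense ?w" using d S by (intro dense_bil) auto
    show "is_bimodule V (regular_bimod R)" using S is_bimodule_regular by metis
  qed (use k' d S is_bimodule_bimod_tensor[OF X Y XY(1)] in auto)
  then show ?thesis using k by blast
qed

text \<open>On the dense element that x, y, x give in (X \<otimes> Y) \<otimes> X, the two sides
  evaluate to x b(y,x) and t(x,y) x, which \<open>E\<close> identifies. Exchanging the roles of X
  and Y yields the other equation of a Morita context.\<close>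

lemma morita_equation:
  assumes X: "is_bimodule V X" and Y: "is_bimodule V Y" and XY: "RAlg X = LAlg Y" "LAlg X = RAlg Y"
    and t: "t \<in> bimod_maps V (bimod_tensor V X Y) (regular_bimod (LAlg X))"
    and b: "b \<in> bimod_maps V (bimod_tensor V Y X) (regular_bimod (RAlg X))"
    and d: "dense x" "obj x = BCar X" "dense y" "obj y = BCar Y"
    and E: "bil (RAct X) x (bil (b \<cdot> proj V Y X) y x) = bil (LAct X) (bil (t \<cdot> proj V X Y) x y) x"
  shows "bimod_runit V X
      \<cdot> map_tensor V X X (bimod_tensor V Y X) (regular_bimod (RAlg X)) (Idn V (BCar X)) b
      \<cdot> bimod_assoc V X Y X
    = bimod_lunit V X
      \<cdot> map_tensor V (bimod_tensor V X Y) (regular_bimod (LAlg X)) X X t (Idn V (BCar X))"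
proof -
  let ?XY = "bimod_tensor V X Y" and ?YX = "bimod_tensor V Y X"
    and ?R = "regular_bimod (LAlg X)" and ?S = "regular_bimod (RAlg X)"
  have YX: "RAlg Y = LAlg X" using XY by simp
  note T = is_bimodule_bimod_tensor[OF X Y XY(1)] and U = is_bimodule_bimod_tensor[OF Y X YX]
  note R = bimod_maps_simps(5)[OF t] and S = bimod_maps_simps(5)[OF b]
  have TX: "RAlg ?XY = LAlg X" and XU: "RAlg X = LAlg ?YX" and RX: "RAlg ?R = LAlg X" and XS: "RAlg X = LAlg ?S"
    using XY by simp_all
  have i: "Idn V (BCar X) \<in> bimod_maps V X X"
    using is_bimodule_simps[OF X] X by (simp add: bimod_maps_def in_hom_iff)
  note A = is_bimodule_simps[OF X] is_bimodule_simps[OF Y] proj_simps[OF X Y XY(1)] proj_simps[OF Y X YX]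
    proj_simps[OF T X TX] proj_simps[OF X U XU] proj_simps[OF R X RX] proj_simps[OF X S XS]
    bimod_maps_simps(1-3)[OF t] bimod_maps_simps(1-3)[OF b]
  have M: "bimod_assoc V X Y X \<in> hom V (Cod V (proj V ?XY X)) (Cod V (proj V X ?YX))"
    "map_tensor V X X ?YX ?S (Idn V (BCar X)) b \<in> hom V (Cod V (proj V X ?YX)) (Cod V (proj V X ?S))"
    "map_tensor V ?XY ?R X X t (Idn V (BCar X)) \<in> hom V (Cod V (proj V ?XY X)) (Cod V (proj V ?R X))"
    "bimod_lunit V X \<in> hom V (Cod V (proj V ?R X)) (BCar X)"
    "bimod_runit V X \<in> hom V (Cod V (proj V X ?S)) (BCar X)"
    using bimod_assoc[OF X Y X XY(1) YX] map_tensor[OF i b XU] map_tensor[OF t i TX] bimod_lunit[OF X] bimod_runit[OF X]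
    by auto
  let ?v = "bil (proj V X Y) x y"
  let ?w = "bil (proj V ?XY X) ?v x"
  have v: "dense ?v" using d A by (intro dense_bil) auto
  have w: "dense ?w" using d v A by (intro dense_bil) auto
  have "app (bimod_runit V X) (app (map_tensor V X X ?YX ?S (Idn V (BCar X)) b) (app (bimod_assoc V X Y X) ?w))
     = app (bimod_runit V X) (bil (proj V X ?S) (app (Idn V (BCar X)) x) (app b (bil (proj V Y X) y x)))"
    using d A by (simp add: app_bimod_assoc[OF X Y X XY(1) YX] app_map_tensor[OF i b XU] del: app_bil)
  also have "\<dots> = bil (RAct X) x (bil (b \<cdot> proj V Y X) y x)"
    using d A bimod_runit[OF X] by (simp add: app_Idn in_hom_iff)
  also have "\<dots> = bil (LAct X) (bil (t \<cdot> proj V X Y) x y) x" by (rule E)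
  also have "\<dots> = app (bimod_lunit V X) (bil (proj V ?R X) (app t ?v) (app (Idn V (BCar X)) x))"
    using d A bimod_lunit[OF X] by (simp add: app_Idn in_hom_iff)
  also have "\<dots> = app (bimod_lunit V X) (app (map_tensor V ?XY ?R X X t (Idn V (BCar X))) ?w)"
    using d A v by (simp add: app_map_tensor[OF t i TX] del: app_bil)
  finally have "app (bimod_runit V X \<cdot> map_tensor V X X ?YX ?S (Idn V (BCar X)) b \<cdot> bimod_assoc V X Y X) ?w
     = app (bimod_lunit V X \<cdot> map_tensor V ?XY ?R X X t (Idn V (BCar X))) ?w"
    using w M A d v by (simp add: app_app in_hom_iff del: app_bil)
  then show ?thesis
    by (rule app_dense_cancel[OF _ w]) (use M A d v in \<open>auto simp: in_hom_iff\<close>)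
qed

section \<open>Morita contexts in the bicategory of bimodules\<close>

lemma Bim_simps [simp]:
  "Cell0 (Bim V) = {R. is_algebra V R}" "Cell1 (Bim V) = {X. is_bimodule V X}"
  "Src (Bim V) = LAlg" "Trg (Bim V) = RAlg" "Unit1 (Bim V) = regular_bimod"
  "HComp1 (Bim V) = bimod_tensor V" "Cell2 (Bim V) = bimod_maps V" "Id2 (Bim V) = (\<lambda>X. Idn V (BCar X))"
  "VComp (Bim V) = Cmp V" "HComp2 (Bim V) = map_tensor V" "Assoc (Bim V) = bimod_assoc V"
  "LUnit (Bim V) = bimod_lunit V" "RUnit (Bim V) = bimod_runit V"
  by (simp_all add: Bim_def)

text \<open>Reduces a Morita context to eight equations between elements: balancedness and two
  linearity laws for each pairing, and the two Morita equations.\<close>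

lemma Bim_morita_contextI:
  assumes X: "is_bimodule V X" "LAlg X = R" "RAlg X = S" and Y: "is_bimodule V Y" "LAlg Y = S" "RAlg Y = R"
    and t: "t \<in> hom V (BCar X \<otimes> BCar Y) (Car R)"
    and b: "b \<in> hom V (BCar Y \<otimes> BCar X) (Car S)"
    and d: "dense x" "obj x = BCar X" "dense y" "obj y = BCar Y" "dense r" "obj r = Car R" "dense s" "obj s = Car S"
    and t_balanced: "bil t (bil (RAct X) x s) y = bil t x (bil (LAct Y) s y)"
    and t_linear: "bil t (bil (LAct X) r x) y = bil (Mul R) r (bil t x y)"
      "bil t x (bil (RAct Y) y r) = bil (Mul R) (bil t x y) r"
    and b_balanced: "bil b (bil (RAct Y) y r) x = bil b y (bil (LAct X) r x)"
    and b_linear: "bil b (bil (LAct Y) s y) x = bil (Mul S) s (bil b y x)"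
      "bil b y (bil (RAct X) x s) = bil (Mul S) (bil b y x) s"
    and morita: "bil (RAct X) x (bil b y x) = bil (LAct X) (bil t x y) x"
      "bil (RAct Y) y (bil t x y) = bil (LAct Y) (bil b y x) y"
  shows "\<exists>tri btri. tri \<in> Cell2 (Bim V) (X \<bullet>\<^bsub>Bim V\<^esub> Y) (Unit1 (Bim V) R) \<and> tri \<cdot> proj V X Y = t \<and>
     btri \<in> Cell2 (Bim V) (Y \<bullet>\<^bsub>Bim V\<^esub> X) (Unit1 (Bim V) S) \<and> btri \<cdot> proj V Y X = b \<and>
     morita_context (Bim V) R S X Y tri btri"
proof -
  obtain tri where tri: "tri \<in> bimod_maps V (bimod_tensor V X Y) (regular_bimod R)" "tri \<cdot> proj V X Y = t"
    using induced_bimod_map[of X Y R t x y r s] assms by (auto simp: in_hom_iff)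
  obtain btri where btri: "btri \<in> bimod_maps V (bimod_tensor V Y X) (regular_bimod S)" "btri \<cdot> proj V Y X = b"
    using induced_bimod_map[of Y X S b y x s r] assms by (auto simp: in_hom_iff)
  have "is_algebra V R" "is_algebra V S" using X is_bimodule_simps by auto
  then show ?thesis
    using morita_equation[of X Y tri btri x y] morita_equation[of Y X btri tri y x] tri btri X Y d morita
    by (intro exI[of _ tri] exI[of _ btri]) (simp add: morita_context_def hom1_def)
qed

end

section \<open>Braided monoidal categories\<close>

context braided_category
begin

lemma Brd_simps [simp]:
  assumes "x \<in> Obj V" "y \<in> Obj V"
  shows "Brd V x y \<in> Arr V" "Dom V (Brd V x y) = x \<otimes> y" "Cod V (Brd V x y) = y \<otimes> x" "is_iso V (Brd V x y)"
  using Brd_in_hom[OF assms] Brd_iso[OF assms] by (auto simp: in_hom_iff)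

lemma swap_simps [simp]:
  assumes "x \<in> Obj V" "y \<in> Obj V"
  shows "swap V x y \<in> Arr V" "Dom V (swap V x y) = x \<otimes> y" "Cod V (swap V x y) = y \<otimes> x" "is_iso V (swap V x y)"
  using assms by (auto simp: swap_def)

lemma Brd_nat:
  assumes "f \<in> Arr V" "g \<in> Arr V" "Cod V f = x" "Cod V g = y"
  shows "Brd V x y \<cdot> (f \<odot> g) = (g \<odot> f) \<cdot> Brd V (Dom V f) (Dom V g)"
  using Brd_natural[of f "Dom V f" "Cod V f" g "Dom V g" "Cod V g"] assms by (simp add: in_hom_iff)

lemma swap_nat:
  assumes "f \<in> Arr V" "g \<in> Arr V" "Cod V f = x" "Cod V g = y"
  shows "swap V x y \<cdot> (f \<odot> g) = (g \<odot> f) \<cdot> swap V (Dom V f) (Dom V g)"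
proof -
  have "f \<odot> g = (Brd V y x \<cdot> (g \<odot> f)) \<cdot> swap V (Dom V f) (Dom V g)"
    using assms Brd_nat[of g f y x] by (auto simp: swap_def)
  then show ?thesis using assms by (auto simp: swap_def)
qed

text \<open>The argument of Joyal and Street: a hexagon with two arguments equal to the unit, from
  which one invertible braiding is cancelled. \<open>Run_Brd\<close> applies it to the other
  hexagon.\<close>

lemma Lun_Brd:
  assumes [simp]: "x \<in> Obj V"
  shows "Lun V x \<cdot> Brd V x (Unt V) = Run V x"
proof (rule TenA_Unt_cancel)
  let ?I = "Unt V" and ?b = "Brd V x (Unt V)"
  have "?b \<cdot> (Run V x \<odot> Idn V ?I) = ?b \<cdot> ((Idn V x \<odot> Lun V ?I) \<cdot> Asc V x ?I ?I)"
    by (subst triangle) auto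
  also have "\<dots> = (?b \<cdot> (Idn V x \<odot> Lun V ?I)) \<cdot> Asc V x ?I ?I"
    by (subst Cmp_Cmp) auto
  also have "\<dots> = (Lun V ?I \<odot> Idn V x) \<cdot> Brd V x (?I \<otimes> ?I) \<cdot> Asc V x ?I ?I"
    by (subst Brd_nat) auto
  also have "\<dots> = Lun V (?I \<otimes> x) \<cdot> (Asc V ?I ?I x \<cdot> Brd V x (?I \<otimes> ?I) \<cdot> Asc V x ?I ?I)"
    by (subst Lun_TenO[symmetric]) auto
  also have "\<dots> = Lun V (?I \<otimes> x) \<cdot> ((Idn V ?I \<odot> ?b) \<cdot> Asc V ?I x ?I \<cdot> (?b \<odot> Idn V ?I))"
    by (subst hexagon_right) auto
  also have "\<dots> = (Lun V (?I \<otimes> x) \<cdot> (Idn V ?I \<odot> ?b)) \<cdot> Asc V ?I x ?I \<cdot> (?b \<odot> Idn V ?I)"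
    by (subst Cmp_Cmp) auto
  also have "\<dots> = ?b \<cdot> (Lun V (x \<otimes> ?I) \<cdot> Asc V ?I x ?I) \<cdot> (?b \<odot> Idn V ?I)"
    by (subst Lun_nat) auto
  also have "\<dots> = ?b \<cdot> ((Lun V x \<odot> Idn V ?I) \<cdot> (?b \<odot> Idn V ?I))"
    by (subst Lun_TenO) auto
  also have "\<dots> = ?b \<cdot> ((Lun V x \<cdot> ?b) \<odot> Idn V ?I)" by simp
  finally show "(Lun V x \<cdot> ?b) \<odot> Idn V ?I = Run V x \<odot> Idn V ?I"
    by (subst (asm) iso_cancel_left) auto
qed auto

lemma Run_Brd:
  assumes [simp]: "x \<in> Obj V"
  shows "Run V x \<cdot> Brd V (Unt V) x = Lun V x"
proof (rule Unt_TenA_cancel)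
  let ?I = "Unt V" and ?b = "Brd V (Unt V) x"
  have xI: "Run V (x \<otimes> ?I) \<cdot> iso_inv V (Asc V x ?I ?I) = Idn V x \<odot> Run V ?I"
    using iso_move_right[OF Run_TenO[of x ?I]] by simp
  have Ix: "Run V (?I \<otimes> x) \<cdot> iso_inv V (Asc V ?I x ?I) = Idn V ?I \<odot> Run V x"
    using iso_move_right[OF Run_TenO[of ?I x]] by simp
  have "?b \<cdot> (Idn V ?I \<odot> Lun V x) = ?b \<cdot> ((Run V ?I \<odot> Idn V x) \<cdot> iso_inv V (Asc V ?I ?I x))"
    by (simp add: TenA_Run_Asc_inv)
  also have "\<dots> = (?b \<cdot> (Run V ?I \<odot> Idn V x)) \<cdot> iso_inv V (Asc V ?I ?I x)"
    by (subst Cmp_Cmp) auto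
  also have "\<dots> = (Idn V x \<odot> Run V ?I) \<cdot> Brd V (?I \<otimes> ?I) x \<cdot> iso_inv V (Asc V ?I ?I x)"
    by (subst Brd_nat) auto
  also have "\<dots> = Run V (x \<otimes> ?I) \<cdot> (iso_inv V (Asc V x ?I ?I) \<cdot> Brd V (?I \<otimes> ?I) x \<cdot> iso_inv V (Asc V ?I ?I x))"
    by (subst xI[symmetric]) simp
  also have "\<dots> = Run V (x \<otimes> ?I) \<cdot> ((?b \<odot> Idn V ?I) \<cdot> iso_inv V (Asc V ?I x ?I) \<cdot> (Idn V ?I \<odot> ?b))"
    by (subst hexagon_left) auto
  also have "\<dots> = (Run V (x \<otimes> ?I) \<cdot> (?b \<odot> Idn V ?I)) \<cdot> iso_inv V (Asc V ?I x ?I) \<cdot> (Idn V ?I \<odot> ?b)"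
    by (subst Cmp_Cmp) auto
  also have "\<dots> = ?b \<cdot> (Run V (?I \<otimes> x) \<cdot> iso_inv V (Asc V ?I x ?I)) \<cdot> (Idn V ?I \<odot> ?b)"
    by (subst Run_nat) auto
  also have "\<dots> = ?b \<cdot> (Idn V ?I \<odot> (Run V x \<cdot> ?b))"
    unfolding Ix by simp
  finally show "Idn V ?I \<odot> (Run V x \<cdot> ?b) = Idn V ?I \<odot> Lun V x"
    by (subst (asm) iso_cancel_left) auto
qed auto

section \<open>The inverse braiding: unit laws, hexagons, reversal of three factors\<close>

lemma Brd_Unt_left: "x \<in> Obj V \<Longrightarrow> Brd V (Unt V) x = iso_inv V (Run V x) \<cdot> Lun V x"
  and Brd_Unt_right: "x \<in> Obj V \<Longrightarrow> Brd V x (Unt V) = iso_inv V (Lun V x) \<cdot> Run V x"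
  using iso_move_left[OF Run_Brd] iso_move_left[OF Lun_Brd] by auto

lemma swap_Unt_left: "x \<in> Obj V \<Longrightarrow> swap V (Unt V) x = iso_inv V (Run V x) \<cdot> Lun V x"
  and swap_Unt_right: "x \<in> Obj V \<Longrightarrow> swap V x (Unt V) = iso_inv V (Lun V x) \<cdot> Run V x"
  by (simp_all add: swap_def Brd_Unt_left Brd_Unt_right iso_inv_Cmp)

text \<open>Obtained by inverting the left hexagon of \<open>Brd\<close>. Inversion exchanges the
  two hexagons, so together with \<open>swap_hexagon_left\<close> this shows that
  \<open>swap\<close> is itself a braiding.\<close>

lemma swap_hexagon_right:
  assumes [simp]: "x \<in> Obj V" "y \<in> Obj V" "z \<in> Obj V"
  shows "Asc V y z x \<cdot> swap V x (y \<otimes> z) \<cdot> Asc V x y z =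
    (Idn V y \<odot> swap V x z) \<cdot> Asc V y x z \<cdot> (swap V x y \<odot> Idn V z)"
proof -
  have "iso_inv V (iso_inv V (Asc V x y z) \<cdot> Brd V (y \<otimes> z) x \<cdot> iso_inv V (Asc V y z x)) =
    iso_inv V ((Brd V y x \<odot> Idn V z) \<cdot> iso_inv V (Asc V y x z) \<cdot> (Idn V y \<odot> Brd V z x))"
    using hexagon_left[of y z x] by simp
  then show ?thesis by (simp add: iso_inv_Cmp swap_def)
qed

lemma swap_hexagon_left:
  assumes [simp]: "x \<in> Obj V" "y \<in> Obj V" "z \<in> Obj V"
  shows "swap V (x \<otimes> y) z =
    Asc V z x y \<cdot> (swap V x z \<odot> Idn V y) \<cdot> iso_inv V (Asc V x z y) \<cdot> (Idn V x \<odot> swap V y z) \<cdot> Asc V x y z"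
proof -
  have "iso_inv V (Asc V x y z \<cdot> Brd V z (x \<otimes> y) \<cdot> Asc V z x y) =
    iso_inv V ((Idn V x \<odot> Brd V z y) \<cdot> Asc V x z y \<cdot> (Brd V z x \<odot> Idn V y))"
    using hexagon_right[of z x y] by simp
  then have "iso_inv V (Asc V z x y) \<cdot> swap V (x \<otimes> y) z \<cdot> iso_inv V (Asc V x y z) =
    (swap V x z \<odot> Idn V y) \<cdot> iso_inv V (Asc V x z y) \<cdot> (Idn V x \<odot> swap V y z)"
    by (simp add: iso_inv_Cmp swap_def)
  then have "(iso_inv V (Asc V z x y) \<cdot> swap V (x \<otimes> y) z) \<cdot> iso_inv V (Asc V x y z) =
    (swap V x z \<odot> Idn V y) \<cdot> iso_inv V (Asc V x z y) \<cdot> (Idn V x \<odot> swap V y z)"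
    by simp
  from iso_move_right[OF this]
  have "iso_inv V (Asc V z x y) \<cdot> swap V (x \<otimes> y) z =
    ((swap V x z \<odot> Idn V y) \<cdot> iso_inv V (Asc V x z y) \<cdot> (Idn V x \<odot> swap V y z)) \<cdot> Asc V x y z"
    by simp
  from iso_move_left[OF this] show ?thesis by simp
qed

text \<open>In effect the Yang-Baxter equation: the two ways of reversing x, y, z coincide, by
  naturality and the two hexagons.\<close>

lemma swap_reverse:
  assumes [simp]: "x \<in> Obj V" "y \<in> Obj V" "z \<in> Obj V"
  shows "Asc V z y x \<cdot> (swap V y z \<odot> Idn V x) \<cdot> swap V x (y \<otimes> z) \<cdot> Asc V x y z =
    (Idn V z \<odot> swap V x y) \<cdot> swap V (x \<otimes> y) z"
proof -
  have nat: "(swap V y z \<odot> Idn V x) \<cdot> swap V x (y \<otimes> z) = swap V x (z \<otimes> y) \<cdot> (Idn V x \<odot> swap V y z)"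
    using swap_nat[of "Idn V x" "swap V y z" x "z \<otimes> y"] by simp
  have hex: "Asc V z y x \<cdot> swap V x (z \<otimes> y) =
    (Idn V z \<odot> swap V x y) \<cdot> Asc V z x y \<cdot> (swap V x z \<odot> Idn V y) \<cdot> iso_inv V (Asc V x z y)"
  proof -
    have "(Asc V z y x \<cdot> swap V x (z \<otimes> y)) \<cdot> Asc V x z y =
      (Idn V z \<odot> swap V x y) \<cdot> Asc V z x y \<cdot> (swap V x z \<odot> Idn V y)"
      using swap_hexagon_right[of x z y] by simp
    from iso_move_right[OF this] show ?thesis by simp
  qed
  have "Asc V z y x \<cdot> (swap V y z \<odot> Idn V x) \<cdot> swap V x (y \<otimes> z) \<cdot> Asc V x y z
     = Asc V z y x \<cdot> ((swap V y z \<odot> Idn V x) \<cdot> swap V x (y \<otimes> z)) \<cdot> Asc V x y z" by simp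
  also have "\<dots> = (Asc V z y x \<cdot> swap V x (z \<otimes> y)) \<cdot> (Idn V x \<odot> swap V y z) \<cdot> Asc V x y z"
    unfolding nat by simp
  also have "\<dots> = (Idn V z \<odot> swap V x y) \<cdot> swap V (x \<otimes> y) z"
    unfolding hex swap_hexagon_left[OF assms] by simp
  finally show ?thesis .
qed

text \<open>Associativity survives reading the arguments in reverse through \<open>swap\<close>: the
  two bracketings reverse the three factors in the two ways compared by
  \<open>swap_reverse\<close>.\<close>

lemma bil_swap_assoc:
  assumes E: "r \<cdot> (s \<odot> Idn V x) = r' \<cdot> (Idn V z \<odot> s') \<cdot> Asc V z y x"
    and [simp]: "x \<in> Obj V" "y \<in> Obj V" "z \<in> Obj V"
    and [simp]: "s \<in> Arr V" "Dom V s = z \<otimes> y" "r \<in> Arr V" "Dom V r = Cod V s \<otimes> x"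
    "s' \<in> Arr V" "Dom V s' = y \<otimes> x" "r' \<in> Arr V" "Dom V r' = z \<otimes> Cod V s'"
  shows "(r' \<cdot> swap V (Cod V s') z) \<cdot> ((s' \<cdot> swap V x y) \<odot> Idn V z) =
    (r \<cdot> swap V x (Cod V s)) \<cdot> (Idn V x \<odot> (s \<cdot> swap V y z)) \<cdot> Asc V x y z"
proof -
  have "(r \<cdot> swap V x (Cod V s)) \<cdot> (Idn V x \<odot> (s \<cdot> swap V y z)) \<cdot> Asc V x y z
    = r \<cdot> (swap V x (Cod V s) \<cdot> (Idn V x \<odot> s)) \<cdot> (Idn V x \<odot> swap V y z) \<cdot> Asc V x y z" by simp
  also have "swap V x (Cod V s) \<cdot> (Idn V x \<odot> s) = (s \<odot> Idn V x) \<cdot> swap V x (z \<otimes> y)"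
    by (subst swap_nat) auto
  also have "r \<cdot> ((s \<odot> Idn V x) \<cdot> swap V x (z \<otimes> y)) \<cdot> (Idn V x \<odot> swap V y z) \<cdot> Asc V x y z
    = (r \<cdot> (s \<odot> Idn V x)) \<cdot> (swap V x (z \<otimes> y) \<cdot> (Idn V x \<odot> swap V y z)) \<cdot> Asc V x y z" by simp
  also have "swap V x (z \<otimes> y) \<cdot> (Idn V x \<odot> swap V y z) = (swap V y z \<odot> Idn V x) \<cdot> swap V x (y \<otimes> z)"
    by (subst swap_nat) auto
  also have "(r \<cdot> (s \<odot> Idn V x)) \<cdot> ((swap V y z \<odot> Idn V x) \<cdot> swap V x (y \<otimes> z)) \<cdot> Asc V x y z
    = r' \<cdot> (Idn V z \<odot> s') \<cdot> (Asc V z y x \<cdot> (swap V y z \<odot> Idn V x) \<cdot> swap V x (y \<otimes> z) \<cdot> Asc V x y z)"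
    unfolding E by simp
  also have "\<dots> = r' \<cdot> ((Idn V z \<odot> (s' \<cdot> swap V x y)) \<cdot> swap V (x \<otimes> y) z)"
    unfolding swap_reverse[OF assms(2-4)] by simp
  also have "(Idn V z \<odot> (s' \<cdot> swap V x y)) \<cdot> swap V (x \<otimes> y) z = swap V (Cod V s') z \<cdot> ((s' \<cdot> swap V x y) \<odot> Idn V z)"
    by (subst swap_nat) auto
  finally show ?thesis by simp
qed

section \<open>Exchange of the middle factors when some of the four factors are the unit\<close>

lemma exchange_Unt_2:
  assumes [simp]: "a \<in> Obj V" "c \<in> Obj V" "d \<in> Obj V"
  shows "exchange V a (Unt V) c d =
    (Idn V (a \<otimes> c) \<odot> iso_inv V (Lun V d)) \<cdot> iso_inv V (Asc V a c d) \<cdot> (Run V a \<odot> Idn V (c \<otimes> d))"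
proof -
  let ?I = "Unt V"
  have "Asc V c ?I d \<cdot> (Brd V ?I c \<odot> Idn V d) \<cdot> iso_inv V (Asc V ?I c d)
    = (Asc V c ?I d \<cdot> (iso_inv V (Run V c) \<odot> Idn V d)) \<cdot> ((Lun V c \<odot> Idn V d) \<cdot> iso_inv V (Asc V ?I c d))"
    by (simp add: Brd_Unt_left)
  also have "\<dots> = (Idn V c \<odot> iso_inv V (Lun V d)) \<cdot> Lun V (c \<otimes> d)"
    by (simp only: Asc_TenA_Run_inv TenA_Lun_Asc_inv assms)
  finally have mid: "Asc V c ?I d \<cdot> (Brd V ?I c \<odot> Idn V d) \<cdot> iso_inv V (Asc V ?I c d)
    = (Idn V c \<odot> iso_inv V (Lun V d)) \<cdot> Lun V (c \<otimes> d)" .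
  have "exchange V a ?I c d = iso_inv V (Asc V a c (?I \<otimes> d)) \<cdot> (Idn V a \<odot> (Idn V c \<odot> iso_inv V (Lun V d)))
     \<cdot> ((Idn V a \<odot> Lun V (c \<otimes> d)) \<cdot> Asc V a ?I (c \<otimes> d))"
    unfolding exchange_def mid by simp
  also have "(Idn V a \<odot> Lun V (c \<otimes> d)) \<cdot> Asc V a ?I (c \<otimes> d) = Run V a \<odot> Idn V (c \<otimes> d)"
    by (subst triangle) auto
  also have "iso_inv V (Asc V a c (?I \<otimes> d)) \<cdot> (Idn V a \<odot> (Idn V c \<odot> iso_inv V (Lun V d))) \<cdot> (Run V a \<odot> Idn V (c \<otimes> d))
    = (iso_inv V (Asc V a c (?I \<otimes> d)) \<cdot> (Idn V a \<odot> (Idn V c \<odot> iso_inv V (Lun V d)))) \<cdot> (Run V a \<odot> Idn V (c \<otimes> d))"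
    by (subst Cmp_Cmp) auto
  also have "iso_inv V (Asc V a c (?I \<otimes> d)) \<cdot> (Idn V a \<odot> (Idn V c \<odot> iso_inv V (Lun V d)))
    = (Idn V (a \<otimes> c) \<odot> iso_inv V (Lun V d)) \<cdot> iso_inv V (Asc V a c d)"
    by (subst Asc_inv_nat) auto
  finally show ?thesis by simp
qed

lemma exchange_Unt_3:
  assumes [simp]: "a \<in> Obj V" "b \<in> Obj V" "d \<in> Obj V"
  shows "exchange V a b (Unt V) d =
    (iso_inv V (Run V a) \<odot> Idn V (b \<otimes> d)) \<cdot> Asc V a b d \<cdot> (Idn V (a \<otimes> b) \<odot> Lun V d)"
proof -
  let ?I = "Unt V"
  have "Asc V ?I b d \<cdot> (Brd V b ?I \<odot> Idn V d) \<cdot> iso_inv V (Asc V b ?I d)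
    = (Asc V ?I b d \<cdot> (iso_inv V (Lun V b) \<odot> Idn V d)) \<cdot> ((Run V b \<odot> Idn V d) \<cdot> iso_inv V (Asc V b ?I d))"
    by (simp add: Brd_Unt_right)
  also have "\<dots> = iso_inv V (Lun V (b \<otimes> d)) \<cdot> (Idn V b \<odot> Lun V d)"
    by (simp only: Asc_TenA_Lun_inv TenA_Run_Asc_inv assms)
  finally have mid: "Asc V ?I b d \<cdot> (Brd V b ?I \<odot> Idn V d) \<cdot> iso_inv V (Asc V b ?I d)
    = iso_inv V (Lun V (b \<otimes> d)) \<cdot> (Idn V b \<odot> Lun V d)" .
  have *: "iso_inv V (Asc V a ?I (b \<otimes> d)) \<cdot> (Idn V a \<odot> iso_inv V (Lun V (b \<otimes> d))) = iso_inv V (Run V a) \<odot> Idn V (b \<otimes> d)"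
    by (subst Asc_TenA_Run_inv[symmetric]) auto
  have "exchange V a b ?I d = (iso_inv V (Asc V a ?I (b \<otimes> d)) \<cdot> (Idn V a \<odot> iso_inv V (Lun V (b \<otimes> d))))
     \<cdot> ((Idn V a \<odot> (Idn V b \<odot> Lun V d)) \<cdot> Asc V a b (?I \<otimes> d))"
    unfolding exchange_def mid by simp
  also have "(Idn V a \<odot> (Idn V b \<odot> Lun V d)) \<cdot> Asc V a b (?I \<otimes> d) = Asc V a b d \<cdot> ((Idn V a \<odot> Idn V b) \<odot> Lun V d)"
    by (subst Asc_nat) auto
  finally show ?thesis unfolding * by simp
qed

text \<open>Here the outer factors are trivial instead of a middle one, and the braiding of the
  middle factors survives. This is how a braiding enters
  \<open>VCmp_lwhisker_rwhisker\<close>.\<close>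

lemma exchange_Unt_Unt:
  assumes [simp]: "b \<in> Obj V" "c \<in> Obj V"
  shows "exchange V (Unt V) b c (Unt V) =
    (iso_inv V (Lun V c) \<odot> iso_inv V (Run V b)) \<cdot> Brd V b c \<cdot> (Lun V b \<odot> Run V c)"
proof -
  let ?I = "Unt V"
  let ?m = "Asc V c b ?I \<cdot> (Brd V b c \<odot> Idn V ?I) \<cdot> iso_inv V (Asc V b c ?I)"
  have 1: "(Lun V c \<odot> Idn V (b \<otimes> ?I)) \<cdot> iso_inv V (Asc V ?I c (b \<otimes> ?I)) = Lun V (c \<otimes> (b \<otimes> ?I))"
    by (simp add: TenA_Lun_Asc_inv)
  have "(Lun V c \<odot> Run V b) \<cdot> exchange V ?I b c ?I
     = (Idn V c \<odot> Run V b) \<cdot> ((Lun V c \<odot> Idn V (b \<otimes> ?I)) \<cdot> iso_inv V (Asc V ?I c (b \<otimes> ?I)))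
        \<cdot> (Idn V ?I \<odot> ?m) \<cdot> Asc V ?I b (c \<otimes> ?I)"
    unfolding exchange_def by simp
  also have "\<dots> = (Idn V c \<odot> Run V b) \<cdot> (Lun V (c \<otimes> (b \<otimes> ?I)) \<cdot> (Idn V ?I \<odot> ?m)) \<cdot> Asc V ?I b (c \<otimes> ?I)"
    unfolding 1 by simp
  also have "Lun V (c \<otimes> (b \<otimes> ?I)) \<cdot> (Idn V ?I \<odot> ?m) = ?m \<cdot> Lun V (b \<otimes> (c \<otimes> ?I))"
    by (subst Lun_nat) auto
  also have "(Idn V c \<odot> Run V b) \<cdot> (?m \<cdot> Lun V (b \<otimes> (c \<otimes> ?I))) \<cdot> Asc V ?I b (c \<otimes> ?I)
     = ((Idn V c \<odot> Run V b) \<cdot> Asc V c b ?I) \<cdot> (Brd V b c \<odot> Idn V ?I) \<cdot> iso_inv V (Asc V b c ?I)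
       \<cdot> (Lun V (b \<otimes> (c \<otimes> ?I)) \<cdot> Asc V ?I b (c \<otimes> ?I))"
    by simp
  also have "\<dots> = (Run V (c \<otimes> b) \<cdot> (Brd V b c \<odot> Idn V ?I)) \<cdot> iso_inv V (Asc V b c ?I) \<cdot> (Lun V b \<odot> Idn V (c \<otimes> ?I))"
    by (subst Run_TenO, simp, simp, subst Lun_TenO) auto
  also have "Run V (c \<otimes> b) \<cdot> (Brd V b c \<odot> Idn V ?I) = Brd V b c \<cdot> Run V (b \<otimes> c)"
    by (subst Run_nat) auto
  also have "Run V (b \<otimes> c) = (Idn V b \<odot> Run V c) \<cdot> Asc V b c ?I"
    by (subst Run_TenO) auto
  finally have "(Lun V c \<odot> Run V b) \<cdot> exchange V ?I b c ?I = Brd V b c \<cdot> (Lun V b \<odot> Run V c)"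
    by simp
  moreover have "exchange V ?I b c ?I \<in> Arr V" "Cod V (exchange V ?I b c ?I) = (?I \<otimes> c) \<otimes> (b \<otimes> ?I)"
    by (simp_all add: exchange_def)
  ultimately show ?thesis
    using iso_move_left[of "Lun V c \<odot> Run V b" "exchange V ?I b c ?I" "Brd V b c \<cdot> (Lun V b \<odot> Run V c)"] by simp
qed

lemma exchange_simps [simp]:
  assumes "a \<in> Obj V" "b \<in> Obj V" "c \<in> Obj V" "d \<in> Obj V"
  shows "exchange V a b c d \<in> Arr V" "Dom V (exchange V a b c d) = (a \<otimes> b) \<otimes> (c \<otimes> d)"
    "Cod V (exchange V a b c d) = (a \<otimes> c) \<otimes> (b \<otimes> d)"
  using assms by (simp_all add: exchange_def)

lemma exchange_nat:
  assumes [simp]: "f \<in> Arr V" "g \<in> Arr V" "h \<in> Arr V" "k \<in> Arr V"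
    and [simp]: "Dom V f = a" "Dom V g = b" "Dom V h = c" "Dom V k = d"
    and [simp]: "Cod V f = a'" "Cod V g = b'" "Cod V h = c'" "Cod V k = d'"
  shows "exchange V a' b' c' d' \<cdot> ((f \<odot> g) \<odot> (h \<odot> k)) = ((f \<odot> h) \<odot> (g \<odot> k)) \<cdot> exchange V a b c d"
proof -
  have [simp]: "a \<in> Obj V" "b \<in> Obj V" "c \<in> Obj V" "d \<in> Obj V" "a' \<in> Obj V" "b' \<in> Obj V" "c' \<in> Obj V" "d' \<in> Obj V"
    using Dom_in_Obj[of f] Dom_in_Obj[of g] Dom_in_Obj[of h] Dom_in_Obj[of k]
      Cod_in_Obj[of f] Cod_in_Obj[of g] Cod_in_Obj[of h] Cod_in_Obj[of k] by simp_all
  let ?m' = "Asc V c' b' d' \<cdot> (Brd V b' c' \<odot> Idn V d') \<cdot> iso_inv V (Asc V b' c' d')"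
  let ?m = "Asc V c b d \<cdot> (Brd V b c \<odot> Idn V d) \<cdot> iso_inv V (Asc V b c d)"
  have "?m' \<cdot> (g \<odot> (h \<odot> k)) = Asc V c' b' d' \<cdot> (Brd V b' c' \<odot> Idn V d') \<cdot> (iso_inv V (Asc V b' c' d') \<cdot> (g \<odot> (h \<odot> k)))"
    by simp
  also have "\<dots> = Asc V c' b' d' \<cdot> ((Brd V b' c' \<cdot> (g \<odot> h)) \<odot> k) \<cdot> iso_inv V (Asc V b c d)"
    by (subst Asc_inv_nat) auto
  also have "\<dots> = (Asc V c' b' d' \<cdot> ((h \<odot> g) \<odot> k)) \<cdot> (Brd V b c \<odot> Idn V d) \<cdot> iso_inv V (Asc V b c d)"
    by (subst Brd_nat) auto
  also have "\<dots> = (h \<odot> (g \<odot> k)) \<cdot> ?m"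
    by (subst Asc_nat) auto
  finally have m: "?m' \<cdot> (g \<odot> (h \<odot> k)) = (h \<odot> (g \<odot> k)) \<cdot> ?m" .
  have "exchange V a' b' c' d' \<cdot> ((f \<odot> g) \<odot> (h \<odot> k))
     = iso_inv V (Asc V a' c' (b' \<otimes> d')) \<cdot> (Idn V a' \<odot> ?m') \<cdot> (Asc V a' b' (c' \<otimes> d') \<cdot> ((f \<odot> g) \<odot> (h \<odot> k)))"
    by (simp add: exchange_def)
  also have "\<dots> = iso_inv V (Asc V a' c' (b' \<otimes> d')) \<cdot> (Idn V a' \<odot> ?m') \<cdot> ((f \<odot> (g \<odot> (h \<odot> k))) \<cdot> Asc V a b (c \<otimes> d))"
    by (subst Asc_nat) auto
  also have "\<dots> = iso_inv V (Asc V a' c' (b' \<otimes> d')) \<cdot> (f \<odot> (?m' \<cdot> (g \<odot> (h \<odot> k)))) \<cdot> Asc V a b (c \<otimes> d)"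
    by simp
  also have "\<dots> = (iso_inv V (Asc V a' c' (b' \<otimes> d')) \<cdot> (f \<odot> (h \<odot> (g \<odot> k)))) \<cdot> (Idn V a \<odot> ?m) \<cdot> Asc V a b (c \<otimes> d)"
    unfolding m by simp
  also have "\<dots> = ((f \<odot> h) \<odot> (g \<odot> k)) \<cdot> exchange V a b c d"
    by (subst Asc_inv_nat) (auto simp: exchange_def)
  finally show ?thesis .
qed

end

section \<open>The two compositions of an enriched category\<close>

locale braided_enriched_category = braided_category V + enriched_category V C
  for V :: "('o, 'm, 'z) braided_category_scheme" (structure) and C :: "('b, 'o, 'm) enriched_category"
begin

lemma EHom_Obj [simp]: "x \<in> EObj C \<Longrightarrow> y \<in> EObj C \<Longrightarrow> EHom C x y \<in> Obj V"
  by (rule EHom_in_Obj)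

lemma ECmp_simps [simp]:
  assumes "x \<in> EObj C" "y \<in> EObj C" "z \<in> EObj C"
  shows "ECmp C x y z \<in> Arr V" "Dom V (ECmp C x y z) = EHom C y z \<otimes> EHom C x y"
    "Cod V (ECmp C x y z) = EHom C x z"
  using ECmp_in_hom[OF assms] by (auto simp: in_hom_iff)

lemma EId_simps [simp]:
  assumes "x \<in> EObj C"
  shows "EId C x \<in> Arr V" "Dom V (EId C x) = Unt V" "Cod V (EId C x) = EHom C x x"
  using EId_in_hom[OF assms] by (auto simp: in_hom_iff)

text \<open>For x = y = z this is the multiplication of
  \<open>op_algebra (end_algebra C x)\<close>.\<close>

definition dcmp :: "'b \<Rightarrow> 'b \<Rightarrow> 'b \<Rightarrow> 'm" where
  "dcmp x y z = ECmp C x y z \<cdot> swap V (EHom C x y) (EHom C y z)"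

lemma dcmp_simps [simp]:
  assumes "x \<in> EObj C" "y \<in> EObj C" "z \<in> EObj C"
  shows "dcmp x y z \<in> Arr V" "Dom V (dcmp x y z) = EHom C x y \<otimes> EHom C y z"
    "Cod V (dcmp x y z) = EHom C x z"
  using assms by (auto simp: dcmp_def)

lemma bil_ECmp_assoc:
  assumes "w \<in> EObj C" "x \<in> EObj C" "y \<in> EObj C" "z \<in> EObj C"
    and "elem a" "elem b" "elem c" "obj a = EHom C y z" "obj b = EHom C x y" "obj c = EHom C w x"
  shows "bil (ECmp C w x z) (bil (ECmp C x y z) a b) c = bil (ECmp C w y z) a (bil (ECmp C w x y) b c)"
  using assms by (intro bil_assoc) (auto simp: ECmp_assoc)

lemma bil_dcmp_assoc:
  assumes "w \<in> EObj C" "x \<in> EObj C" "y \<in> EObj C" "z \<in> EObj C"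
    and "elem a" "elem b" "elem c" "obj a = EHom C w x" "obj b = EHom C x y" "obj c = EHom C y z"
  shows "bil (dcmp w y z) (bil (dcmp w x y) a b) c = bil (dcmp w x z) a (bil (dcmp x y z) b c)"
proof (rule bil_assoc)
  show "dcmp w y z \<cdot> (dcmp w x y \<odot> Idn V (obj c)) =
      dcmp w x z \<cdot> (Idn V (obj a) \<odot> dcmp x y z) \<cdot> Asc V (obj a) (obj b) (obj c)"
    using bil_swap_assoc[of "ECmp C w x z" "ECmp C x y z" "EHom C w x" "ECmp C w y z" "EHom C y z"
        "ECmp C w x y" "EHom C x y"] ECmp_assoc[of w x y z] assms
    by (simp add: dcmp_def)
qed (use assms in auto)

lemma bil_EId:
  assumes "x \<in> EObj C" "y \<in> EObj C" "elem a" "obj a = EHom C x y"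
  shows "bil (ECmp C x y y) (con (EId C y)) a = a" "bil (ECmp C x x y) a (con (EId C x)) = a"
proof -
  have "(ECmp C x y y \<cdot> (EId C y \<odot> Idn V (EHom C x y))) \<cdot> iso_inv V (Lun V (EHom C x y)) = Idn V (EHom C x y)"
    "(ECmp C x x y \<cdot> (Idn V (EHom C x y) \<odot> EId C x)) \<cdot> iso_inv V (Run V (EHom C x y)) = Idn V (EHom C x y)"
    using assms by (simp_all only: ECmp_EId_left ECmp_EId_right) simp_all
  then show "bil (ECmp C x y y) (con (EId C y)) a = a" "bil (ECmp C x x y) a (con (EId C x)) = a"
    using assms by (simp_all add: bil_con_left bil_con_right app_Idn)
qed

text \<open>Braiding with the unit is a composite of unit constraints, so against a constant the two
  compositions agree.\<close>

lemma bil_dcmp_con: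
  assumes "x \<in> EObj C" "y \<in> EObj C" "z \<in> EObj C" "e \<in> Arr V" "Dom V e = Unt V"
  shows "\<lbrakk>elem a; obj a = EHom C x y; Cod V e = EHom C y z\<rbrakk>
      \<Longrightarrow> bil (dcmp x y z) a (con e) = bil (ECmp C x y z) (con e) a"
    "\<lbrakk>elem a; obj a = EHom C y z; Cod V e = EHom C x y\<rbrakk>
      \<Longrightarrow> bil (dcmp x y z) (con e) a = bil (ECmp C x y z) a (con e)"
proof -
  assume a: "elem a" "obj a = EHom C x y" "Cod V e = EHom C y z"
  have "swap V (EHom C x y) (EHom C y z) \<cdot> (Idn V (EHom C x y) \<odot> e)
     = (e \<odot> Idn V (EHom C x y)) \<cdot> iso_inv V (Lun V (EHom C x y)) \<cdot> Run V (EHom C x y)"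
    using assms a by (simp add: swap_nat swap_Unt_right)
  from Cmp_extend[OF this, of "iso_inv V (Run V (EHom C x y))"]
  show "bil (dcmp x y z) a (con e) = bil (ECmp C x y z) (con e) a"
    using assms a by (simp add: bil_con_left bil_con_right dcmp_def)
next
  assume a: "elem a" "obj a = EHom C y z" "Cod V e = EHom C x y"
  have "swap V (EHom C x y) (EHom C y z) \<cdot> (e \<odot> Idn V (EHom C y z))
     = (Idn V (EHom C y z) \<odot> e) \<cdot> iso_inv V (Run V (EHom C y z)) \<cdot> Lun V (EHom C y z)"
    using assms a by (simp add: swap_nat swap_Unt_left)
  from Cmp_extend[OF this, of "iso_inv V (Lun V (EHom C y z))"]
  show "bil (dcmp x y z) (con e) a = bil (ECmp C x y z) a (con e)"
    using assms a by (simp add: bil_con_left bil_con_right dcmp_def)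
qed

lemma ECmp_assoc_elements:
  assumes "w \<in> EObj C" "x \<in> EObj C" "y \<in> EObj C" "z \<in> EObj C"
    and "f \<in> Arr V" "Cod V f = EHom C y z" "g \<in> Arr V" "Cod V g = EHom C x y" "h \<in> Arr V" "Cod V h = EHom C w x"
  shows "ECmp C w y z \<cdot> (f \<odot> (ECmp C w x y \<cdot> (g \<odot> h))) =
    ECmp C w x z \<cdot> ((ECmp C x y z \<cdot> (f \<odot> g)) \<odot> h) \<cdot> iso_inv V (Asc V (Dom V f) (Dom V g) (Dom V h))"
proof -
  have "(ECmp C w y z \<cdot> (f \<odot> (ECmp C w x y \<cdot> (g \<odot> h)))) \<cdot> Asc V (Dom V f) (Dom V g) (Dom V h) =
    ECmp C w y z \<cdot> (Idn V (EHom C y z) \<odot> ECmp C w x y) \<cdot> ((f \<odot> (g \<odot> h)) \<cdot> Asc V (Dom V f) (Dom V g) (Dom V h))"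
    using assms by simp
  also have "\<dots> = ECmp C w y z \<cdot> (Idn V (EHom C y z) \<odot> ECmp C w x y) \<cdot> Asc V (EHom C y z) (EHom C x y) (EHom C w x) \<cdot> ((f \<odot> g) \<odot> h)"
    using assms by (subst Asc_nat) auto
  also have "\<dots> = (ECmp C w x z \<cdot> (ECmp C x y z \<odot> Idn V (EHom C w x))) \<cdot> ((f \<odot> g) \<odot> h)"
    using assms by (subst ECmp_assoc) auto
  also have "\<dots> = ECmp C w x z \<cdot> ((ECmp C x y z \<cdot> (f \<odot> g)) \<odot> h)"
    using assms by simp
  finally have "(ECmp C w y z \<cdot> (f \<odot> (ECmp C w x y \<cdot> (g \<odot> h)))) \<cdot> Asc V (Dom V f) (Dom V g) (Dom V h) =
    ECmp C w x z \<cdot> ((ECmp C x y z \<cdot> (f \<odot> g)) \<odot> h)" .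
  from iso_move_right[OF this] show ?thesis using assms by simp
qed

lemma dcmp_elements:
  assumes "x \<in> EObj C" "y \<in> EObj C" "z \<in> EObj C"
    and "f \<in> Arr V" "Cod V f = EHom C x y" "g \<in> Arr V" "Cod V g = EHom C y z"
  shows "dcmp x y z \<cdot> (f \<odot> g) = ECmp C x y z \<cdot> (g \<odot> f) \<cdot> swap V (Dom V f) (Dom V g)"
  using assms by (simp add: dcmp_def swap_nat)

text \<open>Along a square on which both compositions agree, they associate with each other.\<close>

lemma mixed_assoc_left:
  assumes xyz [simp]: "x \<in> EObj C" "y \<in> EObj C" "y1 \<in> EObj C" "z \<in> EObj C" "w \<in> EObj C"
    and f [simp]: "f \<in> Arr V" "Dom V f = F" "Cod V f = EHom C y z"
      "f1 \<in> Arr V" "Dom V f1 = F" "Cod V f1 = EHom C y1 w"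
    and g [simp]: "g \<in> Arr V" "Dom V g = G" "Cod V g = EHom C z w"
      "g1 \<in> Arr V" "Dom V g1 = G" "Cod V g1 = EHom C y y1"
    and n [simp]: "n \<in> Arr V" "Dom V n = N" "Cod V n = EHom C x y"
    and E: "ECmp C y y1 w \<cdot> (f1 \<odot> g1) = dcmp y z w \<cdot> (f \<odot> g)"
  shows "dcmp x z w \<cdot> ((ECmp C x y z \<cdot> (f \<odot> n)) \<odot> g) =
    ECmp C x y1 w \<cdot> (f1 \<odot> (dcmp x y y1 \<cdot> (n \<odot> g1))) \<cdot> Asc V F N G"
proof -
  have [simp]: "F \<in> Obj V" "G \<in> Obj V" "N \<in> Obj V"
    using Dom_in_Obj[OF f(1)] Dom_in_Obj[OF g(1)] Dom_in_Obj[OF n(1)] by simp_all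
  let ?u = "dcmp y z w \<cdot> (f \<odot> g)"
  have "ECmp C x y1 w \<cdot> (f1 \<odot> (dcmp x y y1 \<cdot> (n \<odot> g1))) \<cdot> Asc V F N G
     = (ECmp C x y1 w \<cdot> (f1 \<odot> (ECmp C x y y1 \<cdot> (g1 \<odot> n)))) \<cdot> (Idn V F \<odot> swap V N G) \<cdot> Asc V F N G"
    by (subst dcmp_elements) auto
  also have "\<dots> = ECmp C x y w \<cdot> (?u \<odot> n) \<cdot> iso_inv V (Asc V F G N) \<cdot> (Idn V F \<odot> swap V N G) \<cdot> Asc V F N G"
    by (subst ECmp_assoc_elements) (auto simp: E)
  finally have 1: "ECmp C x y1 w \<cdot> (f1 \<odot> (dcmp x y y1 \<cdot> (n \<odot> g1))) \<cdot> Asc V F N G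
     = ECmp C x y w \<cdot> (?u \<odot> n) \<cdot> iso_inv V (Asc V F G N) \<cdot> (Idn V F \<odot> swap V N G) \<cdot> Asc V F N G" .
  have "dcmp x z w \<cdot> ((ECmp C x y z \<cdot> (f \<odot> n)) \<odot> g)
     = (ECmp C x z w \<cdot> (g \<odot> (ECmp C x y z \<cdot> (f \<odot> n)))) \<cdot> swap V (F \<otimes> N) G"
    by (subst dcmp_elements) auto
  also have "\<dots> = ECmp C x y w \<cdot> ((ECmp C y z w \<cdot> (g \<odot> f)) \<odot> n) \<cdot> iso_inv V (Asc V G F N) \<cdot> swap V (F \<otimes> N) G"
    by (subst ECmp_assoc_elements) auto
  \<comment> \<open>The hexagon moves G past N and then past F. The crossing with F turns
    \<open>ECmp\<close> into \<open>dcmp\<close>, where E applies; the crossing with N is the one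
    present on the other side.\<close>
  also have "\<dots> = ECmp C x y w \<cdot> ((ECmp C y z w \<cdot> (g \<odot> f) \<cdot> swap V F G) \<odot> n)
      \<cdot> iso_inv V (Asc V F G N) \<cdot> (Idn V F \<odot> swap V N G) \<cdot> Asc V F N G"
    by (subst swap_hexagon_left) auto
  also have "ECmp C y z w \<cdot> (g \<odot> f) \<cdot> swap V F G = ?u"
    by (subst dcmp_elements) auto
  finally show ?thesis using 1 by simp
qed

text \<open>The other hexagon is used here: F has to pass M and H. The crossing with M is contained
  in \<open>dcmp\<close>, the crossing with H is supplied by E.\<close>

lemma mixed_assoc_right:
  assumes xyz [simp]: "x \<in> EObj C" "y \<in> EObj C" "y1 \<in> EObj C" "z \<in> EObj C" "w \<in> EObj C"
    and f [simp]: "f \<in> Arr V" "Dom V f = F" "Cod V f = EHom C y z"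
      "f1 \<in> Arr V" "Dom V f1 = F" "Cod V f1 = EHom C x y1"
    and h [simp]: "h \<in> Arr V" "Dom V h = H" "Cod V h = EHom C x y"
      "h1 \<in> Arr V" "Dom V h1 = H" "Cod V h1 = EHom C y1 z"
    and m [simp]: "m \<in> Arr V" "Dom V m = M" "Cod V m = EHom C z w"
    and E: "ECmp C x y z \<cdot> (f \<odot> h) = dcmp x y1 z \<cdot> (f1 \<odot> h1)"
  shows "ECmp C x y w \<cdot> ((dcmp y z w \<cdot> (f \<odot> m)) \<odot> h) =
    dcmp x y1 w \<cdot> (f1 \<odot> (ECmp C y1 z w \<cdot> (m \<odot> h1))) \<cdot> Asc V F M H"
proof -
  have [simp]: "F \<in> Obj V" "H \<in> Obj V" "M \<in> Obj V"
    using Dom_in_Obj[OF f(1)] Dom_in_Obj[OF h(1)] Dom_in_Obj[OF m(1)] by simp_all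
  have "ECmp C x y w \<cdot> ((dcmp y z w \<cdot> (f \<odot> m)) \<odot> h)
     = (ECmp C x y w \<cdot> ((ECmp C y z w \<cdot> (m \<odot> f)) \<odot> h) \<cdot> iso_inv V (Asc V M F H))
        \<cdot> Asc V M F H \<cdot> (swap V F M \<odot> Idn V H)"
    by (subst dcmp_elements) auto
  also have "\<dots> = (ECmp C x z w \<cdot> (m \<odot> (ECmp C x y z \<cdot> (f \<odot> h)))) \<cdot> Asc V M F H \<cdot> (swap V F M \<odot> Idn V H)"
    by (subst ECmp_assoc_elements) auto
  also have "\<dots> = (ECmp C x z w \<cdot> (m \<odot> (ECmp C x y1 z \<cdot> (h1 \<odot> f1)))) \<cdot>
       ((Idn V M \<odot> swap V F H) \<cdot> Asc V M F H \<cdot> (swap V F M \<odot> Idn V H))"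
    unfolding E by (subst dcmp_elements) auto
  also have "\<dots> = (ECmp C x z w \<cdot> (m \<odot> (ECmp C x y1 z \<cdot> (h1 \<odot> f1)))) \<cdot>
       Asc V M H F \<cdot> swap V F (M \<otimes> H) \<cdot> Asc V F M H"
    by (subst swap_hexagon_right) auto
  also have "\<dots> = (ECmp C x y1 w \<cdot> ((ECmp C y1 z w \<cdot> (m \<odot> h1)) \<odot> f1)) \<cdot> swap V F (M \<otimes> H) \<cdot> Asc V F M H"
    by (subst ECmp_assoc_elements) auto
  also have "\<dots> = (ECmp C x y1 w \<cdot> ((ECmp C y1 z w \<cdot> (m \<odot> h1)) \<odot> f1) \<cdot> swap V F (M \<otimes> H)) \<cdot> Asc V F M H"
    by simp
  also have "ECmp C x y1 w \<cdot> ((ECmp C y1 z w \<cdot> (m \<odot> h1)) \<odot> f1) \<cdot> swap V F (M \<otimes> H)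
      = dcmp x y1 w \<cdot> (f1 \<odot> (ECmp C y1 z w \<cdot> (m \<odot> h1)))"
    by (subst dcmp_elements) auto
  finally show ?thesis by simp
qed

text \<open>Equal first components express that f, f1 and likewise g, g1 are two images of the same
  stages, such as two whiskerings of one cell. The isomorphism \<open>split\<close> can then be
  cancelled from E.\<close>

lemma bil_mixed_left:
  assumes "x \<in> EObj C" "y \<in> EObj C" "y1 \<in> EObj C" "z \<in> EObj C" "w \<in> EObj C"
    and f: "elem f" "obj f = EHom C y z" "elem f1" "obj f1 = EHom C y1 w" "fst f1 = fst f"
    and g: "elem g" "obj g = EHom C z w" "elem g1" "obj g1 = EHom C y y1" "fst g1 = fst g"
    and n: "elem n" "obj n = EHom C x y"
    and E: "bil (ECmp C y y1 w) f1 g1 = bil (dcmp y z w) f g"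
  shows "bil (dcmp x z w) (bil (ECmp C x y z) f n) g = bil (ECmp C x y1 w) f1 (bil (dcmp x y y1) n g1)"
proof -
  have "(ECmp C y y1 w \<cdot> (snd f1 \<odot> snd g1)) \<cdot> split (fst f) (fst g) = (dcmp y z w \<cdot> (snd f \<odot> snd g)) \<cdot> split (fst f) (fst g)"
    using E assms(1-15) by (simp add: bil_def elem_def obj_def)
  then have E': "ECmp C y y1 w \<cdot> (snd f1 \<odot> snd g1) = dcmp y z w \<cdot> (snd f \<odot> snd g)"
    by (subst (asm) iso_cancel_right) (use assms(1-17) in \<open>auto simp: elem_def obj_def\<close>)
  let ?S = "(split (fst f) (fst n) \<odot> Idn V (ten (fst g))) \<cdot> split (fst f @ fst n) (fst g)"
  have "snd (bil (dcmp x z w) (bil (ECmp C x y z) f n) g)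
     = (dcmp x z w \<cdot> ((ECmp C x y z \<cdot> (snd f \<odot> snd n)) \<odot> snd g)) \<cdot> ?S"
    using assms(1-17) by (simp add: bil_def elem_def obj_def)
  also have "dcmp x z w \<cdot> ((ECmp C x y z \<cdot> (snd f \<odot> snd n)) \<odot> snd g)
     = ECmp C x y1 w \<cdot> (snd f1 \<odot> (dcmp x y y1 \<cdot> (snd n \<odot> snd g1))) \<cdot> Asc V (ten (fst f)) (ten (fst n)) (ten (fst g))"
    by (rule mixed_assoc_left[OF assms(1-5) _ _ _ _ _ _ _ _ _ _ _ _ _ _ _ E'])
      (use assms(1-17) in \<open>auto simp: elem_def obj_def\<close>)
  also have "(ECmp C x y1 w \<cdot> (snd f1 \<odot> (dcmp x y y1 \<cdot> (snd n \<odot> snd g1))) \<cdot> Asc V (ten (fst f)) (ten (fst n)) (ten (fst g))) \<cdot> ?S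
     = ECmp C x y1 w \<cdot> (snd f1 \<odot> (dcmp x y y1 \<cdot> (snd n \<odot> snd g1))) \<cdot> (Asc V (ten (fst f)) (ten (fst n)) (ten (fst g)) \<cdot> ?S)"
    using assms(1-17) by (simp add: elem_def obj_def)
  also have "\<dots> = snd (bil (ECmp C x y1 w) f1 (bil (dcmp x y y1) n g1))"
    using assms(1-17) by (subst split_split) (auto simp: elem_def obj_def bil_def)
  finally show ?thesis using f g by (intro prod_eqI) (auto simp: bil_def)
qed

lemma bil_mixed_right:
  assumes "x \<in> EObj C" "y \<in> EObj C" "y1 \<in> EObj C" "z \<in> EObj C" "w \<in> EObj C"
    and f: "elem f" "obj f = EHom C y z" "elem f1" "obj f1 = EHom C x y1" "fst f1 = fst f"
    and h: "elem h" "obj h = EHom C x y" "elem h1" "obj h1 = EHom C y1 z" "fst h1 = fst h"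
    and m: "elem m" "obj m = EHom C z w"
    and E: "bil (ECmp C x y z) f h = bil (dcmp x y1 z) f1 h1"
  shows "bil (ECmp C x y w) (bil (dcmp y z w) f m) h = bil (dcmp x y1 w) f1 (bil (ECmp C y1 z w) m h1)"
proof -
  have "(ECmp C x y z \<cdot> (snd f \<odot> snd h)) \<cdot> split (fst f) (fst h) = (dcmp x y1 z \<cdot> (snd f1 \<odot> snd h1)) \<cdot> split (fst f) (fst h)"
    using E assms(1-15) by (simp add: bil_def elem_def obj_def)
  then have E': "ECmp C x y z \<cdot> (snd f \<odot> snd h) = dcmp x y1 z \<cdot> (snd f1 \<odot> snd h1)"
    by (subst (asm) iso_cancel_right) (use assms(1-17) in \<open>auto simp: elem_def obj_def\<close>)
  let ?S = "(split (fst f) (fst m) \<odot> Idn V (ten (fst h))) \<cdot> split (fst f @ fst m) (fst h)"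
  have "snd (bil (ECmp C x y w) (bil (dcmp y z w) f m) h)
     = (ECmp C x y w \<cdot> ((dcmp y z w \<cdot> (snd f \<odot> snd m)) \<odot> snd h)) \<cdot> ?S"
    using assms(1-17) by (simp add: bil_def elem_def obj_def)
  also have "ECmp C x y w \<cdot> ((dcmp y z w \<cdot> (snd f \<odot> snd m)) \<odot> snd h)
     = dcmp x y1 w \<cdot> (snd f1 \<odot> (ECmp C y1 z w \<cdot> (snd m \<odot> snd h1))) \<cdot> Asc V (ten (fst f)) (ten (fst m)) (ten (fst h))"
    by (rule mixed_assoc_right[OF assms(1-5) _ _ _ _ _ _ _ _ _ _ _ _ _ _ _ E'])
      (use assms(1-17) in \<open>auto simp: elem_def obj_def\<close>)
  also have "(dcmp x y1 w \<cdot> (snd f1 \<odot> (ECmp C y1 z w \<cdot> (snd m \<odot> snd h1))) \<cdot> Asc V (ten (fst f)) (ten (fst m)) (ten (fst h))) \<cdot> ?S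
     = dcmp x y1 w \<cdot> (snd f1 \<odot> (ECmp C y1 z w \<cdot> (snd m \<odot> snd h1))) \<cdot> (Asc V (ten (fst f)) (ten (fst m)) (ten (fst h)) \<cdot> ?S)"
    using assms(1-17) by (simp add: elem_def obj_def)
  also have "\<dots> = snd (bil (dcmp x y1 w) f1 (bil (ECmp C y1 z w) m h1))"
    using assms(1-17) by (subst split_split) (auto simp: elem_def obj_def bil_def)
  finally show ?thesis using f h by (intro prod_eqI) (auto simp: bil_def)
qed

end

section \<open>Two-cells of an enriched bicategory\<close>

lemma HomCat_simps [simp]:
  "EObj (HomCat \<B> a b) = hom1 \<B> a b" "EHom (HomCat \<B> a b) = Hom2 \<B>"
  "EId (HomCat \<B> a b) = VId \<B>" "ECmp (HomCat \<B> a b) = VCmp \<B>"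
  by (simp_all add: HomCat_def)

context enriched_bicategory
begin

section \<open>Typing of 1-cells and of the structure maps between hom-objects\<close>

abbreviation hcomp1 (infixl "\<Zspot>" 65) where
  "f \<Zspot> g \<equiv> f \<bullet>\<^bsub>\<B>\<^esub> g"

lemma hom1_iff: "f \<in> hom1 \<B> a b \<longleftrightarrow> f \<in> Cell1 \<B> \<and> Src \<B> f = a \<and> Trg \<B> f = b"
  by (auto simp: hom1_def)

lemma Src_Trg_Cell0 [simp]: "f \<in> Cell1 \<B> \<Longrightarrow> Src \<B> f \<in> Cell0 \<B>" "f \<in> Cell1 \<B> \<Longrightarrow> Trg \<B> f \<in> Cell0 \<B>"
  by (auto intro: Src_in_Cell0 Trg_in_Cell0)

lemma Unit1_simps [simp]:
  assumes "a \<in> Cell0 \<B>"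
  shows "Unit1 \<B> a \<in> Cell1 \<B>" "Src \<B> (Unit1 \<B> a) = a" "Trg \<B> (Unit1 \<B> a) = a"
  using Unit1_in_hom1[OF assms] by (auto simp: hom1_iff)

text \<open>Closure of 1-cells under composition is contained in the functoriality of
  \<open>HCmp\<close>, whose object map is composition of 1-cells.\<close>

lemma HComp1_simps [simp]:
  assumes "f \<in> Cell1 \<B>" "g \<in> Cell1 \<B>" "Trg \<B> f = Src \<B> g"
  shows "f \<Zspot> g \<in> Cell1 \<B>" "Src \<B> (f \<Zspot> g) = Src \<B> f" "Trg \<B> (f \<Zspot> g) = Trg \<B> g"
  using HCmp_functor[of "Src \<B> f" "Trg \<B> f" "Trg \<B> g"] assms
  by (auto simp: enriched_functor_def etensor_def hom1_iff)

lemma HomCat_braided: "a \<in> Cell0 \<B> \<Longrightarrow> b \<in> Cell0 \<B> \<Longrightarrow> braided_enriched_category V (HomCat \<B> a b)"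
  using HomCat_enriched[of a b] braided_category_axioms by (simp add: braided_enriched_category_def)

lemma Hom2_simps [simp]:
  assumes "f \<in> Cell1 \<B>" "g \<in> Cell1 \<B>" "Src \<B> f = Src \<B> g" "Trg \<B> f = Trg \<B> g"
  shows "Hom2 \<B> f g \<in> Obj V"
  using braided_enriched_category.EHom_Obj[OF HomCat_braided[of "Src \<B> f" "Trg \<B> f"], of f g] assms
  by (simp add: hom1_iff)

lemma VId_simps [simp]:
  assumes "f \<in> Cell1 \<B>"
  shows "VId \<B> f \<in> Arr V" "Dom V (VId \<B> f) = Unt V" "Cod V (VId \<B> f) = Hom2 \<B> f f"
  using braided_enriched_category.EId_simps[OF HomCat_braided[of "Src \<B> f" "Trg \<B> f"], of f] assms
  by (simp_all add: hom1_iff)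

lemma VCmp_simps [simp]:
  assumes "f \<in> Cell1 \<B>" "g \<in> Cell1 \<B>" "Src \<B> f = Src \<B> g" "Trg \<B> f = Trg \<B> g"
    "h \<in> Cell1 \<B>" "Src \<B> g = Src \<B> h" "Trg \<B> g = Trg \<B> h"
  shows "VCmp \<B> f g h \<in> Arr V" "Dom V (VCmp \<B> f g h) = Hom2 \<B> g h \<otimes> Hom2 \<B> f g"
    "Cod V (VCmp \<B> f g h) = Hom2 \<B> f h"
  using braided_enriched_category.ECmp_simps[OF HomCat_braided[of "Src \<B> f" "Trg \<B> f"], of f g h] assms
  by (simp_all add: hom1_iff)

lemma HCmp_simps [simp]:
  assumes "f \<in> Cell1 \<B>" "f' \<in> Cell1 \<B>" "Src \<B> f = Src \<B> f'" "Trg \<B> f = Trg \<B> f'"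
    "g \<in> Cell1 \<B>" "g' \<in> Cell1 \<B>" "Src \<B> g = Src \<B> g'" "Trg \<B> g = Trg \<B> g'" "Trg \<B> f' = Src \<B> g'"
  shows "HCmp \<B> f f' g g' \<in> Arr V" "Dom V (HCmp \<B> f f' g g') = Hom2 \<B> f f' \<otimes> Hom2 \<B> g g'"
    "Cod V (HCmp \<B> f f' g g') = Hom2 \<B> (f \<Zspot> g) (f' \<Zspot> g')"
  using HCmp_functor[of "Src \<B> f" "Trg \<B> f" "Trg \<B> g"] assms
  by (simp_all add: enriched_functor_def etensor_def hom1_iff in_hom_iff)

section \<open>Functoriality of horizontal composition, specialised to whiskering\<close>

lemma HCmp_VId:
  assumes "f \<in> Cell1 \<B>" "g \<in> Cell1 \<B>" "Trg \<B> f = Src \<B> g"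
  shows "HCmp \<B> f f g g \<cdot> (VId \<B> f \<odot> VId \<B> g) \<cdot> iso_inv V (Lun V (Unt V)) = VId \<B> (f \<Zspot> g)"
  using HCmp_functor[of "Src \<B> f" "Trg \<B> f" "Trg \<B> g"] assms
  by (simp add: enriched_functor_def etensor_def hom1_iff)

lemma HCmp_VCmp:
  assumes "f \<in> hom1 \<B> a b" "f' \<in> hom1 \<B> a b" "f'' \<in> hom1 \<B> a b" "g \<in> hom1 \<B> b c" "g' \<in> hom1 \<B> b c" "g'' \<in> hom1 \<B> b c"
  shows "VCmp \<B> (f \<Zspot> g) (f' \<Zspot> g') (f'' \<Zspot> g'') \<cdot> (HCmp \<B> f' f'' g' g'' \<odot> HCmp \<B> f f' g g') =
    HCmp \<B> f f'' g g'' \<cdot> (VCmp \<B> f f' f'' \<odot> VCmp \<B> g g' g'')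
      \<cdot> exchange V (Hom2 \<B> f' f'') (Hom2 \<B> g' g'') (Hom2 \<B> f f') (Hom2 \<B> g g')"
proof -
  have "a \<in> Cell0 \<B>" "b \<in> Cell0 \<B>" "c \<in> Cell0 \<B>" using assms by (auto simp: hom1_iff)
  from HCmp_functor[OF this] show ?thesis
    using assms by (simp add: enriched_functor_def etensor_def)
qed

lemma rwhisker_simps [simp]:
  assumes "f \<in> Cell1 \<B>" "f' \<in> Cell1 \<B>" "Src \<B> f = Src \<B> f'" "Trg \<B> f = Trg \<B> f'" "g \<in> Cell1 \<B>" "Trg \<B> f' = Src \<B> g"
  shows "rwhisker V \<B> f f' g \<in> Arr V" "Dom V (rwhisker V \<B> f f' g) = Hom2 \<B> f f'"
    "Cod V (rwhisker V \<B> f f' g) = Hom2 \<B> (f \<Zspot> g) (f' \<Zspot> g)"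
  using assms by (simp_all add: rwhisker_def)

lemma lwhisker_simps [simp]:
  assumes "f \<in> Cell1 \<B>" "f' \<in> Cell1 \<B>" "Src \<B> f = Src \<B> f'" "Trg \<B> f = Trg \<B> f'" "g \<in> Cell1 \<B>" "Trg \<B> g = Src \<B> f'"
  shows "lwhisker V \<B> g f f' \<in> Arr V" "Dom V (lwhisker V \<B> g f f') = Hom2 \<B> f f'"
    "Cod V (lwhisker V \<B> g f f') = Hom2 \<B> (g \<Zspot> f) (g \<Zspot> f')"
  using assms by (simp_all add: lwhisker_def)

lemma VCmp_VId:
  assumes "f \<in> Cell1 \<B>" "g \<in> Cell1 \<B>" "Src \<B> f = Src \<B> g" "Trg \<B> f = Trg \<B> g"
  shows "VCmp \<B> f g g \<cdot> (VId \<B> g \<odot> Idn V (Hom2 \<B> f g)) = Lun V (Hom2 \<B> f g)"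
    "VCmp \<B> f f g \<cdot> (Idn V (Hom2 \<B> f g) \<odot> VId \<B> f) = Run V (Hom2 \<B> f g)"
  using enriched_category.ECmp_EId_left[OF HomCat_enriched[of "Src \<B> f" "Trg \<B> f"], of f g]
    enriched_category.ECmp_EId_right[OF HomCat_enriched[of "Src \<B> f" "Trg \<B> f"], of f g] assms
  by (simp_all add: hom1_iff)

text \<open>Functoriality of \<open>HCmp\<close> when the second component of the outer 2-cell is an
  identity. One of the two factors braided by the exchange is then the unit, so only constraints
  remain.\<close>

lemma VCmp_rwhisker_HCmp:
  assumes fg: "f \<in> hom1 \<B> a b" "f' \<in> hom1 \<B> a b" "f'' \<in> hom1 \<B> a b" "g \<in> hom1 \<B> b c" "g' \<in> hom1 \<B> b c"
  shows "HCmp \<B> f f'' g g' \<cdot> (VCmp \<B> f f' f'' \<odot> Idn V (Hom2 \<B> g g')) =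
    VCmp \<B> (f \<Zspot> g) (f' \<Zspot> g') (f'' \<Zspot> g') \<cdot> (rwhisker V \<B> f' f'' g' \<odot> HCmp \<B> f f' g g')
      \<cdot> Asc V (Hom2 \<B> f' f'') (Hom2 \<B> f f') (Hom2 \<B> g g')"
proof -
  note S [simp] = fg[unfolded hom1_iff]
  let ?F' = "Hom2 \<B> f' f''" and ?F = "Hom2 \<B> f f'" and ?G = "Hom2 \<B> g g'" and ?I = "Unt V"
  let ?V = "VCmp \<B> (f \<Zspot> g) (f' \<Zspot> g') (f'' \<Zspot> g')"
  have "?V \<cdot> (rwhisker V \<B> f' f'' g' \<odot> HCmp \<B> f f' g g')
     = (?V \<cdot> (HCmp \<B> f' f'' g' g' \<odot> HCmp \<B> f f' g g')) \<cdot> ((Idn V ?F' \<odot> VId \<B> g') \<odot> (Idn V ?F \<odot> Idn V ?G))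
        \<cdot> (iso_inv V (Run V ?F') \<odot> Idn V (?F \<otimes> ?G))"
    by (simp add: rwhisker_def del: TenA_Idn_Idn) simp
  also have "\<dots> = HCmp \<B> f f'' g g' \<cdot> (VCmp \<B> f f' f'' \<odot> VCmp \<B> g g' g')
      \<cdot> (exchange V ?F' (Hom2 \<B> g' g') ?F ?G \<cdot> ((Idn V ?F' \<odot> VId \<B> g') \<odot> (Idn V ?F \<odot> Idn V ?G)))
        \<cdot> (iso_inv V (Run V ?F') \<odot> Idn V (?F \<otimes> ?G))"
    by (subst HCmp_VCmp[OF fg(1,2,3,4,5,5)]) simp
  also have "exchange V ?F' (Hom2 \<B> g' g') ?F ?G \<cdot> ((Idn V ?F' \<odot> VId \<B> g') \<odot> (Idn V ?F \<odot> Idn V ?G))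
     = ((Idn V ?F' \<odot> Idn V ?F) \<odot> (VId \<B> g' \<odot> Idn V ?G)) \<cdot> exchange V ?F' ?I ?F ?G"
    by (rule exchange_nat) auto
  also have "HCmp \<B> f f'' g g' \<cdot> (VCmp \<B> f f' f'' \<odot> VCmp \<B> g g' g')
      \<cdot> (((Idn V ?F' \<odot> Idn V ?F) \<odot> (VId \<B> g' \<odot> Idn V ?G)) \<cdot> exchange V ?F' ?I ?F ?G)
        \<cdot> (iso_inv V (Run V ?F') \<odot> Idn V (?F \<otimes> ?G))
     = HCmp \<B> f f'' g g' \<cdot> (VCmp \<B> f f' f'' \<odot> (VCmp \<B> g g' g' \<cdot> (VId \<B> g' \<odot> Idn V ?G)))
      \<cdot> exchange V ?F' ?I ?F ?G \<cdot> (iso_inv V (Run V ?F') \<odot> Idn V (?F \<otimes> ?G))"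
    by simp
  also have "\<dots> = HCmp \<B> f f'' g g' \<cdot> (VCmp \<B> f f' f'' \<odot> Idn V ?G) \<cdot> iso_inv V (Asc V ?F' ?F ?G)"
    by (simp add: VCmp_VId exchange_Unt_2)
  finally have "?V \<cdot> (rwhisker V \<B> f' f'' g' \<odot> HCmp \<B> f f' g g') =
    HCmp \<B> f f'' g g' \<cdot> (VCmp \<B> f f' f'' \<odot> Idn V ?G) \<cdot> iso_inv V (Asc V ?F' ?F ?G)" .
  from Cmp_extend[OF this, of "Asc V ?F' ?F ?G"] show ?thesis by simp
qed

text \<open>Dually, the first component of the inner 2-cell is an identity, and again a braided
  factor is the unit.\<close>

lemma VCmp_HCmp_lwhisker:
  assumes fg: "f \<in> hom1 \<B> a b" "f' \<in> hom1 \<B> a b" "g \<in> hom1 \<B> b c" "g' \<in> hom1 \<B> b c" "g'' \<in> hom1 \<B> b c"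
  shows "VCmp \<B> (f \<Zspot> g) (f \<Zspot> g') (f' \<Zspot> g'') \<cdot> (HCmp \<B> f f' g' g'' \<odot> lwhisker V \<B> f g g') =
    HCmp \<B> f f' g g'' \<cdot> (Idn V (Hom2 \<B> f f') \<odot> VCmp \<B> g g' g'')
      \<cdot> Asc V (Hom2 \<B> f f') (Hom2 \<B> g' g'') (Hom2 \<B> g g')"
proof -
  note S [simp] = fg[unfolded hom1_iff]
  let ?G' = "Hom2 \<B> g' g''" and ?F = "Hom2 \<B> f f'" and ?G = "Hom2 \<B> g g'" and ?I = "Unt V"
  let ?V = "VCmp \<B> (f \<Zspot> g) (f \<Zspot> g') (f' \<Zspot> g'')"
  have "?V \<cdot> (HCmp \<B> f f' g' g'' \<odot> lwhisker V \<B> f g g')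
     = (?V \<cdot> (HCmp \<B> f f' g' g'' \<odot> HCmp \<B> f f g g')) \<cdot> ((Idn V ?F \<odot> Idn V ?G') \<odot> (VId \<B> f \<odot> Idn V ?G))
        \<cdot> (Idn V (?F \<otimes> ?G') \<odot> iso_inv V (Lun V ?G))"
    by (simp add: lwhisker_def del: TenA_Idn_Idn) simp
  also have "\<dots> = HCmp \<B> f f' g g'' \<cdot> (VCmp \<B> f f f' \<odot> VCmp \<B> g g' g'')
      \<cdot> (exchange V ?F ?G' (Hom2 \<B> f f) ?G \<cdot> ((Idn V ?F \<odot> Idn V ?G') \<odot> (VId \<B> f \<odot> Idn V ?G)))
        \<cdot> (Idn V (?F \<otimes> ?G') \<odot> iso_inv V (Lun V ?G))"
    by (subst HCmp_VCmp[OF fg(1,1,2,3,4,5)]) simp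
  also have "exchange V ?F ?G' (Hom2 \<B> f f) ?G \<cdot> ((Idn V ?F \<odot> Idn V ?G') \<odot> (VId \<B> f \<odot> Idn V ?G))
     = ((Idn V ?F \<odot> VId \<B> f) \<odot> (Idn V ?G' \<odot> Idn V ?G)) \<cdot> exchange V ?F ?G' ?I ?G"
    by (rule exchange_nat) auto
  also have "HCmp \<B> f f' g g'' \<cdot> (VCmp \<B> f f f' \<odot> VCmp \<B> g g' g'')
      \<cdot> (((Idn V ?F \<odot> VId \<B> f) \<odot> (Idn V ?G' \<odot> Idn V ?G)) \<cdot> exchange V ?F ?G' ?I ?G)
        \<cdot> (Idn V (?F \<otimes> ?G') \<odot> iso_inv V (Lun V ?G))
     = HCmp \<B> f f' g g'' \<cdot> ((VCmp \<B> f f f' \<cdot> (Idn V ?F \<odot> VId \<B> f)) \<odot> VCmp \<B> g g' g'')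
      \<cdot> exchange V ?F ?G' ?I ?G \<cdot> (Idn V (?F \<otimes> ?G') \<odot> iso_inv V (Lun V ?G))"
    by simp
  also have "\<dots> = HCmp \<B> f f' g g'' \<cdot> (Idn V ?F \<odot> VCmp \<B> g g' g'') \<cdot> Asc V ?F ?G' ?G"
    by (simp add: VCmp_VId exchange_Unt_3)
  finally show ?thesis .
qed

text \<open>In this order of whiskering the identities occupy the outer places of the exchange, and
  the braiding of the two hom-objects remains. Its inverse is what \<open>swap\<close> supplies in
  \<open>rw_dc_lw\<close>.\<close>

lemma VCmp_lwhisker_rwhisker:
  assumes fg: "f \<in> hom1 \<B> a b" "f' \<in> hom1 \<B> a b" "g \<in> hom1 \<B> b c" "g' \<in> hom1 \<B> b c"
  shows "VCmp \<B> (f \<Zspot> g) (f' \<Zspot> g) (f' \<Zspot> g') \<cdot> (lwhisker V \<B> f' g g' \<odot> rwhisker V \<B> f f' g) =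
    HCmp \<B> f f' g g' \<cdot> Brd V (Hom2 \<B> g g') (Hom2 \<B> f f')"
proof -
  note S [simp] = fg[unfolded hom1_iff]
  let ?F = "Hom2 \<B> f f'" and ?G = "Hom2 \<B> g g'" and ?I = "Unt V"
  let ?V = "VCmp \<B> (f \<Zspot> g) (f' \<Zspot> g) (f' \<Zspot> g')"
  have "?V \<cdot> (lwhisker V \<B> f' g g' \<odot> rwhisker V \<B> f f' g)
     = (?V \<cdot> (HCmp \<B> f' f' g g' \<odot> HCmp \<B> f f' g g)) \<cdot> ((VId \<B> f' \<odot> Idn V ?G) \<odot> (Idn V ?F \<odot> VId \<B> g))
        \<cdot> (iso_inv V (Lun V ?G) \<odot> iso_inv V (Run V ?F))"
    by (simp add: lwhisker_def rwhisker_def)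
  also have "\<dots> = HCmp \<B> f f' g g' \<cdot> (VCmp \<B> f f' f' \<odot> VCmp \<B> g g g')
      \<cdot> (exchange V (Hom2 \<B> f' f') ?G ?F (Hom2 \<B> g g) \<cdot> ((VId \<B> f' \<odot> Idn V ?G) \<odot> (Idn V ?F \<odot> VId \<B> g)))
        \<cdot> (iso_inv V (Lun V ?G) \<odot> iso_inv V (Run V ?F))"
    by (subst HCmp_VCmp[OF fg(1,2,2,3,3,4)]) simp
  also have "exchange V (Hom2 \<B> f' f') ?G ?F (Hom2 \<B> g g) \<cdot> ((VId \<B> f' \<odot> Idn V ?G) \<odot> (Idn V ?F \<odot> VId \<B> g))
     = ((VId \<B> f' \<odot> Idn V ?F) \<odot> (Idn V ?G \<odot> VId \<B> g)) \<cdot> exchange V ?I ?G ?F ?I"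
    by (rule exchange_nat) auto
  also have "HCmp \<B> f f' g g' \<cdot> (VCmp \<B> f f' f' \<odot> VCmp \<B> g g g')
      \<cdot> (((VId \<B> f' \<odot> Idn V ?F) \<odot> (Idn V ?G \<odot> VId \<B> g)) \<cdot> exchange V ?I ?G ?F ?I)
        \<cdot> (iso_inv V (Lun V ?G) \<odot> iso_inv V (Run V ?F))
     = HCmp \<B> f f' g g' \<cdot> (Lun V ?F \<odot> Run V ?G)
      \<cdot> exchange V ?I ?G ?F ?I \<cdot> (iso_inv V (Lun V ?G) \<odot> iso_inv V (Run V ?F))"
    by (simp add: VCmp_VId)
  also have "\<dots> = HCmp \<B> f f' g g' \<cdot> Brd V ?G ?F"
    by (simp add: exchange_Unt_Unt)
  finally show ?thesis .
qed

lemma bil_HCmp_con: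
  "\<lbrakk>f \<in> Cell1 \<B>; f' \<in> Cell1 \<B>; Src \<B> f = Src \<B> f'; Trg \<B> f = Trg \<B> f'; g \<in> Cell1 \<B>; Trg \<B> f' = Src \<B> g;
    elem a; obj a = Hom2 \<B> f f'\<rbrakk> \<Longrightarrow> bil (HCmp \<B> f f' g g) a (con (VId \<B> g)) = app (rwhisker V \<B> f f' g) a"
  "\<lbrakk>f \<in> Cell1 \<B>; f' \<in> Cell1 \<B>; Src \<B> f = Src \<B> f'; Trg \<B> f = Trg \<B> f'; g \<in> Cell1 \<B>; Trg \<B> g = Src \<B> f';
    elem a; obj a = Hom2 \<B> f f'\<rbrakk> \<Longrightarrow> bil (HCmp \<B> g g f f') (con (VId \<B> g)) a = app (lwhisker V \<B> g f f') a"
  by (simp_all add: bil_con_left bil_con_right rwhisker_def lwhisker_def)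

text \<open>A 2-cell is a triple of its source, its target and a generalised element of the object of 2-cells
  between them, which need not determine the 1-cells.\<close>

definition dom2 :: "'b \<times> 'b \<times> ('o list \<times> 'm) \<Rightarrow> 'b" where "dom2 c = fst c"
definition cod2 :: "'b \<times> 'b \<times> ('o list \<times> 'm) \<Rightarrow> 'b" where "cod2 c = fst (snd c)"
definition val :: "'b \<times> 'b \<times> ('o list \<times> 'm) \<Rightarrow> 'o list \<times> 'm" where "val c = snd (snd c)"
definition stage :: "'b \<times> 'b \<times> ('o list \<times> 'm) \<Rightarrow> 'o list" where "stage c = fst (val c)"

lemma cell_sel [simp]: "dom2 (x, y, a) = x" "cod2 (x, y, a) = y" "val (x, y, a) = a" "stage (x, y, a) = fst a"
  by (simp_all add: dom2_def cod2_def val_def stage_def)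

lemma cell_eqI: "\<lbrakk>dom2 c = dom2 d; cod2 c = cod2 d; val c = val d\<rbrakk> \<Longrightarrow> c = d"
  by (simp add: dom2_def cod2_def val_def prod_eq_iff)

definition cell :: "'b \<times> 'b \<times> ('o list \<times> 'm) \<Rightarrow> bool" where
  "cell c \<longleftrightarrow> dom2 c \<in> Cell1 \<B> \<and> cod2 c \<in> Cell1 \<B> \<and> Src \<B> (cod2 c) = Src \<B> (dom2 c) \<and>
     Trg \<B> (cod2 c) = Trg \<B> (dom2 c) \<and> elem (val c) \<and> obj (val c) = Hom2 \<B> (dom2 c) (cod2 c)"

definition vc (infixr "\<circ>\<^sub>v" 55) where
  "c \<circ>\<^sub>v d = (dom2 d, cod2 c, bil (VCmp \<B> (dom2 d) (cod2 d) (cod2 c)) (val c) (val d))"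

text \<open>The coefficient is \<open>dcmp\<close> of the hom-category written out, as
  \<open>dcmp_HomCat\<close> records.\<close>

definition dc (infixr ";\<^sub>v" 55) where
  "c ;\<^sub>v d = (dom2 c, cod2 d, bil (VCmp \<B> (dom2 c) (cod2 c) (cod2 d)
     \<cdot> swap V (Hom2 \<B> (dom2 c) (cod2 c)) (Hom2 \<B> (cod2 c) (cod2 d))) (val c) (val d))"

definition hc (infixr "\<circ>\<^sub>h" 60) where
  "c \<circ>\<^sub>h d = (dom2 c \<Zspot> dom2 d, cod2 c \<Zspot> cod2 d,
     bil (HCmp \<B> (dom2 c) (cod2 c) (dom2 d) (cod2 d)) (val c) (val d))"

definition cst where "cst x y e = (x, y, con e)"

definition ident where "ident f = cst f f (VId \<B> f)"

definition rw (infixl "\<triangleright>" 70) where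
  "c \<triangleright> g = (dom2 c \<Zspot> g, cod2 c \<Zspot> g, app (rwhisker V \<B> (dom2 c) (cod2 c) g) (val c))"

definition lw (infixr "\<triangleleft>" 70) where
  "g \<triangleleft> c = (g \<Zspot> dom2 c, g \<Zspot> cod2 c, app (lwhisker V \<B> g (dom2 c) (cod2 c)) (val c))"

section \<open>Calculus of 2-cells with stages\<close>

lemma cellI:
  "\<lbrakk>dom2 c \<in> Cell1 \<B>; cod2 c \<in> Cell1 \<B>; Src \<B> (cod2 c) = Src \<B> (dom2 c);
    Trg \<B> (cod2 c) = Trg \<B> (dom2 c); elem (val c); obj (val c) = Hom2 \<B> (dom2 c) (cod2 c)\<rbrakk> \<Longrightarrow> cell c"
  by (simp add: cell_def)

lemma cellD [simp]:
  assumes "cell c"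
  shows "dom2 c \<in> Cell1 \<B>" "cod2 c \<in> Cell1 \<B>" "Src \<B> (cod2 c) = Src \<B> (dom2 c)"
    "Trg \<B> (cod2 c) = Trg \<B> (dom2 c)" "elem (val c)" "obj (val c) = Hom2 \<B> (dom2 c) (cod2 c)"
  using assms by (simp_all add: cell_def)

lemma vc_simps [simp]:
  "dom2 (c \<circ>\<^sub>v d) = dom2 d" "cod2 (c \<circ>\<^sub>v d) = cod2 c" "stage (c \<circ>\<^sub>v d) = stage c @ stage d"
  "\<lbrakk>cell c; cell d; dom2 c = cod2 d\<rbrakk> \<Longrightarrow> cell (c \<circ>\<^sub>v d)"
  by (auto simp: vc_def intro!: cellI) (simp_all add: stage_def bil_def)

lemma dc_simps [simp]:
  "dom2 (c ;\<^sub>v d) = dom2 c" "cod2 (c ;\<^sub>v d) = cod2 d" "stage (c ;\<^sub>v d) = stage c @ stage d"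
  "\<lbrakk>cell c; cell d; dom2 d = cod2 c\<rbrakk> \<Longrightarrow> cell (c ;\<^sub>v d)"
  by (auto simp: dc_def intro!: cellI) (simp_all add: stage_def bil_def)

lemma hc_simps [simp]:
  "dom2 (c \<circ>\<^sub>h d) = dom2 c \<Zspot> dom2 d" "cod2 (c \<circ>\<^sub>h d) = cod2 c \<Zspot> cod2 d" "stage (c \<circ>\<^sub>h d) = stage c @ stage d"
  "\<lbrakk>cell c; cell d; Trg \<B> (dom2 c) = Src \<B> (dom2 d)\<rbrakk> \<Longrightarrow> cell (c \<circ>\<^sub>h d)"
  by (auto simp: hc_def intro!: cellI) (simp_all add: stage_def bil_def)

lemma cst_simps [simp]:
  "dom2 (cst x y e) = x" "cod2 (cst x y e) = y" "val (cst x y e) = con e" "stage (cst x y e) = []"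
  by (simp_all add: cst_def stage_def con_def)

lemma cell_cst:
  "\<lbrakk>x \<in> Cell1 \<B>; y \<in> Cell1 \<B>; Src \<B> y = Src \<B> x; Trg \<B> y = Trg \<B> x; e \<in> hom V (Unt V) (Hom2 \<B> x y)\<rbrakk>
    \<Longrightarrow> cell (cst x y e)"
  by (auto simp: in_hom_iff intro!: cellI)

lemma ident_simps [simp]:
  "dom2 (ident f) = f" "cod2 (ident f) = f" "stage (ident f) = []" "val (ident f) = con (VId \<B> f)"
  "f \<in> Cell1 \<B> \<Longrightarrow> cell (ident f)"
  by (simp_all add: ident_def cell_cst in_hom_iff)

lemma rw_simps [simp]:
  "dom2 (c \<triangleright> g) = dom2 c \<Zspot> g" "cod2 (c \<triangleright> g) = cod2 c \<Zspot> g" "stage (c \<triangleright> g) = stage c"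
  "\<lbrakk>cell c; g \<in> Cell1 \<B>; Trg \<B> (dom2 c) = Src \<B> g\<rbrakk> \<Longrightarrow> cell (c \<triangleright> g)"
  by (auto simp: rw_def intro!: cellI) (simp_all add: stage_def app_def)

lemma lw_simps [simp]:
  "dom2 (g \<triangleleft> c) = g \<Zspot> dom2 c" "cod2 (g \<triangleleft> c) = g \<Zspot> cod2 c" "stage (g \<triangleleft> c) = stage c"
  "\<lbrakk>cell c; g \<in> Cell1 \<B>; Src \<B> (dom2 c) = Trg \<B> g\<rbrakk> \<Longrightarrow> cell (g \<triangleleft> c)"
  by (auto simp: lw_def intro!: cellI) (simp_all add: stage_def app_def)

lemma rw_cst: "rwhisker V \<B> x y g \<cdot> e = e' \<Longrightarrow> cst x y e \<triangleright> g = cst (x \<Zspot> g) (y \<Zspot> g) e'"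
  and lw_cst: "lwhisker V \<B> g x y \<cdot> e = e' \<Longrightarrow> g \<triangleleft> cst x y e = cst (g \<Zspot> x) (g \<Zspot> y) e'"
  by (auto simp: rw_def lw_def cst_def con_def app_def)

text \<open>The 0-cells a and b are free on the right because \<open>ucomp\<close> reads only the
  composition of the hom-category, which \<open>HomCat\<close> takes from \<open>VCmp\<close> for
  every choice of them.\<close>

lemma vc_cst: "cst y z f \<circ>\<^sub>v cst x y e = cst x z (ucomp V (HomCat \<B> a b) x y z f e)"
  by (simp add: vc_def cst_def bil_def con_def ucomp_def apply2_def)

lemma vc_assoc:
  assumes "cell c" "cell d" "cell e" "dom2 c = cod2 d" "dom2 d = cod2 e"
  shows "(c \<circ>\<^sub>v d) \<circ>\<^sub>v e = c \<circ>\<^sub>v (d \<circ>\<^sub>v e)"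
  using braided_enriched_category.bil_ECmp_assoc[OF HomCat_braided[of "Src \<B> (dom2 e)" "Trg \<B> (dom2 e)"],
      of "dom2 e" "cod2 e" "cod2 d" "cod2 c" "val c" "val d" "val e"] assms
  by (simp add: vc_def hom1_iff)

lemma vc_ident:
  assumes "cell c"
  shows "cod2 c = x \<Longrightarrow> ident x \<circ>\<^sub>v c = c" "dom2 c = x \<Longrightarrow> c \<circ>\<^sub>v ident x = c"
  using braided_enriched_category.bil_EId[OF HomCat_braided[of "Src \<B> (dom2 c)" "Trg \<B> (dom2 c)"],
      of "dom2 c" "cod2 c" "val c"] assms
  by (auto simp: vc_def hom1_iff intro: cell_eqI)

lemma dcmp_HomCat:
  assumes "a \<in> Cell0 \<B>" "b \<in> Cell0 \<B>"
  shows "braided_enriched_category.dcmp V (HomCat \<B> a b) =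
    (\<lambda>x y z. VCmp \<B> x y z \<cdot> swap V (Hom2 \<B> x y) (Hom2 \<B> y z))"
  using braided_enriched_category.dcmp_def[OF HomCat_braided[OF assms]] by (simp add: fun_eq_iff)

lemma dc_assoc:
  assumes "cell c" "cell d" "cell e" "dom2 d = cod2 c" "dom2 e = cod2 d"
  shows "(c ;\<^sub>v d) ;\<^sub>v e = c ;\<^sub>v (d ;\<^sub>v e)"
  using braided_enriched_category.bil_dcmp_assoc[OF HomCat_braided[of "Src \<B> (dom2 c)" "Trg \<B> (dom2 c)"],
      of "dom2 c" "cod2 c" "cod2 d" "cod2 e" "val c" "val d" "val e"] assms
  by (simp add: dc_def hom1_iff dcmp_HomCat)

lemma stage_Nil_con:
  assumes "cell c" "stage c = []"
  obtains e where "val c = con e" "e \<in> Arr V" "Dom V e = Unt V" "Cod V e = Hom2 \<B> (dom2 c) (cod2 c)"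
  using assms cellD(5,6)[OF assms(1)] that[of "snd (val c)"]
  by (auto simp: elem_def obj_def stage_def con_def prod_eq_iff)

text \<open>A constant has no stages to be permuted. All constraints of the bicategory are
  constants, so they may be composed by either operation.\<close>

lemma dc_const:
  assumes "cell c" "cell d" "dom2 d = cod2 c" "stage c = [] \<or> stage d = []"
  shows "c ;\<^sub>v d = d \<circ>\<^sub>v c"
  using assms(4)
proof
  assume "stage c = []"
  then obtain e where "val c = con e" "e \<in> Arr V" "Dom V e = Unt V" "Cod V e = Hom2 \<B> (dom2 c) (cod2 c)"
    using stage_Nil_con assms(1) by blast
  then show ?thesis
    using braided_enriched_category.bil_dcmp_con(2)[OF HomCat_braided[of "Src \<B> (dom2 c)" "Trg \<B> (dom2 c)"],
      of "dom2 c" "cod2 c" "cod2 d" e "val d"] assms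
    by (simp add: dc_def vc_def hom1_iff dcmp_HomCat)
next
  assume "stage d = []"
  then obtain e where "val d = con e" "e \<in> Arr V" "Dom V e = Unt V" "Cod V e = Hom2 \<B> (dom2 d) (cod2 d)"
    using stage_Nil_con assms(2) by blast
  then show ?thesis
    using braided_enriched_category.bil_dcmp_con(1)[OF HomCat_braided[of "Src \<B> (dom2 c)" "Trg \<B> (dom2 c)"],
      of "dom2 c" "cod2 c" "cod2 d" e "val c"] assms
    by (simp add: dc_def vc_def hom1_iff dcmp_HomCat)
qed

lemma dc_ident:
  assumes "cell c"
  shows "cod2 c = x \<Longrightarrow> c ;\<^sub>v ident x = c" "dom2 c = x \<Longrightarrow> ident x ;\<^sub>v c = c"
  using assms by (auto simp: dc_const vc_ident)

text \<open>In the applications E is an interchange square: up to constraints, \<open>f1\<close>,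
  \<open>g1\<close> and f, g are the two pairs of whiskerings of the same two cells.\<close>

lemma vc_dc_assoc:
  assumes "cell f" "cell g" "cell n" "cell f1" "cell g1" "stage f1 = stage f" "stage g1 = stage g"
    and "dom2 f = cod2 n" "dom2 g = cod2 f" "dom2 g1 = cod2 n" "dom2 f1 = cod2 g1"
    and E: "f1 \<circ>\<^sub>v g1 = f ;\<^sub>v g"
  shows "(f \<circ>\<^sub>v n) ;\<^sub>v g = f1 \<circ>\<^sub>v (n ;\<^sub>v g1)"
proof -
  have "cod2 (f1 \<circ>\<^sub>v g1) = cod2 (f ;\<^sub>v g)" using E by simp
  then have "cod2 f1 = cod2 g" by simp
  then show ?thesis
    using braided_enriched_category.bil_mixed_left[OF HomCat_braided[of "Src \<B> (dom2 n)" "Trg \<B> (dom2 n)"],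
      of "dom2 n" "cod2 n" "cod2 g1" "cod2 f" "cod2 g" "val f" "val f1" "val g" "val g1" "val n"] assms
    by (simp add: dc_def vc_def hom1_iff dcmp_HomCat) (simp add: stage_def)
qed

lemma dc_vc_assoc:
  assumes "cell f" "cell h" "cell m" "cell f1" "cell h1" "stage f1 = stage f" "stage h1 = stage h"
    and "dom2 f = cod2 h" "dom2 m = cod2 f" "dom2 h1 = cod2 f1" "dom2 m = cod2 h1"
    and E: "f \<circ>\<^sub>v h = f1 ;\<^sub>v h1"
  shows "(f ;\<^sub>v m) \<circ>\<^sub>v h = f1 ;\<^sub>v (m \<circ>\<^sub>v h1)"
proof -
  have "dom2 (f \<circ>\<^sub>v h) = dom2 (f1 ;\<^sub>v h1)" using E by simp
  then have "dom2 f1 = dom2 h" by simp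
  then show ?thesis
    using braided_enriched_category.bil_mixed_right[OF HomCat_braided[of "Src \<B> (dom2 h)" "Trg \<B> (dom2 h)"],
      of "dom2 h" "cod2 h" "cod2 f1" "dom2 m" "cod2 m" "val f" "val f1" "val h" "val h1" "val m"] assms
    by (simp add: dc_def vc_def hom1_iff dcmp_HomCat) (simp add: stage_def)
qed

lemma rw_conv_hc: "cell c \<Longrightarrow> g \<in> Cell1 \<B> \<Longrightarrow> Trg \<B> (dom2 c) = Src \<B> g \<Longrightarrow> c \<triangleright> g = c \<circ>\<^sub>h ident g"
  and lw_conv_hc: "cell c \<Longrightarrow> g \<in> Cell1 \<B> \<Longrightarrow> Src \<B> (dom2 c) = Trg \<B> g \<Longrightarrow> g \<triangleleft> c = ident g \<circ>\<^sub>h c"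
  by (simp_all add: rw_def lw_def hc_def bil_HCmp_con)

lemma hc_ident: "f \<in> Cell1 \<B> \<Longrightarrow> g \<in> Cell1 \<B> \<Longrightarrow> Trg \<B> f = Src \<B> g \<Longrightarrow> ident f \<circ>\<^sub>h ident g = ident (f \<Zspot> g)"
  by (simp add: hc_def HCmp_VId bil_def con_def ident_def cst_def)

text \<open>The laws relating whiskering to \<open>\<circ>\<^sub>v\<close> arise from this one and
  \<open>hc_vc_lw\<close> by inserting identities.\<close>

lemma rw_vc_hc:
  assumes "cell c" "cell d" "cell e" "dom2 c = cod2 d" "Trg \<B> (dom2 d) = Src \<B> (dom2 e)"
  shows "(c \<circ>\<^sub>v d) \<circ>\<^sub>h e = (c \<triangleright> cod2 e) \<circ>\<^sub>v (d \<circ>\<^sub>h e)"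
proof -
  let ?r = "rwhisker V \<B> (dom2 c) (cod2 c) (cod2 e)"
  have "bil (HCmp \<B> (dom2 d) (cod2 c) (dom2 e) (cod2 e)) (bil (VCmp \<B> (dom2 d) (cod2 d) (cod2 c)) (val c) (val d)) (val e)
    = bil (VCmp \<B> (dom2 d \<Zspot> dom2 e) (cod2 d \<Zspot> cod2 e) (cod2 c \<Zspot> cod2 e)
        \<cdot> (?r \<odot> Idn V (Hom2 \<B> (dom2 d \<Zspot> dom2 e) (cod2 d \<Zspot> cod2 e)))) (val c)
      (bil (HCmp \<B> (dom2 d) (cod2 d) (dom2 e) (cod2 e)) (val d) (val e))"
    using VCmp_rwhisker_HCmp[of "dom2 d" "Src \<B> (dom2 d)" "Trg \<B> (dom2 d)" "cod2 d" "cod2 c" "dom2 e" "Trg \<B> (dom2 e)" "cod2 e"] assms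
    by (intro bil_assoc) (simp_all add: hom1_iff)
  then show ?thesis using assms by (simp add: hc_def vc_def rw_def bil_app_left)
qed

lemma hc_vc_lw:
  assumes "cell c" "cell d" "cell e" "dom2 d = cod2 e" "Trg \<B> (dom2 c) = Src \<B> (dom2 e)"
  shows "c \<circ>\<^sub>h (d \<circ>\<^sub>v e) = (c \<circ>\<^sub>h d) \<circ>\<^sub>v (dom2 c \<triangleleft> e)"
proof -
  let ?l = "lwhisker V \<B> (dom2 c) (dom2 e) (cod2 e)"
  have "bil (VCmp \<B> (dom2 c \<Zspot> dom2 e) (dom2 c \<Zspot> cod2 e) (cod2 c \<Zspot> cod2 d)
        \<cdot> (Idn V (Hom2 \<B> (dom2 c \<Zspot> dom2 d) (cod2 c \<Zspot> cod2 d)) \<odot> ?l))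
        (bil (HCmp \<B> (dom2 c) (cod2 c) (dom2 d) (cod2 d)) (val c) (val d)) (val e)
     = bil (HCmp \<B> (dom2 c) (cod2 c) (dom2 e) (cod2 d)) (val c) (bil (VCmp \<B> (dom2 e) (cod2 e) (cod2 d)) (val d) (val e))"
    using VCmp_HCmp_lwhisker[of "dom2 c" "Src \<B> (dom2 c)" "Trg \<B> (dom2 c)" "cod2 c" "dom2 e" "Trg \<B> (dom2 e)" "cod2 e" "cod2 d"] assms
    by (intro bil_assoc) (simp_all add: hom1_iff)
  then show ?thesis using assms by (simp add: hc_def vc_def lw_def bil_app_right)
qed

text \<open>The reason for composing through the inverse braiding: naturality leads to
  \<open>VCmp_lwhisker_rwhisker\<close>, which leaves a \<open>Brd\<close>, and \<open>swap\<close>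
  cancels it.\<close>

lemma rw_dc_lw:
  assumes "cell c" "cell d" "Trg \<B> (dom2 c) = Src \<B> (dom2 d)"
  shows "(c \<triangleright> dom2 d) ;\<^sub>v (cod2 c \<triangleleft> d) = c \<circ>\<^sub>h d"
proof -
  let ?F = "Hom2 \<B> (dom2 c) (cod2 c)" and ?G = "Hom2 \<B> (dom2 d) (cod2 d)"
  let ?r = "rwhisker V \<B> (dom2 c) (cod2 c) (dom2 d)" and ?l = "lwhisker V \<B> (cod2 c) (dom2 d) (cod2 d)"
  let ?V = "VCmp \<B> (dom2 c \<Zspot> dom2 d) (cod2 c \<Zspot> dom2 d) (cod2 c \<Zspot> cod2 d)"
  let ?S = "swap V (Hom2 \<B> (dom2 c \<Zspot> dom2 d) (cod2 c \<Zspot> dom2 d)) (Hom2 \<B> (cod2 c \<Zspot> dom2 d) (cod2 c \<Zspot> cod2 d))"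
  have "(?V \<cdot> ?S) \<cdot> (?r \<odot> ?l) = (?V \<cdot> (?l \<odot> ?r)) \<cdot> swap V ?F ?G"
    using assms by (simp add: swap_nat)
  also have "?V \<cdot> (?l \<odot> ?r) = HCmp \<B> (dom2 c) (cod2 c) (dom2 d) (cod2 d) \<cdot> Brd V ?G ?F"
    using assms
    by (intro VCmp_lwhisker_rwhisker[of _ "Src \<B> (dom2 c)" "Trg \<B> (dom2 c)" _ _ "Trg \<B> (dom2 d)"]) (simp_all add: hom1_iff)
  finally have "(?V \<cdot> ?S) \<cdot> (?r \<odot> ?l) = HCmp \<B> (dom2 c) (cod2 c) (dom2 d) (cod2 d)"
    using assms by (simp add: swap_def)
  then show ?thesis
    using assms bil_TenA[of "val c" "val d" ?r ?l "?V \<cdot> ?S"]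
    by (simp add: dc_def rw_def lw_def hc_def)
qed

text \<open>Together with \<open>rw_dc_lw\<close> this evaluates a horizontal composite in both
  orders, which is the source of the squares needed for mixed associativity.\<close>

lemma rw_vc_lw:
  assumes "cell c" "cell d" "Trg \<B> (dom2 c) = Src \<B> (dom2 d)"
  shows "(c \<triangleright> cod2 d) \<circ>\<^sub>v (dom2 c \<triangleleft> d) = c \<circ>\<^sub>h d"
  using rw_vc_hc[of c "ident (dom2 c)" d] assms by (simp add: lw_conv_hc vc_ident)

lemma rw_vc:
  assumes "cell c" "cell d" "dom2 c = cod2 d" "g \<in> Cell1 \<B>" "Trg \<B> (dom2 d) = Src \<B> g"
  shows "(c \<circ>\<^sub>v d) \<triangleright> g = (c \<triangleright> g) \<circ>\<^sub>v (d \<triangleright> g)"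
  using rw_vc_hc[of c d "ident g"] assms by (simp add: rw_conv_hc)

lemma lw_vc:
  assumes "cell c" "cell d" "dom2 c = cod2 d" "g \<in> Cell1 \<B>" "Src \<B> (dom2 d) = Trg \<B> g"
  shows "g \<triangleleft> (c \<circ>\<^sub>v d) = (g \<triangleleft> c) \<circ>\<^sub>v (g \<triangleleft> d)"
  using hc_vc_lw[of "ident g" c d] assms by (simp add: lw_conv_hc)

text \<open>The law \<open>rw_vc\<close> at generic cells. The form for morphisms is needed in
  \<open>rw_dc\<close>, where a \<open>swap\<close> is composed with \<open>VCmp\<close>.\<close>

lemma rwhisker_VCmp:
  assumes "f \<in> Cell1 \<B>" "f' \<in> Cell1 \<B>" "f'' \<in> Cell1 \<B>" "Src \<B> f' = Src \<B> f" "Src \<B> f'' = Src \<B> f"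
    "Trg \<B> f' = Trg \<B> f" "Trg \<B> f'' = Trg \<B> f" "g \<in> Cell1 \<B>" "Trg \<B> f = Src \<B> g"
  shows "rwhisker V \<B> f f'' g \<cdot> VCmp \<B> f f' f'' =
    VCmp \<B> (f \<Zspot> g) (f' \<Zspot> g) (f'' \<Zspot> g) \<cdot> (rwhisker V \<B> f' f'' g \<odot> rwhisker V \<B> f f' g)"
proof (rule bil_dense_cancel[of _ "gen (Hom2 \<B> f' f'')" "gen (Hom2 \<B> f f')"])
  have "cell (f', f'', gen (Hom2 \<B> f' f''))" "cell (f, f', gen (Hom2 \<B> f f'))"
    using assms by (auto intro!: cellI)
  from rw_vc[OF this, of g]
  show "bil (rwhisker V \<B> f f'' g \<cdot> VCmp \<B> f f' f'') (gen (Hom2 \<B> f' f'')) (gen (Hom2 \<B> f f'))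
     = bil (VCmp \<B> (f \<Zspot> g) (f' \<Zspot> g) (f'' \<Zspot> g) \<cdot> (rwhisker V \<B> f' f'' g \<odot> rwhisker V \<B> f f' g))
       (gen (Hom2 \<B> f' f'')) (gen (Hom2 \<B> f f'))"
    using assms by (simp add: rw_def vc_def bil_TenA)
qed (use assms in auto)

lemma lwhisker_VCmp:
  assumes "f \<in> Cell1 \<B>" "f' \<in> Cell1 \<B>" "f'' \<in> Cell1 \<B>" "Src \<B> f' = Src \<B> f" "Src \<B> f'' = Src \<B> f"
    "Trg \<B> f' = Trg \<B> f" "Trg \<B> f'' = Trg \<B> f" "g \<in> Cell1 \<B>" "Src \<B> f = Trg \<B> g"
  shows "lwhisker V \<B> g f f'' \<cdot> VCmp \<B> f f' f'' =
    VCmp \<B> (g \<Zspot> f) (g \<Zspot> f') (g \<Zspot> f'') \<cdot> (lwhisker V \<B> g f' f'' \<odot> lwhisker V \<B> g f f')"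
proof (rule bil_dense_cancel[of _ "gen (Hom2 \<B> f' f'')" "gen (Hom2 \<B> f f')"])
  have "cell (f', f'', gen (Hom2 \<B> f' f''))" "cell (f, f', gen (Hom2 \<B> f f'))"
    using assms by (auto intro!: cellI)
  from lw_vc[OF this, of g]
  show "bil (lwhisker V \<B> g f f'' \<cdot> VCmp \<B> f f' f'') (gen (Hom2 \<B> f' f'')) (gen (Hom2 \<B> f f'))
     = bil (VCmp \<B> (g \<Zspot> f) (g \<Zspot> f') (g \<Zspot> f'') \<cdot> (lwhisker V \<B> g f' f'' \<odot> lwhisker V \<B> g f f'))
       (gen (Hom2 \<B> f' f'')) (gen (Hom2 \<B> f f'))"
    using assms by (simp add: lw_def vc_def bil_TenA)
qed (use assms in auto)

text \<open>Whiskering is a map of hom-objects, so naturality of \<open>swap\<close> carries its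
  compatibility with \<open>VCmp\<close> over to \<open>;\<^sub>v\<close>.\<close>

lemma rw_dc:
  assumes "cell c" "cell d" "dom2 d = cod2 c" "g \<in> Cell1 \<B>" "Trg \<B> (dom2 c) = Src \<B> g"
  shows "(c ;\<^sub>v d) \<triangleright> g = (c \<triangleright> g) ;\<^sub>v (d \<triangleright> g)"
proof -
  have "rwhisker V \<B> (dom2 c) (cod2 d) g \<cdot> VCmp \<B> (dom2 c) (cod2 c) (cod2 d) \<cdot> k =
    (VCmp \<B> (dom2 c \<Zspot> g) (cod2 c \<Zspot> g) (cod2 d \<Zspot> g) \<cdot> (rwhisker V \<B> (cod2 c) (cod2 d) g \<odot> rwhisker V \<B> (dom2 c) (cod2 c) g)) \<cdot> k"
    if "k \<in> Arr V" "Cod V k = Hom2 \<B> (cod2 c) (cod2 d) \<otimes> Hom2 \<B> (dom2 c) (cod2 c)" for k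
    using that assms by (intro Cmp_extend rwhisker_VCmp) auto
  then show ?thesis using assms by (simp add: rw_def dc_def bil_TenA[symmetric] swap_nat)
qed

lemma lw_dc:
  assumes "cell c" "cell d" "dom2 d = cod2 c" "g \<in> Cell1 \<B>" "Src \<B> (dom2 c) = Trg \<B> g"
  shows "g \<triangleleft> (c ;\<^sub>v d) = (g \<triangleleft> c) ;\<^sub>v (g \<triangleleft> d)"
proof -
  have "lwhisker V \<B> g (dom2 c) (cod2 d) \<cdot> VCmp \<B> (dom2 c) (cod2 c) (cod2 d) \<cdot> k =
    (VCmp \<B> (g \<Zspot> dom2 c) (g \<Zspot> cod2 c) (g \<Zspot> cod2 d) \<cdot> (lwhisker V \<B> g (cod2 c) (cod2 d) \<odot> lwhisker V \<B> g (dom2 c) (cod2 c))) \<cdot> k"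
    if "k \<in> Arr V" "Cod V k = Hom2 \<B> (cod2 c) (cod2 d) \<otimes> Hom2 \<B> (dom2 c) (cod2 c)" for k
    using that assms by (intro Cmp_extend lwhisker_VCmp) auto
  then show ?thesis using assms by (simp add: lw_def dc_def bil_TenA[symmetric] swap_nat)
qed

lemma rw_ident: "f \<in> Cell1 \<B> \<Longrightarrow> g \<in> Cell1 \<B> \<Longrightarrow> Trg \<B> f = Src \<B> g \<Longrightarrow> ident f \<triangleright> g = ident (f \<Zspot> g)"
  and lw_ident: "f \<in> Cell1 \<B> \<Longrightarrow> g \<in> Cell1 \<B> \<Longrightarrow> Trg \<B> g = Src \<B> f \<Longrightarrow> g \<triangleleft> ident f = ident (g \<Zspot> f)"
  by (simp_all add: rw_conv_hc lw_conv_hc hc_ident)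

section \<open>Constraints of an enriched bicategory\<close>

definition asc where
  "asc f g h = cst ((f \<Zspot> g) \<Zspot> h) (f \<Zspot> (g \<Zspot> h)) (EAssoc \<B> f g h)"
definition asc' where
  "asc' f g h = cst (f \<Zspot> (g \<Zspot> h)) ((f \<Zspot> g) \<Zspot> h)
    (uinv V (HomCat \<B> (Src \<B> f) (Trg \<B> h)) ((f \<Zspot> g) \<Zspot> h) (f \<Zspot> (g \<Zspot> h)) (EAssoc \<B> f g h))"
definition lun where "lun f = cst (Unit1 \<B> (Src \<B> f) \<Zspot> f) f (ELUnit \<B> f)"
definition lun' where
  "lun' f = cst f (Unit1 \<B> (Src \<B> f) \<Zspot> f)
    (uinv V (HomCat \<B> (Src \<B> f) (Trg \<B> f)) (Unit1 \<B> (Src \<B> f) \<Zspot> f) f (ELUnit \<B> f))"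
definition run where "run f = cst (f \<Zspot> Unit1 \<B> (Trg \<B> f)) f (ERUnit \<B> f)"
definition run' where
  "run' f = cst f (f \<Zspot> Unit1 \<B> (Trg \<B> f))
    (uinv V (HomCat \<B> (Src \<B> f) (Trg \<B> f)) (f \<Zspot> Unit1 \<B> (Trg \<B> f)) f (ERUnit \<B> f))"

lemma vc_cancel_right:
  assumes "c \<circ>\<^sub>v k = d \<circ>\<^sub>v k" "k \<circ>\<^sub>v k' = ident (cod2 k)" "cell c" "cell d" "cell k" "cell k'"
    "dom2 c = cod2 k" "dom2 d = cod2 k" "dom2 k = cod2 k'"
  shows "c = d"
proof -
  have "c = c \<circ>\<^sub>v (k \<circ>\<^sub>v k')" using assms(2,3,7) by (simp add: vc_ident)
  also have "\<dots> = (c \<circ>\<^sub>v k) \<circ>\<^sub>v k'" using assms(3,5-9) by (simp add: vc_assoc)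
  also have "\<dots> = d \<circ>\<^sub>v (k \<circ>\<^sub>v k')" unfolding assms(1) using assms(4-9) by (simp add: vc_assoc)
  also have "\<dots> = d" using assms(2,4,8) by (simp add: vc_ident)
  finally show ?thesis .
qed

lemma vc_cancel_left:
  assumes "k \<circ>\<^sub>v c = k \<circ>\<^sub>v d" "k' \<circ>\<^sub>v k = ident (dom2 k)" "cell c" "cell d" "cell k" "cell k'"
    "cod2 c = dom2 k" "cod2 d = dom2 k" "dom2 k' = cod2 k"
  shows "c = d"
proof -
  have "c = (k' \<circ>\<^sub>v k) \<circ>\<^sub>v c" using assms(2,3,7) by (simp add: vc_ident)
  also have "\<dots> = k' \<circ>\<^sub>v (k \<circ>\<^sub>v c)" using assms(3,5-9) by (simp add: vc_assoc)
  also have "\<dots> = (k' \<circ>\<^sub>v k) \<circ>\<^sub>v d" unfolding assms(1) using assms(4-9) by (simp add: vc_assoc)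
  also have "\<dots> = d" using assms(2,4,8) by (simp add: vc_ident)
  finally show ?thesis .
qed

lemma is_uinverse_cst:
  assumes "is_uinverse V (HomCat \<B> a b) x y e e'" "x \<in> hom1 \<B> a b" "y \<in> hom1 \<B> a b"
  shows "cell (cst x y e)" "cell (cst y x e')" "cst y x e' \<circ>\<^sub>v cst x y e = ident x" "cst x y e \<circ>\<^sub>v cst y x e' = ident y"
  using assms by (auto simp: is_uinverse_def vc_cst[of _ _ _ _ _ a b] ident_def hom1_iff intro!: cell_cst)

lemma is_uinverse_uinv:
  assumes e: "\<exists>e'. is_uinverse V (HomCat \<B> a b) x y e e'" and x: "x \<in> hom1 \<B> a b" "y \<in> hom1 \<B> a b"
  shows "is_uinverse V (HomCat \<B> a b) x y e (uinv V (HomCat \<B> a b) x y e)"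
  unfolding uinv_def
proof (rule theI')
  show "\<exists>!e'. is_uinverse V (HomCat \<B> a b) x y e e'"
  proof (rule ex_ex1I[OF e])
    fix f f' assume f: "is_uinverse V (HomCat \<B> a b) x y e f" and f': "is_uinverse V (HomCat \<B> a b) x y e f'"
    note F = is_uinverse_cst[OF f x] and F' = is_uinverse_cst[OF f' x]
    have "cst y x f = cst y x f'"
      by (rule vc_cancel_right[of _ "cst x y e" _ "cst y x f"]) (use F F' in auto)
    then show "f = f'" by (simp add: cst_def con_def)
  qed
qed

text \<open>Enriched naturality equates a \<open>postcomp\<close> with a \<open>precomp\<close>.
  Both are compositions with a constant cell, so evaluation at u turns the axiom into an ordinary
  naturality square.\<close>

lemma enriched_nat_iso_cell:
  assumes N: "enriched_nat_iso V D (HomCat \<B> a b) F0 F G0 G \<eta>" and x: "x \<in> EObj D" "y \<in> EObj D"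
    and F: "F0 x \<in> hom1 \<B> a b" "F0 y \<in> hom1 \<B> a b" "F x y \<in> Arr V" "Dom V (F x y) = obj u" "Cod V (F x y) = Hom2 \<B> (F0 x) (F0 y)"
    and G: "G0 x \<in> hom1 \<B> a b" "G0 y \<in> hom1 \<B> a b" "G x y \<in> Arr V" "Dom V (G x y) = obj u" "Cod V (G x y) = Hom2 \<B> (G0 x) (G0 y)"
    and u: "elem u"
  shows "cst (F0 y) (G0 y) (\<eta> y) \<circ>\<^sub>v (F0 x, F0 y, app (F x y) u) = (G0 x, G0 y, app (G x y) u) \<circ>\<^sub>v cst (F0 x) (G0 x) (\<eta> x)"
proof -
  have "\<eta> x \<in> hom V (Unt V) (Hom2 \<B> (F0 x) (G0 x))" "\<eta> y \<in> hom V (Unt V) (Hom2 \<B> (F0 y) (G0 y))"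
    using N x by (auto simp: enriched_nat_iso_def is_uinverse_def)
  then have e: "\<eta> x \<in> Arr V" "Dom V (\<eta> x) = Unt V" "Cod V (\<eta> x) = Hom2 \<B> (F0 x) (G0 x)"
    "\<eta> y \<in> Arr V" "Dom V (\<eta> y) = Unt V" "Cod V (\<eta> y) = Hom2 \<B> (F0 y) (G0 y)"
    by (auto simp: in_hom_iff)
  let ?post = "postcomp V (HomCat \<B> a b) (F0 x) (F0 y) (G0 y) (\<eta> y)"
    and ?pre = "precomp V (HomCat \<B> a b) (F0 x) (G0 x) (G0 y) (\<eta> x)"
  note S = F G e u hom1_iff
  have P: "?post \<in> Arr V" "Dom V ?post = Hom2 \<B> (F0 x) (F0 y)" "?pre \<in> Arr V" "Dom V ?pre = Hom2 \<B> (G0 x) (G0 y)"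
    using S by (simp_all add: postcomp_def precomp_def)
  have "cst (F0 y) (G0 y) (\<eta> y) \<circ>\<^sub>v (F0 x, F0 y, app (F x y) u) = (F0 x, G0 y, app ?post (app (F x y) u))"
    using S by (simp add: vc_def bil_con_left postcomp_def)
  also have "\<dots> = (F0 x, G0 y, app (?post \<cdot> F x y) u)"
    using P S by (simp add: app_app)
  also have "?post \<cdot> F x y = ?pre \<cdot> G x y"
    using N x by (simp add: enriched_nat_iso_def)
  also have "(F0 x, G0 y, app (?pre \<cdot> G x y) u) = (F0 x, G0 y, app ?pre (app (G x y) u))"
    using P S by (simp add: app_app)
  also have "\<dots> = (G0 x, G0 y, app (G x y) u) \<circ>\<^sub>v cst (F0 x) (G0 x) (\<eta> x)"
    using S by (simp add: vc_def bil_con_right precomp_def)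
  finally show ?thesis .
qed

lemma asc_simps [simp]:
  "dom2 (asc f g h) = (f \<Zspot> g) \<Zspot> h" "cod2 (asc f g h) = f \<Zspot> (g \<Zspot> h)" "stage (asc f g h) = []"
  "dom2 (asc' f g h) = f \<Zspot> (g \<Zspot> h)" "cod2 (asc' f g h) = (f \<Zspot> g) \<Zspot> h" "stage (asc' f g h) = []"
  by (simp_all add: asc_def asc'_def)

lemma lun_simps [simp]:
  "dom2 (lun f) = Unit1 \<B> (Src \<B> f) \<Zspot> f" "cod2 (lun f) = f" "stage (lun f) = []"
  "dom2 (lun' f) = f" "cod2 (lun' f) = Unit1 \<B> (Src \<B> f) \<Zspot> f" "stage (lun' f) = []"
  by (simp_all add: lun_def lun'_def)

lemma run_simps [simp]:
  "dom2 (run f) = f \<Zspot> Unit1 \<B> (Trg \<B> f)" "cod2 (run f) = f" "stage (run f) = []"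
  "dom2 (run' f) = f" "cod2 (run' f) = f \<Zspot> Unit1 \<B> (Trg \<B> f)" "stage (run' f) = []"
  by (simp_all add: run_def run'_def)

lemma asc_iso [simp]:
  assumes "f \<in> Cell1 \<B>" "g \<in> Cell1 \<B>" "h \<in> Cell1 \<B>" "Trg \<B> f = Src \<B> g" "Trg \<B> g = Src \<B> h"
  shows "cell (asc f g h)" "cell (asc' f g h)" "asc' f g h \<circ>\<^sub>v asc f g h = ident ((f \<Zspot> g) \<Zspot> h)"
    "asc f g h \<circ>\<^sub>v asc' f g h = ident (f \<Zspot> (g \<Zspot> h))"
proof -
  have "\<exists>e'. is_uinverse V (HomCat \<B> (Src \<B> f) (Trg \<B> h)) ((f \<Zspot> g) \<Zspot> h) (f \<Zspot> (g \<Zspot> h)) (EAssoc \<B> f g h) e'"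
    using EAssoc_nat_iso[of "Src \<B> f" "Trg \<B> f" "Trg \<B> g" "Trg \<B> h"] assms
    by (simp add: enriched_nat_iso_def etensor_def hom1_iff)
  from is_uinverse_cst[OF is_uinverse_uinv[OF this]]
  show "cell (asc f g h)" "cell (asc' f g h)" "asc' f g h \<circ>\<^sub>v asc f g h = ident ((f \<Zspot> g) \<Zspot> h)"
    "asc f g h \<circ>\<^sub>v asc' f g h = ident (f \<Zspot> (g \<Zspot> h))"
    using assms by (simp_all add: hom1_iff asc_def asc'_def)
qed

lemma lun_iso [simp]:
  assumes "f \<in> Cell1 \<B>"
  shows "cell (lun f)" "cell (lun' f)" "lun' f \<circ>\<^sub>v lun f = ident (Unit1 \<B> (Src \<B> f) \<Zspot> f)" "lun f \<circ>\<^sub>v lun' f = ident f"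
proof -
  have "\<exists>e'. is_uinverse V (HomCat \<B> (Src \<B> f) (Trg \<B> f)) (Unit1 \<B> (Src \<B> f) \<Zspot> f) f (ELUnit \<B> f) e'"
    using ELUnit_nat_iso[of "Src \<B> f" "Trg \<B> f"] assms by (simp add: enriched_nat_iso_def hom1_iff)
  from is_uinverse_cst[OF is_uinverse_uinv[OF this]]
  show "cell (lun f)" "cell (lun' f)" "lun' f \<circ>\<^sub>v lun f = ident (Unit1 \<B> (Src \<B> f) \<Zspot> f)" "lun f \<circ>\<^sub>v lun' f = ident f"
    using assms by (simp_all add: hom1_iff lun_def lun'_def)
qed

lemma run_iso [simp]:
  assumes "f \<in> Cell1 \<B>"
  shows "cell (run f)" "cell (run' f)" "run' f \<circ>\<^sub>v run f = ident (f \<Zspot> Unit1 \<B> (Trg \<B> f))" "run f \<circ>\<^sub>v run' f = ident f"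
proof -
  have "\<exists>e'. is_uinverse V (HomCat \<B> (Src \<B> f) (Trg \<B> f)) (f \<Zspot> Unit1 \<B> (Trg \<B> f)) f (ERUnit \<B> f) e'"
    using ERUnit_nat_iso[of "Src \<B> f" "Trg \<B> f"] assms by (simp add: enriched_nat_iso_def hom1_iff)
  from is_uinverse_cst[OF is_uinverse_uinv[OF this]]
  show "cell (run f)" "cell (run' f)" "run' f \<circ>\<^sub>v run f = ident (f \<Zspot> Unit1 \<B> (Trg \<B> f))" "run f \<circ>\<^sub>v run' f = ident f"
    using assms by (simp_all add: hom1_iff run_def run'_def)
qed

text \<open>Naturality of \<open>EAssoc\<close> at the element \<open>?u\<close> of the threefold
  tensor product; the two functors involved send it to the two nested horizontal composites.\<close>

lemma asc_hc:
  assumes cde: "cell c" "cell d" "cell e" "Trg \<B> (dom2 c) = Src \<B> (dom2 d)" "Trg \<B> (dom2 d) = Src \<B> (dom2 e)"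
  shows "asc (cod2 c) (cod2 d) (cod2 e) \<circ>\<^sub>v ((c \<circ>\<^sub>h d) \<circ>\<^sub>h e) = (c \<circ>\<^sub>h (d \<circ>\<^sub>h e)) \<circ>\<^sub>v asc (dom2 c) (dom2 d) (dom2 e)"
proof -
  let ?f = "dom2 c" and ?g = "dom2 d" and ?h = "dom2 e" and ?f' = "cod2 c" and ?g' = "cod2 d" and ?h' = "cod2 e"
  let ?u = "pair (pair (val c) (val d)) (val e)"
  let ?F = "HCmp \<B> (?f \<Zspot> ?g) (?f' \<Zspot> ?g') ?h ?h' \<cdot> (HCmp \<B> ?f ?f' ?g ?g' \<odot> Idn V (Hom2 \<B> ?h ?h'))"
  let ?G = "HCmp \<B> ?f ?f' (?g \<Zspot> ?h) (?g' \<Zspot> ?h') \<cdot> (Idn V (Hom2 \<B> ?f ?f') \<odot> HCmp \<B> ?g ?g' ?h ?h')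
    \<cdot> Asc V (Hom2 \<B> ?f ?f') (Hom2 \<B> ?g ?g') (Hom2 \<B> ?h ?h')"
  have "app ?F ?u = app (HCmp \<B> (?f \<Zspot> ?g) (?f' \<Zspot> ?g') ?h ?h') (app (HCmp \<B> ?f ?f' ?g ?g' \<odot> Idn V (obj (val e))) ?u)"
    using cde by (subst app_app) auto
  also have "\<dots> = val ((c \<circ>\<^sub>h d) \<circ>\<^sub>h e)"
    using cde by (subst app_TenA_Idn_pair) (auto simp: hc_def)
  finally have F: "app ?F ?u = val ((c \<circ>\<^sub>h d) \<circ>\<^sub>h e)" .
  have "app ?G ?u = app (HCmp \<B> ?f ?f' (?g \<Zspot> ?h) (?g' \<Zspot> ?h'))
     (app ((Idn V (obj (val c)) \<odot> HCmp \<B> ?g ?g' ?h ?h') \<cdot> Asc V (obj (val c)) (obj (val d)) (obj (val e))) ?u)"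
    using cde by (subst app_app) auto
  also have "\<dots> = val (c \<circ>\<^sub>h (d \<circ>\<^sub>h e))"
    using cde by (subst app_Idn_TenA_pair) (auto simp: hc_def)
  finally have G: "app ?G ?u = val (c \<circ>\<^sub>h (d \<circ>\<^sub>h e))" .
  have "Src \<B> ?f \<in> Cell0 \<B>" "Trg \<B> ?f \<in> Cell0 \<B>" "Trg \<B> ?g \<in> Cell0 \<B>" "Trg \<B> ?h \<in> Cell0 \<B>"
    using cde by simp_all
  from enriched_nat_iso_cell[OF EAssoc_nat_iso[OF this], of "((?f, ?g), ?h)" "((?f', ?g'), ?h')" ?u]
  have "asc ?f' ?g' ?h' \<circ>\<^sub>v ((?f \<Zspot> ?g) \<Zspot> ?h, (?f' \<Zspot> ?g') \<Zspot> ?h', app ?F ?u)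
    = (?f \<Zspot> (?g \<Zspot> ?h), ?f' \<Zspot> (?g' \<Zspot> ?h'), app ?G ?u) \<circ>\<^sub>v asc ?f ?g ?h"
    using cde by (simp add: etensor_def hom1_iff asc_def)
  then show ?thesis unfolding F G by (simp add: hc_def)
qed

lemma asc_rw_rw:
  assumes "cell c" "g \<in> Cell1 \<B>" "h \<in> Cell1 \<B>" "Trg \<B> (dom2 c) = Src \<B> g" "Trg \<B> g = Src \<B> h"
  shows "asc (cod2 c) g h \<circ>\<^sub>v (c \<triangleright> g \<triangleright> h) = (c \<triangleright> (g \<Zspot> h)) \<circ>\<^sub>v asc (dom2 c) g h"
  using asc_hc[of c "ident g" "ident h"] assms by (simp add: rw_conv_hc hc_ident)

lemma asc_lw_rw:
  assumes "cell c" "f \<in> Cell1 \<B>" "h \<in> Cell1 \<B>" "Trg \<B> f = Src \<B> (dom2 c)" "Trg \<B> (dom2 c) = Src \<B> h"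
  shows "asc f (cod2 c) h \<circ>\<^sub>v ((f \<triangleleft> c) \<triangleright> h) = (f \<triangleleft> (c \<triangleright> h)) \<circ>\<^sub>v asc f (dom2 c) h"
  using asc_hc[of "ident f" c "ident h"] assms by (simp add: rw_conv_hc lw_conv_hc)

lemma asc_lw_lw:
  assumes "cell c" "f \<in> Cell1 \<B>" "g \<in> Cell1 \<B>" "Trg \<B> f = Src \<B> g" "Trg \<B> g = Src \<B> (dom2 c)"
  shows "asc f g (cod2 c) \<circ>\<^sub>v ((f \<Zspot> g) \<triangleleft> c) = (f \<triangleleft> g \<triangleleft> c) \<circ>\<^sub>v asc f g (dom2 c)"
  using asc_hc[of "ident f" "ident g" c] assms by (simp add: lw_conv_hc hc_ident)

lemma lun_lw:
  assumes "cell c"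
  shows "lun (cod2 c) \<circ>\<^sub>v (Unit1 \<B> (Src \<B> (dom2 c)) \<triangleleft> c) = c \<circ>\<^sub>v lun (dom2 c)"
  using enriched_nat_iso_cell[OF ELUnit_nat_iso[of "Src \<B> (dom2 c)" "Trg \<B> (dom2 c)"], of "dom2 c" "cod2 c" "val c"] assms
  by (simp add: hom1_iff app_Idn lw_def lun_def) (simp add: dom2_def cod2_def val_def)

lemma run_rw:
  assumes "cell c"
  shows "run (cod2 c) \<circ>\<^sub>v (c \<triangleright> Unit1 \<B> (Trg \<B> (dom2 c))) = c \<circ>\<^sub>v run (dom2 c)"
  using enriched_nat_iso_cell[OF ERUnit_nat_iso[of "Src \<B> (dom2 c)" "Trg \<B> (dom2 c)"], of "dom2 c" "cod2 c" "val c"] assms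
  by (simp add: hom1_iff app_Idn rw_def run_def) (simp add: dom2_def cod2_def val_def)

section \<open>Pentagon, triangle and the coherence of the unit constraints\<close>

lemma asc_pentagon:
  assumes "f \<in> Cell1 \<B>" "g \<in> Cell1 \<B>" "h \<in> Cell1 \<B>" "k \<in> Cell1 \<B>"
    "Trg \<B> f = Src \<B> g" "Trg \<B> g = Src \<B> h" "Trg \<B> h = Src \<B> k"
  shows "asc f g (h \<Zspot> k) \<circ>\<^sub>v asc (f \<Zspot> g) h k =
    (f \<triangleleft> asc g h k) \<circ>\<^sub>v (asc f (g \<Zspot> h) k \<circ>\<^sub>v (asc f g h \<triangleright> k))"
  using EAssoc_pentagon[of f "Src \<B> f" "Trg \<B> f" g "Trg \<B> g" h "Trg \<B> h" k "Trg \<B> k"] assms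
  by (simp add: asc_def Let_def hom1_iff vc_cst[of _ _ _ _ _ "Src \<B> f" "Trg \<B> k"] rw_cst lw_cst)

lemma asc_triangle:
  assumes "f \<in> Cell1 \<B>" "g \<in> Cell1 \<B>" "Trg \<B> f = Src \<B> g"
  shows "(f \<triangleleft> lun g) \<circ>\<^sub>v asc f (Unit1 \<B> (Src \<B> g)) g = run f \<triangleright> g"
  using EUnit_triangle[of f "Src \<B> f" "Trg \<B> f" g "Trg \<B> g"] assms
  by (simp add: asc_def lun_def run_def Let_def hom1_iff vc_cst[of _ _ _ _ _ "Src \<B> f" "Trg \<B> g"] rw_cst lw_cst)

text \<open>Naturality of the invertible \<open>lun\<close> makes whiskering with a unit 1-cell
  faithful.\<close>

lemma Unit1_lw_cancel:
  assumes "Unit1 \<B> a \<triangleleft> c = Unit1 \<B> a \<triangleleft> d" "cell c" "cell d" "dom2 c = dom2 d" "cod2 c = cod2 d" "Src \<B> (dom2 d) = a"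
  shows "c = d"
  by (rule vc_cancel_right[of _ "lun (dom2 d)" _ "lun' (dom2 d)"])
    (use assms lun_lw[of c] lun_lw[of d] in auto)

lemma Unit1_rw_cancel:
  assumes "c \<triangleright> Unit1 \<B> a = d \<triangleright> Unit1 \<B> a" "cell c" "cell d" "dom2 c = dom2 d" "cod2 c = cod2 d" "Trg \<B> (dom2 d) = a"
  shows "c = d"
  by (rule vc_cancel_right[of _ "run (dom2 d)" _ "run' (dom2 d)"])
    (use assms run_rw[of c] run_rw[of d] in auto)

lemma run_HComp1_Unit1: "f \<in> Cell1 \<B> \<Longrightarrow> run (f \<Zspot> Unit1 \<B> (Trg \<B> f)) = run f \<triangleright> Unit1 \<B> (Trg \<B> f)"
  by (rule vc_cancel_left[of "run f" _ _ "run' f"]) (use run_rw[of "run f"] in auto)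

lemma asc_rw_iso:
  assumes "f \<in> Cell1 \<B>" "g \<in> Cell1 \<B>" "h \<in> Cell1 \<B>" "k \<in> Cell1 \<B>"
    "Trg \<B> f = Src \<B> g" "Trg \<B> g = Src \<B> h" "Trg \<B> h = Src \<B> k"
  shows "(asc f g h \<triangleright> k) \<circ>\<^sub>v (asc' f g h \<triangleright> k) = ident ((f \<Zspot> (g \<Zspot> h)) \<Zspot> k)"
    "(asc' f g h \<triangleright> k) \<circ>\<^sub>v (asc f g h \<triangleright> k) = ident (((f \<Zspot> g) \<Zspot> h) \<Zspot> k)"
  using assms by (simp_all add: rw_vc[symmetric] rw_ident)

lemma asc_lw_iso:
  assumes "f \<in> Cell1 \<B>" "g \<in> Cell1 \<B>" "h \<in> Cell1 \<B>" "k \<in> Cell1 \<B>"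
    "Trg \<B> f = Src \<B> g" "Trg \<B> g = Src \<B> h" "Trg \<B> k = Src \<B> f"
  shows "(k \<triangleleft> asc' f g h) \<circ>\<^sub>v (k \<triangleleft> asc f g h) = ident (k \<Zspot> ((f \<Zspot> g) \<Zspot> h))"
    "(k \<triangleleft> asc f g h) \<circ>\<^sub>v (k \<triangleleft> asc' f g h) = ident (k \<Zspot> (f \<Zspot> (g \<Zspot> h)))"
  using assms by (simp_all add: lw_vc[symmetric] lw_ident)

text \<open>Kelly's argument from \<open>Lun_TenO\<close>, with the tensor product replaced by
  composition of 1-cells.\<close>

lemma lun_HComp1:
  assumes [simp]: "f \<in> Cell1 \<B>" "g \<in> Cell1 \<B>" "Trg \<B> f = Src \<B> g"
  shows "lun (f \<Zspot> g) \<circ>\<^sub>v asc (Unit1 \<B> (Src \<B> f)) f g = lun f \<triangleright> g"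
proof (rule Unit1_lw_cancel)
  let ?u = "Unit1 \<B> (Src \<B> f)"
  let ?P = "asc ?u (?u \<Zspot> f) g \<circ>\<^sub>v (asc ?u ?u f \<triangleright> g)"
  have "(?u \<triangleleft> (lun (f \<Zspot> g) \<circ>\<^sub>v asc ?u f g)) \<circ>\<^sub>v ?P
     = (?u \<triangleleft> lun (f \<Zspot> g)) \<circ>\<^sub>v ((?u \<triangleleft> asc ?u f g) \<circ>\<^sub>v ?P)"
    by (simp add: lw_vc vc_assoc)
  also have "\<dots> = (?u \<triangleleft> lun (f \<Zspot> g)) \<circ>\<^sub>v (asc ?u ?u (f \<Zspot> g) \<circ>\<^sub>v asc (?u \<Zspot> ?u) f g)"
    by (simp add: asc_pentagon)
  also have "\<dots> = ((?u \<triangleleft> lun (f \<Zspot> g)) \<circ>\<^sub>v asc ?u ?u (f \<Zspot> g)) \<circ>\<^sub>v asc (?u \<Zspot> ?u) f g"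
    by (simp add: vc_assoc)
  also have "\<dots> = (run ?u \<triangleright> (f \<Zspot> g)) \<circ>\<^sub>v asc (?u \<Zspot> ?u) f g"
    using asc_triangle[of ?u "f \<Zspot> g"] by simp
  also have "\<dots> = asc ?u f g \<circ>\<^sub>v (run ?u \<triangleright> f \<triangleright> g)"
    using asc_rw_rw[of "run ?u" f g] by simp
  also have "run ?u \<triangleright> f = (?u \<triangleleft> lun f) \<circ>\<^sub>v asc ?u ?u f"
    using asc_triangle[of ?u f] by simp
  also have "asc ?u f g \<circ>\<^sub>v (((?u \<triangleleft> lun f) \<circ>\<^sub>v asc ?u ?u f) \<triangleright> g) = (asc ?u f g \<circ>\<^sub>v ((?u \<triangleleft> lun f) \<triangleright> g)) \<circ>\<^sub>v (asc ?u ?u f \<triangleright> g)"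
    by (simp add: rw_vc vc_assoc)
  also have "asc ?u f g \<circ>\<^sub>v ((?u \<triangleleft> lun f) \<triangleright> g) = (?u \<triangleleft> (lun f \<triangleright> g)) \<circ>\<^sub>v asc ?u (?u \<Zspot> f) g"
    using asc_lw_rw[of "lun f" ?u g] by simp
  also have "((?u \<triangleleft> (lun f \<triangleright> g)) \<circ>\<^sub>v asc ?u (?u \<Zspot> f) g) \<circ>\<^sub>v (asc ?u ?u f \<triangleright> g) = (?u \<triangleleft> (lun f \<triangleright> g)) \<circ>\<^sub>v ?P"
    by (simp add: vc_assoc)
  finally have E: "(?u \<triangleleft> (lun (f \<Zspot> g) \<circ>\<^sub>v asc ?u f g)) \<circ>\<^sub>v ?P = (?u \<triangleleft> (lun f \<triangleright> g)) \<circ>\<^sub>v ?P" .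
  \<comment> \<open>An explicit right inverse of \<open>?P\<close>, for cancelling it from
    \<open>E\<close>.\<close>
  have "?P \<circ>\<^sub>v ((asc' ?u ?u f \<triangleright> g) \<circ>\<^sub>v asc' ?u (?u \<Zspot> f) g)
      = asc ?u (?u \<Zspot> f) g \<circ>\<^sub>v (((asc ?u ?u f \<triangleright> g) \<circ>\<^sub>v (asc' ?u ?u f \<triangleright> g)) \<circ>\<^sub>v asc' ?u (?u \<Zspot> f) g)"
    by (simp add: vc_assoc)
  also have "\<dots> = ident (cod2 ?P)"
    by (simp add: asc_rw_iso vc_ident)
  finally show "?u \<triangleleft> (lun (f \<Zspot> g) \<circ>\<^sub>v asc ?u f g) = ?u \<triangleleft> (lun f \<triangleright> g)"
    by (rule vc_cancel_right[OF E]) simp_all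
qed simp_all

text \<open>The counterpart of \<open>Run_TenO\<close>. From it \<open>lun_Unit1\<close> follows as
  \<open>Lun_Unt\<close> did.\<close>

lemma run_HComp1:
  assumes [simp]: "f \<in> Cell1 \<B>" "g \<in> Cell1 \<B>" "Trg \<B> f = Src \<B> g"
  shows "(f \<triangleleft> run g) \<circ>\<^sub>v asc f g (Unit1 \<B> (Trg \<B> g)) = run (f \<Zspot> g)"
proof (rule Unit1_rw_cancel)
  let ?u = "Unit1 \<B> (Trg \<B> g)"
  have "asc f g ?u \<circ>\<^sub>v (((f \<triangleleft> run g) \<circ>\<^sub>v asc f g ?u) \<triangleright> ?u) = (asc f g ?u \<circ>\<^sub>v ((f \<triangleleft> run g) \<triangleright> ?u)) \<circ>\<^sub>v (asc f g ?u \<triangleright> ?u)"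
    by (simp add: rw_vc vc_assoc)
  also have "asc f g ?u \<circ>\<^sub>v ((f \<triangleleft> run g) \<triangleright> ?u) = (f \<triangleleft> (run g \<triangleright> ?u)) \<circ>\<^sub>v asc f (g \<Zspot> ?u) ?u"
    using asc_lw_rw[of "run g" f ?u] by simp
  also have "run g \<triangleright> ?u = (g \<triangleleft> lun ?u) \<circ>\<^sub>v asc g ?u ?u"
    using asc_triangle[of g ?u] by simp
  also have "((f \<triangleleft> ((g \<triangleleft> lun ?u) \<circ>\<^sub>v asc g ?u ?u)) \<circ>\<^sub>v asc f (g \<Zspot> ?u) ?u) \<circ>\<^sub>v (asc f g ?u \<triangleright> ?u)
     = (f \<triangleleft> g \<triangleleft> lun ?u) \<circ>\<^sub>v ((f \<triangleleft> asc g ?u ?u) \<circ>\<^sub>v (asc f (g \<Zspot> ?u) ?u \<circ>\<^sub>v (asc f g ?u \<triangleright> ?u)))"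
    by (simp add: lw_vc vc_assoc)
  also have "\<dots> = (f \<triangleleft> g \<triangleleft> lun ?u) \<circ>\<^sub>v (asc f g (?u \<Zspot> ?u) \<circ>\<^sub>v asc (f \<Zspot> g) ?u ?u)"
    by (simp add: asc_pentagon)
  also have "\<dots> = ((f \<triangleleft> g \<triangleleft> lun ?u) \<circ>\<^sub>v asc f g (?u \<Zspot> ?u)) \<circ>\<^sub>v asc (f \<Zspot> g) ?u ?u"
    by (simp add: vc_assoc)
  also have "(f \<triangleleft> g \<triangleleft> lun ?u) \<circ>\<^sub>v asc f g (?u \<Zspot> ?u) = asc f g ?u \<circ>\<^sub>v ((f \<Zspot> g) \<triangleleft> lun ?u)"
    using asc_lw_lw[of "lun ?u" f g] by simp
  also have "(asc f g ?u \<circ>\<^sub>v ((f \<Zspot> g) \<triangleleft> lun ?u)) \<circ>\<^sub>v asc (f \<Zspot> g) ?u ?u = asc f g ?u \<circ>\<^sub>v (((f \<Zspot> g) \<triangleleft> lun ?u) \<circ>\<^sub>v asc (f \<Zspot> g) ?u ?u)"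
    by (simp add: vc_assoc)
  also have "\<dots> = asc f g ?u \<circ>\<^sub>v (run (f \<Zspot> g) \<triangleright> ?u)"
    using asc_triangle[of "f \<Zspot> g" ?u] by simp
  finally show "((f \<triangleleft> run g) \<circ>\<^sub>v asc f g ?u) \<triangleright> ?u = run (f \<Zspot> g) \<triangleright> ?u"
    by (rule vc_cancel_left[where k' = "asc' f g ?u"]) simp_all
qed simp_all

lemma lun_Unit1:
  assumes [simp]: "a \<in> Cell0 \<B>"
  shows "lun (Unit1 \<B> a) = run (Unit1 \<B> a)"
proof (rule Unit1_lw_cancel)
  let ?u = "Unit1 \<B> a"
  have "(?u \<triangleleft> lun ?u) \<circ>\<^sub>v asc ?u ?u ?u = (?u \<triangleleft> run ?u) \<circ>\<^sub>v asc ?u ?u ?u"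
    using asc_triangle[of ?u ?u] run_HComp1[of ?u ?u] run_HComp1_Unit1[of ?u] by simp
  then show "?u \<triangleleft> lun ?u = ?u \<triangleleft> run ?u"
    by (rule vc_cancel_right[where k' = "asc' ?u ?u ?u"]) simp_all
qed simp_all

section \<open>The Morita context of a pair of 1-cells\<close>

text \<open>Composition with the constant k can be rewritten from \<open>\<circ>\<^sub>v\<close> to
  \<open>;\<^sub>v\<close>, and associativity of \<open>;\<^sub>v\<close> then moves k to its new
  place.\<close>

lemma vc_dc_const:
  assumes "cell c" "cell d" "cell k" "stage k = []"
  shows "\<lbrakk>dom2 d = cod2 c; dom2 k = cod2 d\<rbrakk> \<Longrightarrow> k \<circ>\<^sub>v (c ;\<^sub>v d) = c ;\<^sub>v (k \<circ>\<^sub>v d)"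
    "\<lbrakk>dom2 d = cod2 c; dom2 c = cod2 k\<rbrakk> \<Longrightarrow> (c ;\<^sub>v d) \<circ>\<^sub>v k = (c \<circ>\<^sub>v k) ;\<^sub>v d"
    "\<lbrakk>dom2 k = cod2 c; dom2 d = cod2 k\<rbrakk> \<Longrightarrow> c ;\<^sub>v (d \<circ>\<^sub>v k) = (k \<circ>\<^sub>v c) ;\<^sub>v d"
  using assms by (simp_all add: dc_const[symmetric] dc_assoc)

text \<open>The composite (q \<bullet> m) \<circ> (n \<bullet> q) with its constraints, written with
  \<open>;\<^sub>v\<close> so that the stages of n precede those of m.\<close>

definition tri where
  "tri p q n m = (run q \<circ>\<^sub>v ((n \<triangleright> q) ;\<^sub>v ((q \<triangleleft> m) \<circ>\<^sub>v asc q p q))) \<circ>\<^sub>v lun' q"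

text \<open>The composite (m \<bullet> p) \<circ> (p \<bullet> n) with its constraints; here
  \<open>\<circ>\<^sub>v\<close> itself puts the stages of m first.\<close>

definition btri where
  "btri p q m n = (lun p \<circ>\<^sub>v (((m \<triangleright> p) \<circ>\<^sub>v asc' p q p) \<circ>\<^sub>v (p \<triangleleft> n))) \<circ>\<^sub>v run' p"

lemma asc'_natural:
  assumes "asc f' g' h' \<circ>\<^sub>v c = d \<circ>\<^sub>v asc f g h" "cell c" "cell d"
    and "cod2 c = (f' \<Zspot> g') \<Zspot> h'" "dom2 c = (f \<Zspot> g) \<Zspot> h"
    and "cod2 d = f' \<Zspot> (g' \<Zspot> h')" "dom2 d = f \<Zspot> (g \<Zspot> h)"
    and [simp]: "f \<in> Cell1 \<B>" "g \<in> Cell1 \<B>" "h \<in> Cell1 \<B>" "Trg \<B> f = Src \<B> g" "Trg \<B> g = Src \<B> h"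
      "f' \<in> Cell1 \<B>" "g' \<in> Cell1 \<B>" "h' \<in> Cell1 \<B>" "Trg \<B> f' = Src \<B> g'" "Trg \<B> g' = Src \<B> h'"
  shows "c \<circ>\<^sub>v asc' f g h = asc' f' g' h' \<circ>\<^sub>v d"
proof -
  note [simp] = assms(2-7)
  have "c \<circ>\<^sub>v asc' f g h = (asc' f' g' h' \<circ>\<^sub>v asc f' g' h') \<circ>\<^sub>v (c \<circ>\<^sub>v asc' f g h)"
    by (simp add: vc_ident)
  \<comment> \<open>The inverse laws are withheld from the simplifier, since they would undo the
    identity inserted in the previous step.\<close>
  also have "\<dots> = asc' f' g' h' \<circ>\<^sub>v ((asc f' g' h' \<circ>\<^sub>v c) \<circ>\<^sub>v asc' f g h)"
    by (simp add: vc_assoc del: asc_iso(3,4))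
  also have "\<dots> = asc' f' g' h' \<circ>\<^sub>v (d \<circ>\<^sub>v (asc f g h \<circ>\<^sub>v asc' f g h))"
    unfolding assms(1) by (simp add: vc_assoc del: asc_iso(3,4))
  also have "\<dots> = asc' f' g' h' \<circ>\<^sub>v d"
    by (simp add: vc_ident)
  finally show ?thesis .
qed

lemma lun'_natural:
  assumes [simp]: "cell c" "Src \<B> (dom2 c) = a"
  shows "(Unit1 \<B> a \<triangleleft> c) \<circ>\<^sub>v lun' (dom2 c) = lun' (cod2 c) \<circ>\<^sub>v c"
proof (rule vc_cancel_left[of "lun (cod2 c)" _ _ "lun' (cod2 c)"])
  have [simp]: "a \<in> Cell0 \<B>" using Src_Trg_Cell0(1)[of "dom2 c"] by simp
  have "lun (cod2 c) \<circ>\<^sub>v ((Unit1 \<B> a \<triangleleft> c) \<circ>\<^sub>v lun' (dom2 c)) = (lun (cod2 c) \<circ>\<^sub>v (Unit1 \<B> a \<triangleleft> c)) \<circ>\<^sub>v lun' (dom2 c)"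
    by (simp add: vc_assoc)
  also have "\<dots> = c \<circ>\<^sub>v (lun (dom2 c) \<circ>\<^sub>v lun' (dom2 c))"
    using lun_lw[of c] by (simp add: vc_assoc del: lun_iso(3,4))
  also have "\<dots> = (lun (cod2 c) \<circ>\<^sub>v lun' (cod2 c)) \<circ>\<^sub>v c"
    by (simp add: vc_ident)
  also have "\<dots> = lun (cod2 c) \<circ>\<^sub>v (lun' (cod2 c) \<circ>\<^sub>v c)"
    by (simp add: vc_assoc del: lun_iso(3,4))
  finally show "lun (cod2 c) \<circ>\<^sub>v ((Unit1 \<B> a \<triangleleft> c) \<circ>\<^sub>v lun' (dom2 c)) = lun (cod2 c) \<circ>\<^sub>v (lun' (cod2 c) \<circ>\<^sub>v c)" .
qed (use Src_Trg_Cell0(1)[of "dom2 c"] in simp_all)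

lemma run'_natural:
  assumes [simp]: "cell c" "Trg \<B> (dom2 c) = a"
  shows "(c \<triangleright> Unit1 \<B> a) \<circ>\<^sub>v run' (dom2 c) = run' (cod2 c) \<circ>\<^sub>v c"
proof (rule vc_cancel_left[of "run (cod2 c)" _ _ "run' (cod2 c)"])
  have [simp]: "a \<in> Cell0 \<B>" using Src_Trg_Cell0(2)[of "dom2 c"] by simp
  have "run (cod2 c) \<circ>\<^sub>v ((c \<triangleright> Unit1 \<B> a) \<circ>\<^sub>v run' (dom2 c)) = (run (cod2 c) \<circ>\<^sub>v (c \<triangleright> Unit1 \<B> a)) \<circ>\<^sub>v run' (dom2 c)"
    by (simp add: vc_assoc)
  also have "\<dots> = c \<circ>\<^sub>v (run (dom2 c) \<circ>\<^sub>v run' (dom2 c))"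
    using run_rw[of c] by (simp add: vc_assoc del: run_iso(3,4))
  also have "\<dots> = (run (cod2 c) \<circ>\<^sub>v run' (cod2 c)) \<circ>\<^sub>v c"
    by (simp add: vc_ident)
  also have "\<dots> = run (cod2 c) \<circ>\<^sub>v (run' (cod2 c) \<circ>\<^sub>v c)"
    by (simp add: vc_assoc del: run_iso(3,4))
  finally show "run (cod2 c) \<circ>\<^sub>v ((c \<triangleright> Unit1 \<B> a) \<circ>\<^sub>v run' (dom2 c)) = run (cod2 c) \<circ>\<^sub>v (run' (cod2 c) \<circ>\<^sub>v c)" .
qed (use Src_Trg_Cell0(2)[of "dom2 c"] in simp_all)

lemma val_simps:
  "val (c \<circ>\<^sub>v d) = bil (VCmp \<B> (dom2 d) (cod2 d) (cod2 c)) (val c) (val d)"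
  "val (c ;\<^sub>v d) = bil (VCmp \<B> (dom2 c) (cod2 c) (cod2 d)
     \<cdot> swap V (Hom2 \<B> (dom2 c) (cod2 c)) (Hom2 \<B> (cod2 c) (cod2 d))) (val c) (val d)"
  "val (c \<triangleright> g) = app (rwhisker V \<B> (dom2 c) (cod2 c) g) (val c)"
  "val (g \<triangleleft> c) = app (lwhisker V \<B> g (dom2 c) (cod2 c)) (val c)"
  by (simp_all add: vc_def dc_def rw_def lw_def)

text \<open>Matches composition with a constraint to the \<open>precomp\<close> and
  \<open>postcomp\<close> that occur in \<open>triangle0\<close> and
  \<open>blacktriangle0\<close>.\<close>

lemma val_vc_cst:
  assumes "cell c" "cell (cst x y e)"
  shows "cod2 c = x \<Longrightarrow> val (cst x y e \<circ>\<^sub>v c) = app (postcomp V (HomCat \<B> a b) (dom2 c) x y e) (val c)"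
    "dom2 c = y \<Longrightarrow> val (c \<circ>\<^sub>v cst x y e) = app (precomp V (HomCat \<B> a b) x y (cod2 c) e) (val c)"
proof -
  have "e \<in> Arr V" "Dom V e = Unt V" "Cod V e = Hom2 \<B> x y"
    using cellD(5,6)[OF assms(2)] by (simp_all add: elem_def con_def obj_def)
  moreover have "x \<in> Cell1 \<B>" "y \<in> Cell1 \<B>" "Src \<B> y = Src \<B> x" "Trg \<B> y = Trg \<B> x"
    using cellD(1-4)[OF assms(2)] by simp_all
  ultimately show "cod2 c = x \<Longrightarrow> val (cst x y e \<circ>\<^sub>v c) = app (postcomp V (HomCat \<B> a b) (dom2 c) x y e) (val c)"
    "dom2 c = y \<Longrightarrow> val (c \<circ>\<^sub>v cst x y e) = app (precomp V (HomCat \<B> a b) x y (cod2 c) e) (val c)"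
    using assms(1) by (auto simp: val_simps bil_con_left bil_con_right precomp_def postcomp_def)
qed

section \<open>Linearity, balancedness and Morita equations of the two pairings\<close>

context
  fixes A B :: 'a and p q :: 'b
  assumes p_hom: "p \<in> hom1 \<B> A B" and q_hom: "q \<in> hom1 \<B> B A"
begin

private abbreviation "ua \<equiv> Unit1 \<B> A"
private abbreviation "ub \<equiv> Unit1 \<B> B"
private abbreviation "pq \<equiv> p \<Zspot> q"
private abbreviation "qp \<equiv> q \<Zspot> p"

private lemma pq_simps:
  "p \<in> Cell1 \<B>" "Src \<B> p = A" "Trg \<B> p = B" "q \<in> Cell1 \<B>" "Src \<B> q = B" "Trg \<B> q = A"
  "A \<in> Cell0 \<B>" "B \<in> Cell0 \<B>"
  using p_hom q_hom Src_in_Cell0[of p] Src_in_Cell0[of q] by (auto simp: hom1_iff)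

text \<open>Interchange of f with m carries f over m; naturality of \<open>run\<close> then brings
  it to the outside.\<close>

lemma tri_left_linear:
  assumes [simp]: "cell n" "dom2 n = ub" "cod2 n = qp" "cell m" "dom2 m = pq" "cod2 m = ua"
    "cell f" "dom2 f = q" "cod2 f = q"
  shows "tri p q ((f \<triangleright> p) \<circ>\<^sub>v n) m = f \<circ>\<^sub>v tri p q n m"
proof -
  note [simp] = pq_simps
  let ?g = "(q \<triangleleft> m) \<circ>\<^sub>v asc q p q"
  have "(f \<triangleright> ua) \<circ>\<^sub>v ?g = ((f \<triangleright> ua) \<circ>\<^sub>v (q \<triangleleft> m)) \<circ>\<^sub>v asc q p q"
    by (simp add: vc_assoc)
  also have "\<dots> = ((f \<triangleright> pq) ;\<^sub>v (q \<triangleleft> m)) \<circ>\<^sub>v asc q p q"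
    using rw_vc_lw[of f m] rw_dc_lw[of f m] by simp
  also have "\<dots> = ((f \<triangleright> pq) \<circ>\<^sub>v asc q p q) ;\<^sub>v (q \<triangleleft> m)"
    by (simp add: vc_dc_const)
  also have "\<dots> = (asc q p q \<circ>\<^sub>v (f \<triangleright> p \<triangleright> q)) ;\<^sub>v (q \<triangleleft> m)"
    using asc_rw_rw[of f p q] by simp
  also have "\<dots> = (f \<triangleright> p \<triangleright> q) ;\<^sub>v ?g"
    by (simp add: vc_dc_const(3))
  finally have E: "(f \<triangleright> ua) \<circ>\<^sub>v ?g = (f \<triangleright> p \<triangleright> q) ;\<^sub>v ?g" .
  have "((f \<triangleright> p) \<circ>\<^sub>v n) \<triangleright> q = (f \<triangleright> p \<triangleright> q) \<circ>\<^sub>v (n \<triangleright> q)"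
    by (simp add: rw_vc)
  \<comment> \<open>Mixed associativity along the square \<open>E\<close>, with the cell
    \<open>n \<triangleright> q\<close> on its inner side.\<close>
  also have "\<dots> ;\<^sub>v ?g = (f \<triangleright> ua) \<circ>\<^sub>v ((n \<triangleright> q) ;\<^sub>v ?g)"
    by (rule vc_dc_assoc[OF _ _ _ _ _ _ _ _ _ _ _ E]) simp_all
  finally have "tri p q ((f \<triangleright> p) \<circ>\<^sub>v n) m = (run q \<circ>\<^sub>v (f \<triangleright> ua)) \<circ>\<^sub>v (((n \<triangleright> q) ;\<^sub>v ?g) \<circ>\<^sub>v lun' q)"
    by (simp add: tri_def vc_assoc)
  also have "run q \<circ>\<^sub>v (f \<triangleright> ua) = f \<circ>\<^sub>v run q"
    using run_rw[of f] by simp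
  finally show ?thesis by (simp add: tri_def vc_assoc)
qed

text \<open>Interchange of f with n carries f to the other end, where naturality of
  \<open>lun'\<close> releases it.\<close>

lemma tri_right_linear:
  assumes [simp]: "cell n" "dom2 n = ub" "cod2 n = qp" "cell m" "dom2 m = pq" "cod2 m = ua"
    "cell f" "dom2 f = q" "cod2 f = q"
  shows "tri p q n (m \<circ>\<^sub>v (p \<triangleleft> f)) = tri p q n m \<circ>\<^sub>v f"
proof -
  note [simp] = pq_simps
  let ?g = "(q \<triangleleft> m) \<circ>\<^sub>v asc q p q"
  have "(q \<triangleleft> (m \<circ>\<^sub>v (p \<triangleleft> f))) \<circ>\<^sub>v asc q p q = (q \<triangleleft> m) \<circ>\<^sub>v ((q \<triangleleft> p \<triangleleft> f) \<circ>\<^sub>v asc q p q)"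
    by (simp add: lw_vc vc_assoc)
  also have "\<dots> = ?g \<circ>\<^sub>v (qp \<triangleleft> f)"
    using asc_lw_lw[of f q p] by (simp add: vc_assoc)
  finally have 1: "(q \<triangleleft> (m \<circ>\<^sub>v (p \<triangleleft> f))) \<circ>\<^sub>v asc q p q = ?g \<circ>\<^sub>v (qp \<triangleleft> f)" .
  have "(n \<triangleright> q) \<circ>\<^sub>v (ub \<triangleleft> f) = (n \<triangleright> q) ;\<^sub>v (qp \<triangleleft> f)"
    using rw_vc_lw[of n f] rw_dc_lw[of n f] by simp
  from dc_vc_assoc[OF _ _ _ _ _ _ _ _ _ _ _ this, of ?g]
  have "(n \<triangleright> q) ;\<^sub>v (?g \<circ>\<^sub>v (qp \<triangleleft> f)) = ((n \<triangleright> q) ;\<^sub>v ?g) \<circ>\<^sub>v (ub \<triangleleft> f)"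
    by simp
  then have "tri p q n (m \<circ>\<^sub>v (p \<triangleleft> f)) = run q \<circ>\<^sub>v (((n \<triangleright> q) ;\<^sub>v ?g) \<circ>\<^sub>v ((ub \<triangleleft> f) \<circ>\<^sub>v lun' q))"
    unfolding tri_def 1 by (simp add: vc_assoc)
  also have "(ub \<triangleleft> f) \<circ>\<^sub>v lun' q = lun' q \<circ>\<^sub>v f"
    using lun'_natural[of f B] by simp
  finally show ?thesis by (simp add: tri_def vc_assoc)
qed

text \<open>Both sides contain g between two copies of q, in the two possible bracketings;
  naturality of \<open>asc\<close> in its middle argument identifies them.\<close>

lemma tri_balanced:
  assumes [simp]: "cell n" "dom2 n = ub" "cod2 n = qp" "cell m" "dom2 m = pq" "cod2 m = ua"
    "cell g" "dom2 g = p" "cod2 g = p"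
  shows "tri p q (n ;\<^sub>v (q \<triangleleft> g)) m = tri p q n ((g \<triangleright> q) ;\<^sub>v m)"
proof -
  note [simp] = pq_simps
  have "(q \<triangleleft> ((g \<triangleright> q) ;\<^sub>v m)) \<circ>\<^sub>v asc q p q = ((q \<triangleleft> (g \<triangleright> q)) \<circ>\<^sub>v asc q p q) ;\<^sub>v (q \<triangleleft> m)"
    by (simp add: lw_dc vc_dc_const(2))
  also have "\<dots> = (asc q p q \<circ>\<^sub>v ((q \<triangleleft> g) \<triangleright> q)) ;\<^sub>v (q \<triangleleft> m)"
    using asc_lw_rw[of g q q] by simp
  also have "\<dots> = ((q \<triangleleft> g) \<triangleright> q) ;\<^sub>v ((q \<triangleleft> m) \<circ>\<^sub>v asc q p q)"
    by (simp add: vc_dc_const(3))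
  finally show ?thesis by (simp add: tri_def rw_dc dc_assoc)
qed

text \<open>Interchange of g with n, followed by naturality of \<open>run'\<close>.\<close>

lemma btri_left_linear:
  assumes [simp]: "cell n" "dom2 n = ub" "cod2 n = qp" "cell m" "dom2 m = pq" "cod2 m = ua"
    "cell g" "dom2 g = p" "cod2 g = p"
  shows "btri p q ((g \<triangleright> q) ;\<^sub>v m) n = g ;\<^sub>v btri p q m n"
proof -
  note [simp] = pq_simps
  let ?m = "(m \<triangleright> p) \<circ>\<^sub>v asc' p q p"
  have a: "(g \<triangleright> q \<triangleright> p) \<circ>\<^sub>v asc' p q p = asc' p q p \<circ>\<^sub>v (g \<triangleright> qp)"
    by (rule asc'_natural) (use asc_rw_rw[of g q p] in simp_all)
  have "(((g \<triangleright> q) ;\<^sub>v m) \<triangleright> p) \<circ>\<^sub>v asc' p q p = ((g \<triangleright> q \<triangleright> p) \<circ>\<^sub>v asc' p q p) ;\<^sub>v (m \<triangleright> p)"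
    by (simp add: rw_dc vc_dc_const(2))
  also have "\<dots> = (g \<triangleright> qp) ;\<^sub>v ?m"
    unfolding a by (simp add: vc_dc_const(3))
  finally have 1: "(((g \<triangleright> q) ;\<^sub>v m) \<triangleright> p) \<circ>\<^sub>v asc' p q p = (g \<triangleright> qp) ;\<^sub>v ?m" .
  have "(g \<triangleright> qp) \<circ>\<^sub>v (p \<triangleleft> n) = (g \<triangleright> ub) ;\<^sub>v (p \<triangleleft> n)"
    using rw_vc_lw[of g n] rw_dc_lw[of g n] by simp
  from dc_vc_assoc[OF _ _ _ _ _ _ _ _ _ _ _ this, of ?m]
  have "((g \<triangleright> qp) ;\<^sub>v ?m) \<circ>\<^sub>v (p \<triangleleft> n) = (g \<triangleright> ub) ;\<^sub>v (?m \<circ>\<^sub>v (p \<triangleleft> n))"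
    by simp
  then have "btri p q ((g \<triangleright> q) ;\<^sub>v m) n = ((g \<triangleright> ub) \<circ>\<^sub>v run' p) ;\<^sub>v (lun p \<circ>\<^sub>v (?m \<circ>\<^sub>v (p \<triangleleft> n)))"
    unfolding btri_def 1 by (simp add: vc_dc_const(1,2))
  also have "(g \<triangleright> ub) \<circ>\<^sub>v run' p = run' p \<circ>\<^sub>v g"
    using run'_natural[of g B] by simp
  also have "(run' p \<circ>\<^sub>v g) ;\<^sub>v (lun p \<circ>\<^sub>v (?m \<circ>\<^sub>v (p \<triangleleft> n))) = g ;\<^sub>v btri p q m n"
    unfolding btri_def by (rule vc_dc_const(3)[symmetric]) simp_all
  finally show ?thesis .
qed

text \<open>Interchange of g with m, followed by naturality of \<open>lun\<close>.\<close>

lemma btri_right_linear: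
  assumes [simp]: "cell n" "dom2 n = ub" "cod2 n = qp" "cell m" "dom2 m = pq" "cod2 m = ua"
    "cell g" "dom2 g = p" "cod2 g = p"
  shows "btri p q m (n ;\<^sub>v (q \<triangleleft> g)) = btri p q m n ;\<^sub>v g"
proof -
  note [simp] = pq_simps
  let ?m = "(m \<triangleright> p) \<circ>\<^sub>v asc' p q p"
  have a: "(pq \<triangleleft> g) \<circ>\<^sub>v asc' p q p = asc' p q p \<circ>\<^sub>v (p \<triangleleft> q \<triangleleft> g)"
    by (rule asc'_natural) (use asc_lw_lw[of g p q] in simp_all)
  have "?m \<circ>\<^sub>v (p \<triangleleft> q \<triangleleft> g) = (m \<triangleright> p) \<circ>\<^sub>v ((pq \<triangleleft> g) \<circ>\<^sub>v asc' p q p)"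
    unfolding a by (simp add: vc_assoc)
  also have "\<dots> = ((m \<triangleright> p) \<circ>\<^sub>v (pq \<triangleleft> g)) \<circ>\<^sub>v asc' p q p"
    by (simp add: vc_assoc)
  also have "\<dots> = ((m \<triangleright> p) ;\<^sub>v (ua \<triangleleft> g)) \<circ>\<^sub>v asc' p q p"
    using rw_vc_lw[of m g] rw_dc_lw[of m g] by simp
  also have "\<dots> = ?m ;\<^sub>v (ua \<triangleleft> g)"
    by (simp add: vc_dc_const(2))
  finally have E: "?m \<circ>\<^sub>v (p \<triangleleft> q \<triangleleft> g) = ?m ;\<^sub>v (ua \<triangleleft> g)" .
  let ?Z = "?m \<circ>\<^sub>v (p \<triangleleft> n)"
  have "?m \<circ>\<^sub>v (p \<triangleleft> (n ;\<^sub>v (q \<triangleleft> g))) = ?m \<circ>\<^sub>v ((p \<triangleleft> n) ;\<^sub>v (p \<triangleleft> q \<triangleleft> g))"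
    by (simp add: lw_dc)
  also have "\<dots> = ?Z ;\<^sub>v (ua \<triangleleft> g)"
    by (rule vc_dc_assoc[symmetric, OF _ _ _ _ _ _ _ _ _ _ _ E]) simp_all
  finally have "lun p \<circ>\<^sub>v (?m \<circ>\<^sub>v (p \<triangleleft> (n ;\<^sub>v (q \<triangleleft> g)))) = ?Z ;\<^sub>v (lun p \<circ>\<^sub>v (ua \<triangleleft> g))"
    by (simp add: vc_dc_const(1))
  also have "lun p \<circ>\<^sub>v (ua \<triangleleft> g) = g \<circ>\<^sub>v lun p"
    using lun_lw[of g] by simp
  also have "?Z ;\<^sub>v (g \<circ>\<^sub>v lun p) = (lun p \<circ>\<^sub>v ?Z) ;\<^sub>v g"
    by (rule vc_dc_const(3)) simp_all
  finally have "lun p \<circ>\<^sub>v (?m \<circ>\<^sub>v (p \<triangleleft> (n ;\<^sub>v (q \<triangleleft> g)))) = (lun p \<circ>\<^sub>v ?Z) ;\<^sub>v g" .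
  then show ?thesis unfolding btri_def by (simp add: vc_dc_const(2))
qed

text \<open>As for \<open>tri\<close>, with naturality of \<open>asc'\<close> in its middle
  argument.\<close>

lemma btri_balanced:
  assumes [simp]: "cell n" "dom2 n = ub" "cod2 n = qp" "cell m" "dom2 m = pq" "cod2 m = ua"
    "cell f" "dom2 f = q" "cod2 f = q"
  shows "btri p q (m \<circ>\<^sub>v (p \<triangleleft> f)) n = btri p q m ((f \<triangleright> p) \<circ>\<^sub>v n)"
proof -
  note [simp] = pq_simps
  have a: "((p \<triangleleft> f) \<triangleright> p) \<circ>\<^sub>v asc' p q p = asc' p q p \<circ>\<^sub>v (p \<triangleleft> (f \<triangleright> p))"
    by (rule asc'_natural) (use asc_lw_rw[of f p p] in simp_all)
  have "((m \<circ>\<^sub>v (p \<triangleleft> f)) \<triangleright> p) \<circ>\<^sub>v asc' p q p = ((m \<triangleright> p) \<circ>\<^sub>v asc' p q p) \<circ>\<^sub>v (p \<triangleleft> (f \<triangleright> p))"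
    using a by (simp add: rw_vc vc_assoc)
  then show ?thesis by (simp add: btri_def lw_vc vc_assoc)
qed

text \<open>Both sides are \<open>(q \<bullet> m \<bullet> p) \<circ> (n \<bullet> n')\<close> up to constraints.\<close>

lemma act_btri:
  assumes [simp]: "cell n" "dom2 n = ub" "cod2 n = qp" "cell m" "dom2 m = pq" "cod2 m = ua"
    "cell n'" "dom2 n' = ub" "cod2 n' = qp"
  shows "n ;\<^sub>v (q \<triangleleft> btri p q m n') = (tri p q n m \<triangleright> p) \<circ>\<^sub>v n'"
proof -
  note [simp] = pq_simps
  let ?Z = "(q \<triangleleft> (m \<triangleright> p)) \<circ>\<^sub>v ((q \<triangleleft> asc' p q p) \<circ>\<^sub>v asc q p qp)"
  let ?U = "?Z \<circ>\<^sub>v (qp \<triangleleft> n')"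
  \<comment> \<open>The common value of both sides: first n whiskered by the unit, then n', then
    m.\<close>
  let ?K = "((q \<triangleleft> lun p) \<circ>\<^sub>v ((n \<triangleright> ub) ;\<^sub>v ?U)) \<circ>\<^sub>v run' ub"
  \<comment> \<open>This transfers \<open>run' p\<close> from \<open>btri\<close> to the composite
    of q and p; \<open>l\<close> does the same for \<open>lun' q\<close> from
    \<open>tri\<close>.\<close>
  have r: "q \<triangleleft> run' p = asc q p ub \<circ>\<^sub>v run' qp"
  proof (rule vc_cancel_left[of "q \<triangleleft> run p" _ _ "q \<triangleleft> run' p"])
    have "(q \<triangleleft> run p) \<circ>\<^sub>v (asc q p ub \<circ>\<^sub>v run' qp) = ((q \<triangleleft> run p) \<circ>\<^sub>v asc q p ub) \<circ>\<^sub>v run' qp"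
      by (simp add: vc_assoc)
    also have "\<dots> = run qp \<circ>\<^sub>v run' qp" using run_HComp1[of q p] by simp
    finally show "(q \<triangleleft> run p) \<circ>\<^sub>v (q \<triangleleft> run' p) = (q \<triangleleft> run p) \<circ>\<^sub>v (asc q p ub \<circ>\<^sub>v run' qp)"
      by (simp add: lw_vc[symmetric] lw_ident)
    show "(q \<triangleleft> run' p) \<circ>\<^sub>v (q \<triangleleft> run p) = ident (dom2 (q \<triangleleft> run p))"
      by (simp add: lw_vc[symmetric] lw_ident)
  qed simp_all
  have l: "asc ub q p \<circ>\<^sub>v (lun' q \<triangleright> p) = lun' qp"
  proof (rule vc_cancel_left[of "lun qp" _ _ "lun' qp"])
    have "lun qp \<circ>\<^sub>v (asc ub q p \<circ>\<^sub>v (lun' q \<triangleright> p)) = (lun qp \<circ>\<^sub>v asc ub q p) \<circ>\<^sub>v (lun' q \<triangleright> p)"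
      by (simp add: vc_assoc)
    also have "\<dots> = (lun q \<triangleright> p) \<circ>\<^sub>v (lun' q \<triangleright> p)" using lun_HComp1[of q p] by simp
    finally show "lun qp \<circ>\<^sub>v (asc ub q p \<circ>\<^sub>v (lun' q \<triangleright> p)) = lun qp \<circ>\<^sub>v lun' qp"
      by (simp add: rw_vc[symmetric] rw_ident)
  qed simp_all
  \<comment> \<open>After naturality one side leaves a \<open>run'\<close> of the unit 1-cell and
    the other a \<open>lun'\<close>; these coincide.\<close>
  have "lun ub = run ub" by (rule lun_Unit1) simp
  then have u: "lun' ub = run' ub"
    by (simp add: lun_def run_def lun'_def run'_def cst_def con_def)
  have U: "?U = (q \<triangleleft> (m \<triangleright> p)) \<circ>\<^sub>v ((q \<triangleleft> asc' p q p) \<circ>\<^sub>v ((q \<triangleleft> p \<triangleleft> n') \<circ>\<^sub>v asc q p ub))"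
    using asc_lw_lw[of n' q p] by (simp add: vc_assoc)
  have "q \<triangleleft> btri p q m n' = ((q \<triangleleft> lun p) \<circ>\<^sub>v ?U) \<circ>\<^sub>v run' qp"
    unfolding U by (simp add: btri_def lw_vc r vc_assoc)
  then have "n ;\<^sub>v (q \<triangleleft> btri p q m n') = (run' qp \<circ>\<^sub>v n) ;\<^sub>v ((q \<triangleleft> lun p) \<circ>\<^sub>v ?U)"
    by (simp add: vc_dc_const(3))
  also have "run' qp \<circ>\<^sub>v n = (n \<triangleright> ub) \<circ>\<^sub>v run' ub"
    using run'_natural[of n B] by simp
  also have "((n \<triangleright> ub) \<circ>\<^sub>v run' ub) ;\<^sub>v ((q \<triangleleft> lun p) \<circ>\<^sub>v ?U) = ?K"
    by (simp add: vc_dc_const(1,2))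
  finally have L: "n ;\<^sub>v (q \<triangleleft> btri p q m n') = ?K" .

  let ?X = "n \<triangleright> q \<triangleright> p" and ?Y = "((q \<triangleleft> m) \<triangleright> p) \<circ>\<^sub>v (asc q p q \<triangleright> p)"
  have X: "?X \<circ>\<^sub>v asc' ub q p = asc' qp q p \<circ>\<^sub>v (n \<triangleright> qp)"
    by (rule asc'_natural) (use asc_rw_rw[of n q p] in simp_all)
  have "?X = (?X \<circ>\<^sub>v asc' ub q p) \<circ>\<^sub>v asc ub q p"
    by (subst vc_assoc) (simp_all add: vc_ident)
  then have X': "?X = (asc' qp q p \<circ>\<^sub>v (n \<triangleright> qp)) \<circ>\<^sub>v asc ub q p"
    unfolding X .
  \<comment> \<open>A mixed form of the pentagon, needed because \<open>btri\<close> contains the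
    inverse associator and \<open>tri\<close> the associator itself.\<close>
  have pent: "asc q pq p \<circ>\<^sub>v ((asc q p q \<triangleright> p) \<circ>\<^sub>v asc' qp q p) = (q \<triangleleft> asc' p q p) \<circ>\<^sub>v asc q p qp"
  proof (rule vc_cancel_left[of "q \<triangleleft> asc p q p" _ _ "q \<triangleleft> asc' p q p"])
    have "(q \<triangleleft> asc p q p) \<circ>\<^sub>v (asc q pq p \<circ>\<^sub>v ((asc q p q \<triangleright> p) \<circ>\<^sub>v asc' qp q p))
       = ((q \<triangleleft> asc p q p) \<circ>\<^sub>v (asc q pq p \<circ>\<^sub>v (asc q p q \<triangleright> p))) \<circ>\<^sub>v asc' qp q p"
      by (simp add: vc_assoc)
    also have "\<dots> = (asc q p qp \<circ>\<^sub>v asc qp q p) \<circ>\<^sub>v asc' qp q p"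
      by (simp add: asc_pentagon)
    also have "\<dots> = asc q p qp"
      by (subst vc_assoc) (simp_all add: vc_ident)
    also have "\<dots> = (q \<triangleleft> asc p q p) \<circ>\<^sub>v ((q \<triangleleft> asc' p q p) \<circ>\<^sub>v asc q p qp)"
      by (simp add: vc_assoc[symmetric] asc_lw_iso vc_ident)
    finally show "(q \<triangleleft> asc p q p) \<circ>\<^sub>v (asc q pq p \<circ>\<^sub>v ((asc q p q \<triangleright> p) \<circ>\<^sub>v asc' qp q p))
       = (q \<triangleleft> asc p q p) \<circ>\<^sub>v ((q \<triangleleft> asc' p q p) \<circ>\<^sub>v asc q p qp)" .
  qed (simp_all add: asc_lw_iso)
  have "(asc q ua p \<circ>\<^sub>v ?Y) \<circ>\<^sub>v asc' qp q p = ((asc q ua p \<circ>\<^sub>v ((q \<triangleleft> m) \<triangleright> p)) \<circ>\<^sub>v (asc q p q \<triangleright> p)) \<circ>\<^sub>v asc' qp q p"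
    by (simp add: vc_assoc)
  also have "asc q ua p \<circ>\<^sub>v ((q \<triangleleft> m) \<triangleright> p) = (q \<triangleleft> (m \<triangleright> p)) \<circ>\<^sub>v asc q pq p"
    using asc_lw_rw[of m q p] by simp
  also have "(((q \<triangleleft> (m \<triangleright> p)) \<circ>\<^sub>v asc q pq p) \<circ>\<^sub>v (asc q p q \<triangleright> p)) \<circ>\<^sub>v asc' qp q p = ?Z"
    using pent by (simp add: vc_assoc)
  finally have Y: "(asc q ua p \<circ>\<^sub>v ?Y) \<circ>\<^sub>v asc' qp q p = ?Z" .
  \<comment> \<open>The constraints are constants, so they can be passed from the left factor of
    \<open>;\<^sub>v\<close> to the right one and be collected in \<open>?Z\<close>.\<close>
  have "asc q ua p \<circ>\<^sub>v (?X ;\<^sub>v ?Y) = ?X ;\<^sub>v (asc q ua p \<circ>\<^sub>v ?Y)"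
    by (simp add: vc_dc_const(1))
  also have "\<dots> = ((asc' qp q p \<circ>\<^sub>v (n \<triangleright> qp)) ;\<^sub>v (asc q ua p \<circ>\<^sub>v ?Y)) \<circ>\<^sub>v asc ub q p"
    unfolding X' by (rule vc_dc_const(2)[symmetric]) simp_all
  also have "(asc' qp q p \<circ>\<^sub>v (n \<triangleright> qp)) ;\<^sub>v (asc q ua p \<circ>\<^sub>v ?Y) = (n \<triangleright> qp) ;\<^sub>v ?Z"
    unfolding Y[symmetric] by (rule vc_dc_const(3)[symmetric]) simp_all
  finally have XY: "asc q ua p \<circ>\<^sub>v (?X ;\<^sub>v ?Y) = ((n \<triangleright> qp) ;\<^sub>v ?Z) \<circ>\<^sub>v asc ub q p" .
  \<comment> \<open>Interchange of the two elements n and n' of N, the square for the mixed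
    associativity at the end.\<close>
  have E: "(n \<triangleright> qp) \<circ>\<^sub>v (ub \<triangleleft> n') = (n \<triangleright> ub) ;\<^sub>v (qp \<triangleleft> n')"
    using rw_vc_lw[of n n'] rw_dc_lw[of n n'] by simp
  have "(tri p q n m \<triangleright> p) \<circ>\<^sub>v n' = (run q \<triangleright> p) \<circ>\<^sub>v ((?X ;\<^sub>v ?Y) \<circ>\<^sub>v ((lun' q \<triangleright> p) \<circ>\<^sub>v n'))"
    by (simp add: tri_def rw_vc rw_dc vc_assoc)
  also have "run q \<triangleright> p = (q \<triangleleft> lun p) \<circ>\<^sub>v asc q ua p"
    using asc_triangle[of q p] by simp
  also have "((q \<triangleleft> lun p) \<circ>\<^sub>v asc q ua p) \<circ>\<^sub>v ((?X ;\<^sub>v ?Y) \<circ>\<^sub>v ((lun' q \<triangleright> p) \<circ>\<^sub>v n'))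
    = (q \<triangleleft> lun p) \<circ>\<^sub>v ((asc q ua p \<circ>\<^sub>v (?X ;\<^sub>v ?Y)) \<circ>\<^sub>v ((lun' q \<triangleright> p) \<circ>\<^sub>v n'))"
    by (simp add: vc_assoc)
  also have "\<dots> = (q \<triangleleft> lun p) \<circ>\<^sub>v (((n \<triangleright> qp) ;\<^sub>v ?Z) \<circ>\<^sub>v ((asc ub q p \<circ>\<^sub>v (lun' q \<triangleright> p)) \<circ>\<^sub>v n'))"
    unfolding XY by (simp add: vc_assoc)
  also have "(asc ub q p \<circ>\<^sub>v (lun' q \<triangleright> p)) \<circ>\<^sub>v n' = (ub \<triangleleft> n') \<circ>\<^sub>v run' ub"
    unfolding l u[symmetric] using lun'_natural[of n' B] by simp
  also have "(q \<triangleleft> lun p) \<circ>\<^sub>v (((n \<triangleright> qp) ;\<^sub>v ?Z) \<circ>\<^sub>v ((ub \<triangleleft> n') \<circ>\<^sub>v run' ub))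
     = ((q \<triangleleft> lun p) \<circ>\<^sub>v (((n \<triangleright> qp) ;\<^sub>v ?Z) \<circ>\<^sub>v (ub \<triangleleft> n'))) \<circ>\<^sub>v run' ub"
    by (simp add: vc_assoc)
  also have "((n \<triangleright> qp) ;\<^sub>v ?Z) \<circ>\<^sub>v (ub \<triangleleft> n') = (n \<triangleright> ub) ;\<^sub>v ?U"
    by (rule dc_vc_assoc[OF _ _ _ _ _ _ _ _ _ _ _ E]) simp_all
  finally show ?thesis using L by simp
qed

text \<open>Both sides are \<open>(m \<bullet> m') \<circ> (p \<bullet> n \<bullet> q)\<close> up to constraints.\<close>

lemma act_tri:
  assumes [simp]: "cell n" "dom2 n = ub" "cod2 n = qp" "cell m" "dom2 m = pq" "cod2 m = ua"
    "cell m'" "dom2 m' = pq" "cod2 m' = ua"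
  shows "m \<circ>\<^sub>v (p \<triangleleft> tri p q n m') = (btri p q m n \<triangleright> q) ;\<^sub>v m'"
proof -
  note [simp] = pq_simps
  let ?X = "p \<triangleleft> (n \<triangleright> q)" and ?X' = "(p \<triangleleft> n) \<triangleright> q" and ?Y = "(p \<triangleleft> q \<triangleleft> m') \<circ>\<^sub>v (p \<triangleleft> asc q p q)"
  let ?D = "asc pq p q \<circ>\<^sub>v (asc' p q p \<triangleright> q)"
  let ?G = "((m \<triangleright> pq) \<circ>\<^sub>v ?D) \<circ>\<^sub>v ?X'"
  \<comment> \<open>The common value of both sides: first n, then m, then m'.\<close>
  let ?K = "(run ua \<circ>\<^sub>v (?G ;\<^sub>v (ua \<triangleleft> m'))) \<circ>\<^sub>v (run' p \<triangleright> q)"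
  \<comment> \<open>The unit arises in the middle here, so the triangle compares
    \<open>lun' q\<close> from \<open>tri\<close> with \<open>run' p\<close> from
    \<open>btri\<close>.\<close>
  have l: "p \<triangleleft> lun' q = asc p ub q \<circ>\<^sub>v (run' p \<triangleright> q)"
  proof (rule vc_cancel_left[of "p \<triangleleft> lun q" _ _ "p \<triangleleft> lun' q"])
    have "(p \<triangleleft> lun q) \<circ>\<^sub>v (asc p ub q \<circ>\<^sub>v (run' p \<triangleright> q)) = ((p \<triangleleft> lun q) \<circ>\<^sub>v asc p ub q) \<circ>\<^sub>v (run' p \<triangleright> q)"
      by (simp add: vc_assoc)
    also have "\<dots> = (run p \<triangleright> q) \<circ>\<^sub>v (run' p \<triangleright> q)" using asc_triangle[of p q] by simp
    also have "\<dots> = ident pq" by (simp add: rw_vc[symmetric] rw_ident)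
    finally show "(p \<triangleleft> lun q) \<circ>\<^sub>v (p \<triangleleft> lun' q) = (p \<triangleleft> lun q) \<circ>\<^sub>v (asc p ub q \<circ>\<^sub>v (run' p \<triangleright> q))"
      by (simp add: lw_vc[symmetric] lw_ident)
    show "(p \<triangleleft> lun' q) \<circ>\<^sub>v (p \<triangleleft> lun q) = ident (dom2 (p \<triangleleft> lun q))"
      by (simp add: lw_vc[symmetric] lw_ident)
  qed simp_all
  have pent: "asc' p q pq \<circ>\<^sub>v ((p \<triangleleft> asc q p q) \<circ>\<^sub>v asc p qp q) = ?D"
  proof -
    have "?D = (asc' p q pq \<circ>\<^sub>v asc p q pq) \<circ>\<^sub>v ?D" by (simp add: vc_ident)
    also have "\<dots> = asc' p q pq \<circ>\<^sub>v ((asc p q pq \<circ>\<^sub>v asc pq p q) \<circ>\<^sub>v (asc' p q p \<triangleright> q))"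
      by (simp add: vc_assoc del: asc_iso(3,4))
    also have "asc p q pq \<circ>\<^sub>v asc pq p q = (p \<triangleleft> asc q p q) \<circ>\<^sub>v (asc p qp q \<circ>\<^sub>v (asc p q p \<triangleright> q))"
      by (simp add: asc_pentagon)
    also have "asc' p q pq \<circ>\<^sub>v (((p \<triangleleft> asc q p q) \<circ>\<^sub>v (asc p qp q \<circ>\<^sub>v (asc p q p \<triangleright> q))) \<circ>\<^sub>v (asc' p q p \<triangleright> q))
       = asc' p q pq \<circ>\<^sub>v ((p \<triangleleft> asc q p q) \<circ>\<^sub>v (asc p qp q \<circ>\<^sub>v ((asc p q p \<triangleright> q) \<circ>\<^sub>v (asc' p q p \<triangleright> q))))"
      by (simp add: vc_assoc)
    also have "\<dots> = asc' p q pq \<circ>\<^sub>v ((p \<triangleleft> asc q p q) \<circ>\<^sub>v asc p qp q)"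
      by (simp add: asc_rw_iso vc_ident)
    finally show ?thesis by simp
  qed
  have b: "(pq \<triangleleft> m') \<circ>\<^sub>v asc' p q pq = asc' p q ua \<circ>\<^sub>v (p \<triangleleft> q \<triangleleft> m')"
    by (rule asc'_natural) (use asc_lw_lw[of m' p q] in simp_all)
  have r: "p \<triangleleft> run q = run pq \<circ>\<^sub>v asc' p q ua"
  proof -
    have "run pq \<circ>\<^sub>v asc' p q ua = ((p \<triangleleft> run q) \<circ>\<^sub>v asc p q ua) \<circ>\<^sub>v asc' p q ua"
      using run_HComp1[of p q] by simp
    also have "\<dots> = p \<triangleleft> run q" by (subst vc_assoc) (simp_all add: vc_ident)
    finally show ?thesis by simp
  qed
  have "asc' p q ua \<circ>\<^sub>v (?X ;\<^sub>v ?Y) = ?X ;\<^sub>v (asc' p q ua \<circ>\<^sub>v ?Y)"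
    by (simp add: vc_dc_const(1))
  also have "asc' p q ua \<circ>\<^sub>v ?Y = ((pq \<triangleleft> m') \<circ>\<^sub>v asc' p q pq) \<circ>\<^sub>v (p \<triangleleft> asc q p q)"
    unfolding b by (simp add: vc_assoc)
  finally have "(asc' p q ua \<circ>\<^sub>v (?X ;\<^sub>v ?Y)) \<circ>\<^sub>v asc p ub q
     = (?X \<circ>\<^sub>v asc p ub q) ;\<^sub>v (((pq \<triangleleft> m') \<circ>\<^sub>v asc' p q pq) \<circ>\<^sub>v (p \<triangleleft> asc q p q))"
    by (simp add: vc_dc_const(2))
  also have "?X \<circ>\<^sub>v asc p ub q = asc p qp q \<circ>\<^sub>v ?X'"
    using asc_lw_rw[of n p q] by simp
  also have "(asc p qp q \<circ>\<^sub>v ?X') ;\<^sub>v (((pq \<triangleleft> m') \<circ>\<^sub>v asc' p q pq) \<circ>\<^sub>v (p \<triangleleft> asc q p q))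
     = ?X' ;\<^sub>v ((((pq \<triangleleft> m') \<circ>\<^sub>v asc' p q pq) \<circ>\<^sub>v (p \<triangleleft> asc q p q)) \<circ>\<^sub>v asc p qp q)"
    by (rule vc_dc_const(3)[symmetric]) simp_all
  also have "(((pq \<triangleleft> m') \<circ>\<^sub>v asc' p q pq) \<circ>\<^sub>v (p \<triangleleft> asc q p q)) \<circ>\<^sub>v asc p qp q = (pq \<triangleleft> m') \<circ>\<^sub>v ?D"
    using pent by (simp add: vc_assoc)
  finally have XY: "(asc' p q ua \<circ>\<^sub>v (?X ;\<^sub>v ?Y)) \<circ>\<^sub>v asc p ub q = ?X' ;\<^sub>v ((pq \<triangleleft> m') \<circ>\<^sub>v ?D)" .
  \<comment> \<open>Interchange of the two elements m and m' of M, with the constraints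
    \<open>?D\<close> carried along.\<close>
  have E: "(m \<triangleright> ua) \<circ>\<^sub>v ((pq \<triangleleft> m') \<circ>\<^sub>v ?D) = ((m \<triangleright> pq) \<circ>\<^sub>v ?D) ;\<^sub>v (ua \<triangleleft> m')"
  proof -
    have "(m \<triangleright> ua) \<circ>\<^sub>v ((pq \<triangleleft> m') \<circ>\<^sub>v ?D) = ((m \<triangleright> ua) \<circ>\<^sub>v (pq \<triangleleft> m')) \<circ>\<^sub>v ?D"
      by (simp add: vc_assoc)
    also have "\<dots> = ((m \<triangleright> pq) ;\<^sub>v (ua \<triangleleft> m')) \<circ>\<^sub>v ?D"
      using rw_vc_lw[of m m'] rw_dc_lw[of m m'] by simp
    also have "\<dots> = ((m \<triangleright> pq) \<circ>\<^sub>v ?D) ;\<^sub>v (ua \<triangleleft> m')"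
      by (rule vc_dc_const(2)) simp_all
    finally show ?thesis .
  qed
  have "m \<circ>\<^sub>v (p \<triangleleft> tri p q n m') = (m \<circ>\<^sub>v run pq) \<circ>\<^sub>v (((asc' p q ua \<circ>\<^sub>v (?X ;\<^sub>v ?Y)) \<circ>\<^sub>v asc p ub q) \<circ>\<^sub>v (run' p \<triangleright> q))"
    by (simp add: tri_def lw_vc lw_dc r l vc_assoc)
  also have "m \<circ>\<^sub>v run pq = run ua \<circ>\<^sub>v (m \<triangleright> ua)"
    using run_rw[of m] by simp
  also have "(run ua \<circ>\<^sub>v (m \<triangleright> ua)) \<circ>\<^sub>v (((asc' p q ua \<circ>\<^sub>v (?X ;\<^sub>v ?Y)) \<circ>\<^sub>v asc p ub q) \<circ>\<^sub>v (run' p \<triangleright> q))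
     = (run ua \<circ>\<^sub>v ((m \<triangleright> ua) \<circ>\<^sub>v (?X' ;\<^sub>v ((pq \<triangleleft> m') \<circ>\<^sub>v ?D)))) \<circ>\<^sub>v (run' p \<triangleright> q)"
    unfolding XY by (simp add: vc_assoc)
  also have "(m \<triangleright> ua) \<circ>\<^sub>v (?X' ;\<^sub>v ((pq \<triangleleft> m') \<circ>\<^sub>v ?D)) = ?G ;\<^sub>v (ua \<triangleleft> m')"
    by (rule vc_dc_assoc[symmetric, OF _ _ _ _ _ _ _ _ _ _ _ E]) simp_all
  finally have L: "m \<circ>\<^sub>v (p \<triangleleft> tri p q n m') = ?K" .

  have "(lun p \<triangleright> q) \<circ>\<^sub>v (m \<triangleright> p \<triangleright> q) = lun pq \<circ>\<^sub>v (asc ua p q \<circ>\<^sub>v (m \<triangleright> p \<triangleright> q))"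
    using lun_HComp1[of p q] by (simp add: vc_assoc[symmetric])
  also have "asc ua p q \<circ>\<^sub>v (m \<triangleright> p \<triangleright> q) = (m \<triangleright> pq) \<circ>\<^sub>v asc pq p q"
    using asc_rw_rw[of m p q] by simp
  finally have lm: "(lun p \<triangleright> q) \<circ>\<^sub>v (m \<triangleright> p \<triangleright> q) = lun pq \<circ>\<^sub>v ((m \<triangleright> pq) \<circ>\<^sub>v asc pq p q)" .
  have "btri p q m n \<triangleright> q = ((lun p \<triangleright> q) \<circ>\<^sub>v (m \<triangleright> p \<triangleright> q)) \<circ>\<^sub>v ((asc' p q p \<triangleright> q) \<circ>\<^sub>v (?X' \<circ>\<^sub>v (run' p \<triangleright> q)))"
    by (simp add: btri_def rw_vc vc_assoc)
  also have "\<dots> = lun pq \<circ>\<^sub>v (?G \<circ>\<^sub>v (run' p \<triangleright> q))"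
    unfolding lm by (simp add: vc_assoc)
  finally have "(btri p q m n \<triangleright> q) ;\<^sub>v m' = (lun pq \<circ>\<^sub>v (?G \<circ>\<^sub>v (run' p \<triangleright> q))) ;\<^sub>v m'"
    by simp
  also have "\<dots> = (?G \<circ>\<^sub>v (run' p \<triangleright> q)) ;\<^sub>v (m' \<circ>\<^sub>v lun pq)"
    by (rule vc_dc_const(3)[symmetric]) simp_all
  \<comment> \<open>Naturality yields \<open>lun\<close> of the unit 1-cell, which
    \<open>lun_Unit1\<close> replaces by the \<open>run\<close> occurring in
    \<open>?K\<close>.\<close>
  also have "m' \<circ>\<^sub>v lun pq = run ua \<circ>\<^sub>v (ua \<triangleleft> m')"
    using lun_lw[of m'] lun_Unit1[of A] by simp
  also have "(?G \<circ>\<^sub>v (run' p \<triangleright> q)) ;\<^sub>v (run ua \<circ>\<^sub>v (ua \<triangleleft> m')) = ?K"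
    by (simp add: vc_dc_const(1,2))
  finally show ?thesis using L by simp
qed

section \<open>The given context in terms of 2-cells\<close>

private abbreviation "Q \<equiv> ctx_Q \<B> A B q"
private abbreviation "P \<equiv> ctx_P V \<B> A B p"
private abbreviation "N \<equiv> ctx_N V \<B> A B p q"
private abbreviation "M \<equiv> ctx_M V \<B> A B p q"

private lemma ctx_sel:
  "Car Q = Hom2 \<B> q q" "Mul Q = VCmp \<B> q q q" "Uni Q = VId \<B> q"
  "Car P = Hom2 \<B> p p" "Mul P = VCmp \<B> p p p \<cdot> swap V (Hom2 \<B> p p) (Hom2 \<B> p p)" "Uni P = VId \<B> p"
  "LAlg N = Q" "RAlg N = P" "BCar N = Hom2 \<B> ub qp"
  "LAct N = VCmp \<B> ub qp qp \<cdot> (rwhisker V \<B> q q p \<odot> Idn V (Hom2 \<B> ub qp))"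
  "RAct N = VCmp \<B> ub qp qp \<cdot> (lwhisker V \<B> q p p \<odot> Idn V (Hom2 \<B> ub qp)) \<cdot> swap V (Hom2 \<B> ub qp) (Hom2 \<B> p p)"
  "LAlg M = P" "RAlg M = Q" "BCar M = Hom2 \<B> pq ua"
  "LAct M = VCmp \<B> pq pq ua \<cdot> (Idn V (Hom2 \<B> pq ua) \<odot> rwhisker V \<B> p p q) \<cdot> swap V (Hom2 \<B> p p) (Hom2 \<B> pq ua)"
  "RAct M = VCmp \<B> pq pq ua \<cdot> (Idn V (Hom2 \<B> pq ua) \<odot> lwhisker V \<B> p q q)"
  by (simp_all add: ctx_Q_def ctx_P_def ctx_N_def ctx_M_def Let_def end_algebra_def op_algebra_def)

text \<open>Proved for arbitrary cells and not just generic ones, because the laws evaluate the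
  pairing on cells that have already been acted upon.\<close>

lemma triangle0_eq:
  assumes [simp]: "cell n" "dom2 n = ub" "cod2 n = qp" "cell m" "dom2 m = pq" "cod2 m = ua"
  shows "triangle0 V \<B> A B p q \<in> hom V (Hom2 \<B> ub qp \<otimes> Hom2 \<B> pq ua) (Hom2 \<B> q q)"
    "bil (triangle0 V \<B> A B p q) (val n) (val m) = val (tri p q n m)"
proof -
  note [simp] = pq_simps
  let ?C = "HomCat \<B> B A"
  let ?rw = "rwhisker V \<B> ub qp q" and ?lw = "lwhisker V \<B> q pq ua"
  let ?V = "VCmp \<B> (ub \<Zspot> q) (qp \<Zspot> q) (q \<Zspot> ua)"
  let ?a = "precomp V ?C (qp \<Zspot> q) (q \<Zspot> pq) (q \<Zspot> ua) (EAssoc \<B> q p q)"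
  let ?r = "postcomp V ?C (ub \<Zspot> q) (q \<Zspot> ua) q (ERUnit \<B> q)"
  let ?l = "precomp V ?C q (ub \<Zspot> q) q (uinv V ?C (ub \<Zspot> q) q (ELUnit \<B> q))"
  have c: "cell (asc q p q)" "cell (run q)" "cell (lun' q)" by simp_all
  have e: "EAssoc \<B> q p q \<in> Arr V" "Dom V (EAssoc \<B> q p q) = Unt V"
      "Cod V (EAssoc \<B> q p q) = Hom2 \<B> (qp \<Zspot> q) (q \<Zspot> pq)"
      "ERUnit \<B> q \<in> Arr V" "Dom V (ERUnit \<B> q) = Unt V" "Cod V (ERUnit \<B> q) = Hom2 \<B> (q \<Zspot> ua) q"
    "uinv V ?C (ub \<Zspot> q) q (ELUnit \<B> q) \<in> Arr V"
    "Dom V (uinv V ?C (ub \<Zspot> q) q (ELUnit \<B> q)) = Unt V"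
    "Cod V (uinv V ?C (ub \<Zspot> q) q (ELUnit \<B> q)) = Hom2 \<B> q (ub \<Zspot> q)"
    using cellD(5,6)[OF c(1)] cellD(5,6)[OF c(2)] cellD(5,6)[OF c(3)]
    by (simp_all add: asc_def run_def lun'_def elem_def con_def obj_def)
  have t [simp]: "?a \<in> Arr V" "Dom V ?a = Hom2 \<B> (q \<Zspot> pq) (q \<Zspot> ua)" "Cod V ?a = Hom2 \<B> (qp \<Zspot> q) (q \<Zspot> ua)"
    "?r \<in> Arr V" "Dom V ?r = Hom2 \<B> (ub \<Zspot> q) (q \<Zspot> ua)" "Cod V ?r = Hom2 \<B> (ub \<Zspot> q) q"
    "?l \<in> Arr V" "Dom V ?l = Hom2 \<B> (ub \<Zspot> q) q" "Cod V ?l = Hom2 \<B> q q"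
    using e by (simp_all add: precomp_def postcomp_def)
  have D: "triangle0 V \<B> A B p q = ?l \<cdot> ?r \<cdot> ?V \<cdot> ((?a \<cdot> ?lw) \<odot> ?rw) \<cdot> swap V (Hom2 \<B> ub qp) (Hom2 \<B> pq ua)"
    by (simp add: triangle0_def Let_def)
  show "triangle0 V \<B> A B p q \<in> hom V (Hom2 \<B> ub qp \<otimes> Hom2 \<B> pq ua) (Hom2 \<B> q q)"
    unfolding D by (simp add: in_hom_iff)
  let ?S = "swap V (Hom2 \<B> (ub \<Zspot> q) (qp \<Zspot> q)) (Hom2 \<B> (qp \<Zspot> q) (q \<Zspot> ua))"
  have "val ((q \<triangleleft> m) \<circ>\<^sub>v asc q p q) = app ?a (app ?lw (val m))"
    using val_vc_cst(2)[of "q \<triangleleft> m", OF _ c(1)[unfolded asc_def], of B A] by (simp add: asc_def val_simps)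
  then have "val ((n \<triangleright> q) ;\<^sub>v ((q \<triangleleft> m) \<circ>\<^sub>v asc q p q)) = bil (?V \<cdot> ?S) (app ?rw (val n)) (app (?a \<cdot> ?lw) (val m))"
    by (simp add: val_simps(2,3) app_app)
  also have "\<dots> = bil ((?V \<cdot> ?S) \<cdot> (?rw \<odot> (?a \<cdot> ?lw))) (val n) (val m)"
    by (rule bil_TenA[symmetric]) simp_all
  \<comment> \<open>Naturality turns the \<open>swap\<close> of the whiskered hom-objects contained
    in \<open>;\<^sub>v\<close> into the \<open>swap\<close> of the hom-objects of n and m used by
    \<open>triangle0\<close>.\<close>
  also have "(?V \<cdot> ?S) \<cdot> (?rw \<odot> (?a \<cdot> ?lw)) = ?V \<cdot> ((?a \<cdot> ?lw) \<odot> ?rw) \<cdot> swap V (Hom2 \<B> ub qp) (Hom2 \<B> pq ua)"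
    by (simp add: swap_nat)
  finally have X: "val ((n \<triangleright> q) ;\<^sub>v ((q \<triangleleft> m) \<circ>\<^sub>v asc q p q))
     = bil (?V \<cdot> ((?a \<cdot> ?lw) \<odot> ?rw) \<cdot> swap V (Hom2 \<B> ub qp) (Hom2 \<B> pq ua)) (val n) (val m)" .
  have "val (run q \<circ>\<^sub>v ((n \<triangleright> q) ;\<^sub>v ((q \<triangleleft> m) \<circ>\<^sub>v asc q p q))) = app ?r (val ((n \<triangleright> q) ;\<^sub>v ((q \<triangleleft> m) \<circ>\<^sub>v asc q p q)))"
    using val_vc_cst(1)[of "((n \<triangleright> q) ;\<^sub>v ((q \<triangleleft> m) \<circ>\<^sub>v asc q p q))", OF _ c(2)[unfolded run_def], of B A] by (simp add: run_def[of q])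
  moreover have "val ((run q \<circ>\<^sub>v ((n \<triangleright> q) ;\<^sub>v ((q \<triangleleft> m) \<circ>\<^sub>v asc q p q))) \<circ>\<^sub>v lun' q) = app ?l (val (run q \<circ>\<^sub>v ((n \<triangleright> q) ;\<^sub>v ((q \<triangleleft> m) \<circ>\<^sub>v asc q p q))))"
    using val_vc_cst(2)[of "run q \<circ>\<^sub>v ((n \<triangleright> q) ;\<^sub>v ((q \<triangleleft> m) \<circ>\<^sub>v asc q p q))", OF _ c(3)[unfolded lun'_def], of B A] by (simp add: lun'_def[of q])
  ultimately have "val (tri p q n m) = app ?l (app ?r (val ((n \<triangleright> q) ;\<^sub>v ((q \<triangleleft> m) \<circ>\<^sub>v asc q p q))))"
    unfolding tri_def by simp
  then show "bil (triangle0 V \<B> A B p q) (val n) (val m) = val (tri p q n m)"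
    unfolding D X by simp
qed

lemma blacktriangle0_eq:
  assumes [simp]: "cell n" "dom2 n = ub" "cod2 n = qp" "cell m" "dom2 m = pq" "cod2 m = ua"
  shows "blacktriangle0 V \<B> A B p q \<in> hom V (Hom2 \<B> pq ua \<otimes> Hom2 \<B> ub qp) (Hom2 \<B> p p)"
    "bil (blacktriangle0 V \<B> A B p q) (val m) (val n) = val (btri p q m n)"
proof -
  note [simp] = pq_simps
  let ?C = "HomCat \<B> A B"
  let ?lw = "lwhisker V \<B> p ub qp" and ?rw = "rwhisker V \<B> pq ua p"
  let ?V = "VCmp \<B> (p \<Zspot> ub) (p \<Zspot> qp) (ua \<Zspot> p)"
  let ?e = "uinv V ?C (pq \<Zspot> p) (p \<Zspot> qp) (EAssoc \<B> p q p)"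
  let ?f = "uinv V ?C (p \<Zspot> ub) p (ERUnit \<B> p)"
  let ?a = "precomp V ?C (p \<Zspot> qp) (pq \<Zspot> p) (ua \<Zspot> p) ?e"
  let ?l = "postcomp V ?C (p \<Zspot> ub) (ua \<Zspot> p) p (ELUnit \<B> p)"
  let ?r = "precomp V ?C p (p \<Zspot> ub) p ?f"
  have c: "cell (asc' p q p)" "cell (lun p)" "cell (run' p)" by simp_all
  have e: "?e \<in> Arr V" "Dom V ?e = Unt V" "Cod V ?e = Hom2 \<B> (p \<Zspot> qp) (pq \<Zspot> p)"
      "ELUnit \<B> p \<in> Arr V" "Dom V (ELUnit \<B> p) = Unt V" "Cod V (ELUnit \<B> p) = Hom2 \<B> (ua \<Zspot> p) p"
      "?f \<in> Arr V" "Dom V ?f = Unt V" "Cod V ?f = Hom2 \<B> p (p \<Zspot> ub)"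
    using cellD(5,6)[OF c(1)] cellD(5,6)[OF c(2)] cellD(5,6)[OF c(3)]
    by (simp_all add: asc'_def lun_def run'_def elem_def con_def obj_def)
  have t [simp]: "?a \<in> Arr V" "Dom V ?a = Hom2 \<B> (pq \<Zspot> p) (ua \<Zspot> p)" "Cod V ?a = Hom2 \<B> (p \<Zspot> qp) (ua \<Zspot> p)"
    "?l \<in> Arr V" "Dom V ?l = Hom2 \<B> (p \<Zspot> ub) (ua \<Zspot> p)" "Cod V ?l = Hom2 \<B> (p \<Zspot> ub) p"
    "?r \<in> Arr V" "Dom V ?r = Hom2 \<B> (p \<Zspot> ub) p" "Cod V ?r = Hom2 \<B> p p"
    using e by (simp_all add: precomp_def postcomp_def)
  have D: "blacktriangle0 V \<B> A B p q = ?r \<cdot> ?l \<cdot> ?V \<cdot> ((?a \<cdot> ?rw) \<odot> ?lw)"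
    by (simp add: blacktriangle0_def Let_def)
  show "blacktriangle0 V \<B> A B p q \<in> hom V (Hom2 \<B> pq ua \<otimes> Hom2 \<B> ub qp) (Hom2 \<B> p p)"
    unfolding D by (simp add: in_hom_iff)
  have "val ((m \<triangleright> p) \<circ>\<^sub>v asc' p q p) = app ?a (app ?rw (val m))"
    using val_vc_cst(2)[of "m \<triangleright> p", OF _ c(1)[unfolded asc'_def], of A B] by (simp add: asc'_def val_simps)
  then have X: "val (((m \<triangleright> p) \<circ>\<^sub>v asc' p q p) \<circ>\<^sub>v (p \<triangleleft> n)) = bil (?V \<cdot> ((?a \<cdot> ?rw) \<odot> ?lw)) (val m) (val n)"
    by (simp add: val_simps(1)[of _ "p \<triangleleft> n"] val_simps(4) app_app bil_TenA)
  have "val (lun p \<circ>\<^sub>v (((m \<triangleright> p) \<circ>\<^sub>v asc' p q p) \<circ>\<^sub>v (p \<triangleleft> n))) = app ?l (val (((m \<triangleright> p) \<circ>\<^sub>v asc' p q p) \<circ>\<^sub>v (p \<triangleleft> n)))"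
    using val_vc_cst(1)[of "(((m \<triangleright> p) \<circ>\<^sub>v asc' p q p) \<circ>\<^sub>v (p \<triangleleft> n))", OF _ c(2)[unfolded lun_def], of A B] by (simp add: lun_def[of p])
  moreover have "val ((lun p \<circ>\<^sub>v (((m \<triangleright> p) \<circ>\<^sub>v asc' p q p) \<circ>\<^sub>v (p \<triangleleft> n))) \<circ>\<^sub>v run' p) = app ?r (val (lun p \<circ>\<^sub>v (((m \<triangleright> p) \<circ>\<^sub>v asc' p q p) \<circ>\<^sub>v (p \<triangleleft> n))))"
    using val_vc_cst(2)[of "lun p \<circ>\<^sub>v (((m \<triangleright> p) \<circ>\<^sub>v asc' p q p) \<circ>\<^sub>v (p \<triangleleft> n))", OF _ c(3)[unfolded run'_def], of A B] by (simp add: run'_def[of p])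
  ultimately have "val (btri p q m n) = app ?r (app ?l (val (((m \<triangleright> p) \<circ>\<^sub>v asc' p q p) \<circ>\<^sub>v (p \<triangleleft> n))))"
    unfolding btri_def by simp
  then show "bil (blacktriangle0 V \<B> A B p q) (val m) (val n) = val (btri p q m n)"
    unfolding D X by simp
qed

text \<open>The dictionary between the context and cells: the operations defined with a
  \<open>swap\<close> become \<open>;\<^sub>v\<close>, the others \<open>\<circ>\<^sub>v\<close>,
  and the arguments keep their order.\<close>

private lemma ctx_ops:
  "\<lbrakk>cell f; cell f'; dom2 f = q; cod2 f = q; dom2 f' = q; cod2 f' = q\<rbrakk>
    \<Longrightarrow> bil (Mul Q) (val f) (val f') = val (f \<circ>\<^sub>v f')"
  "\<lbrakk>cell g; cell g'; dom2 g = p; cod2 g = p; dom2 g' = p; cod2 g' = p\<rbrakk>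
    \<Longrightarrow> bil (Mul P) (val g) (val g') = val (g ;\<^sub>v g')"
  "\<lbrakk>cell n; dom2 n = ub; cod2 n = qp; cell f; dom2 f = q; cod2 f = q\<rbrakk>
    \<Longrightarrow> bil (LAct N) (val f) (val n) = val ((f \<triangleright> p) \<circ>\<^sub>v n)"
  "\<lbrakk>cell n; dom2 n = ub; cod2 n = qp; cell g; dom2 g = p; cod2 g = p\<rbrakk>
    \<Longrightarrow> bil (RAct N) (val n) (val g) = val (n ;\<^sub>v (q \<triangleleft> g))"
  "\<lbrakk>cell m; dom2 m = pq; cod2 m = ua; cell g; dom2 g = p; cod2 g = p\<rbrakk>
    \<Longrightarrow> bil (LAct M) (val g) (val m) = val ((g \<triangleright> q) ;\<^sub>v m)"
  "\<lbrakk>cell m; dom2 m = pq; cod2 m = ua; cell f; dom2 f = q; cod2 f = q\<rbrakk>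
    \<Longrightarrow> bil (RAct M) (val m) (val f) = val (m \<circ>\<^sub>v (p \<triangleleft> f))"
  "con (Uni Q) = val (ident q)" "con (Uni P) = val (ident p)"
  using pq_simps
  by (simp_all add: ctx_sel vc_def dc_def rw_def lw_def bil_app_left bil_app_right swap_nat)

lemma morita_context_of_cells:
  assumes coequalizers: "monoidal_category_with_coequalizers V"
  shows "is_algebra V Q" "is_algebra V P" "is_bimodule V N" "is_bimodule V M"
    "\<exists>tri btri. tri \<in> Cell2 (Bim V) (N \<bullet>\<^bsub>Bim V\<^esub> M) (Unit1 (Bim V) Q) \<and>
       tri \<cdot> proj V N M = triangle0 V \<B> A B p q \<and>
       btri \<in> Cell2 (Bim V) (M \<bullet>\<^bsub>Bim V\<^esub> N) (Unit1 (Bim V) P) \<and>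
       btri \<cdot> proj V M N = blacktriangle0 V \<B> A B p q \<and>
       morita_context (Bim V) Q P N M tri btri"
proof -
  note [simp] = pq_simps
  \<comment> \<open>Generic cells; being dense, they suffice for testing every law.\<close>
  define n where "n = (ub, qp, gen (Hom2 \<B> ub qp))"
  define m where "m = (pq, ua, gen (Hom2 \<B> pq ua))"
  define f where "f = (q, q, gen (Hom2 \<B> q q))"
  define g where "g = (p, p, gen (Hom2 \<B> p p))"
  have c [simp]: "cell n" "dom2 n = ub" "cod2 n = qp" "cell m" "dom2 m = pq" "cod2 m = ua"
    "cell f" "dom2 f = q" "cod2 f = q" "cell g" "dom2 g = p" "cod2 g = p"
    by (auto simp: n_def m_def f_def g_def intro!: cellI)
  have d [simp]: "dense (val n)" "dense (val m)" "dense (val f)" "dense (val g)"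
    by (simp_all add: n_def m_def f_def g_def)
  have t [simp]: "cell (tri p q n m)" "dom2 (tri p q n m) = q" "cod2 (tri p q n m) = q"
    "cell (btri p q m n)" "dom2 (btri p q m n) = p" "cod2 (btri p q m n) = p"
    by (simp_all add: tri_def btri_def)
  have Q_laws: "bil (Mul Q) (bil (Mul Q) (val f) (val f)) (val f) = bil (Mul Q) (val f) (bil (Mul Q) (val f) (val f))"
    "bil (Mul Q) (con (Uni Q)) (val f) = val f" "bil (Mul Q) (val f) (con (Uni Q)) = val f"
    \<comment> \<open>The rule \<open>ident_simps(4)\<close> would rewrite
      \<open>val (ident q)\<close> into a constant again and undo \<open>ctx_ops\<close>.\<close>
    by (simp_all add: ctx_ops vc_assoc vc_ident del: ident_simps(4))
  show Q: "is_algebra V Q"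
    by (rule is_algebraI[OF _ _ _ _ _ _ d(3) _ Q_laws]) (simp_all add: ctx_sel)
  have P_laws: "bil (Mul P) (bil (Mul P) (val g) (val g)) (val g) = bil (Mul P) (val g) (bil (Mul P) (val g) (val g))"
    "bil (Mul P) (con (Uni P)) (val g) = val g" "bil (Mul P) (val g) (con (Uni P)) = val g"
    by (simp_all add: ctx_ops dc_assoc dc_ident del: ident_simps(4))
  show P: "is_algebra V P"
    by (rule is_algebraI[OF _ _ _ _ _ _ d(4) _ P_laws]) (simp_all add: ctx_sel)
  \<comment> \<open>The actions of Q and P on N commute by mixed associativity; the square is
    interchange of f with g.\<close>
  have "((f \<triangleright> p) \<circ>\<^sub>v n) ;\<^sub>v (q \<triangleleft> g) = (f \<triangleright> p) \<circ>\<^sub>v (n ;\<^sub>v (q \<triangleleft> g))"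
    by (rule vc_dc_assoc) (use rw_vc_lw[of f g] rw_dc_lw[of f g] in simp_all)
  then have N_laws:
    "bil (LAct N) (bil (Mul (LAlg N)) (val f) (val f)) (val n) = bil (LAct N) (val f) (bil (LAct N) (val f) (val n))"
    "bil (RAct N) (bil (RAct N) (val n) (val g)) (val g) = bil (RAct N) (val n) (bil (Mul (RAlg N)) (val g) (val g))"
    "bil (RAct N) (bil (LAct N) (val f) (val n)) (val g) = bil (LAct N) (val f) (bil (RAct N) (val n) (val g))"
    "bil (LAct N) (con (Uni (LAlg N))) (val n) = val n" "bil (RAct N) (val n) (con (Uni (RAlg N))) = val n"
    by (simp_all add: ctx_sel(7,8) ctx_ops rw_vc lw_dc vc_assoc dc_assoc rw_ident lw_ident vc_ident dc_ident
        del: ident_simps(4))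
  show N: "is_bimodule V N"
    by (rule is_bimoduleI[OF _ _ _ _ _ _ _ _ d(3) _ d(1) _ d(4) _ N_laws])
      (simp_all add: ctx_sel(7,8) Q P, simp_all add: ctx_sel)
  \<comment> \<open>On M the square is interchange of g with f, the roles of the two actions being
    exchanged.\<close>
  have "((g \<triangleright> q) ;\<^sub>v m) \<circ>\<^sub>v (p \<triangleleft> f) = (g \<triangleright> q) ;\<^sub>v (m \<circ>\<^sub>v (p \<triangleleft> f))"
    by (rule dc_vc_assoc) (use rw_vc_lw[of g f] rw_dc_lw[of g f] in simp_all)
  then have M_laws:
    "bil (LAct M) (bil (Mul (LAlg M)) (val g) (val g)) (val m) = bil (LAct M) (val g) (bil (LAct M) (val g) (val m))"
    "bil (RAct M) (bil (RAct M) (val m) (val f)) (val f) = bil (RAct M) (val m) (bil (Mul (RAlg M)) (val f) (val f))"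
    "bil (RAct M) (bil (LAct M) (val g) (val m)) (val f) = bil (LAct M) (val g) (bil (RAct M) (val m) (val f))"
    "bil (LAct M) (con (Uni (LAlg M))) (val m) = val m" "bil (RAct M) (val m) (con (Uni (RAlg M))) = val m"
    by (simp_all add: ctx_sel(12,13) ctx_ops rw_dc lw_vc vc_assoc dc_assoc rw_ident lw_ident vc_ident dc_ident
        del: ident_simps(4))
  show M: "is_bimodule V M"
    by (rule is_bimoduleI[OF _ _ _ _ _ _ _ _ d(4) _ d(2) _ d(3) _ M_laws])
      (simp_all add: ctx_sel(12,13) Q P, simp_all add: ctx_sel)
  have T: "bil (triangle0 V \<B> A B p q) (val n') (val m') = val (tri p q n' m')"
      "bil (blacktriangle0 V \<B> A B p q) (val m') (val n') = val (btri p q m' n')"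
    if "cell n'" "dom2 n' = ub" "cod2 n' = qp" "cell m'" "dom2 m' = pq" "cod2 m' = ua" for n' m'
    using triangle0_eq(2) blacktriangle0_eq(2) that by auto
  note S = ctx_sel(7,8,12,13) ctx_ops T
  show "\<exists>tri btri. tri \<in> Cell2 (Bim V) (N \<bullet>\<^bsub>Bim V\<^esub> M) (Unit1 (Bim V) Q) \<and>
       tri \<cdot> proj V N M = triangle0 V \<B> A B p q \<and>
       btri \<in> Cell2 (Bim V) (M \<bullet>\<^bsub>Bim V\<^esub> N) (Unit1 (Bim V) P) \<and>
       btri \<cdot> proj V M N = blacktriangle0 V \<B> A B p q \<and>
       morita_context (Bim V) Q P N M tri btri"
  proof (rule monoidal_category_with_coequalizers.Bim_morita_contextI[OF coequalizers N _ _ M _ _ _ _ d(1) _ d(2) _ d(3) _ d(4)])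
    show "triangle0 V \<B> A B p q \<in> hom V (BCar N \<otimes> BCar M) (Car Q)"
      "blacktriangle0 V \<B> A B p q \<in> hom V (BCar M \<otimes> BCar N) (Car P)"
      using triangle0_eq(1)[of n m] blacktriangle0_eq(1)[of n m] by (simp_all add: ctx_sel)
    show "bil (triangle0 V \<B> A B p q) (bil (RAct N) (val n) (val g)) (val m) =
        bil (triangle0 V \<B> A B p q) (val n) (bil (LAct M) (val g) (val m))"
      using tri_balanced[of n m g] by (simp add: S)
    show "bil (triangle0 V \<B> A B p q) (bil (LAct N) (val f) (val n)) (val m) =
        bil (Mul Q) (val f) (bil (triangle0 V \<B> A B p q) (val n) (val m))"
      using tri_left_linear[of n m f] by (simp add: S)
    show "bil (triangle0 V \<B> A B p q) (val n) (bil (RAct M) (val m) (val f)) =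
        bil (Mul Q) (bil (triangle0 V \<B> A B p q) (val n) (val m)) (val f)"
      using tri_right_linear[of n m f] by (simp add: S)
    show "bil (blacktriangle0 V \<B> A B p q) (bil (RAct M) (val m) (val f)) (val n) =
        bil (blacktriangle0 V \<B> A B p q) (val m) (bil (LAct N) (val f) (val n))"
      using btri_balanced[of n m f] by (simp add: S)
    show "bil (blacktriangle0 V \<B> A B p q) (bil (LAct M) (val g) (val m)) (val n) =
        bil (Mul P) (val g) (bil (blacktriangle0 V \<B> A B p q) (val m) (val n))"
      using btri_left_linear[of n m g] by (simp add: S)
    show "bil (blacktriangle0 V \<B> A B p q) (val m) (bil (RAct N) (val n) (val g)) =
        bil (Mul P) (bil (blacktriangle0 V \<B> A B p q) (val m) (val n)) (val g)"
      using btri_right_linear[of n m g] by (simp add: S)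
    \<comment> \<open>The same generic cell n occurs twice, which is harmless because each
      occurrence contributes its own stages.\<close>
    show "bil (RAct N) (val n) (bil (blacktriangle0 V \<B> A B p q) (val m) (val n)) =
        bil (LAct N) (bil (triangle0 V \<B> A B p q) (val n) (val m)) (val n)"
      using act_btri[of n m n] by (simp add: S)
    show "bil (RAct M) (val m) (bil (triangle0 V \<B> A B p q) (val n) (val m)) =
        bil (LAct M) (bil (blacktriangle0 V \<B> A B p q) (val m) (val n)) (val m)"
      using act_tri[of n m m] by (simp add: S)
  qed (simp_all add: ctx_sel n_def m_def f_def g_def)
qed

end

end

theorem theorem3p3:
  fixes V :: "('o, 'm) braided_category"
    and \<B> :: "('a, 'b, 'o, 'm) enriched_bicategory"
    and A B :: 'a
    and p q :: 'b
  assumes "monoidal_category_with_coequalizers V"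
    and "braided_category V"
    and "enriched_bicategory V \<B>"
    and "A \<in> Cell0 \<B>" and "B \<in> Cell0 \<B>"
    and "p \<in> hom1 \<B> A B" and "q \<in> hom1 \<B> B A"
  shows "let Q = ctx_Q \<B> A B q; P = ctx_P V \<B> A B p;
             N = ctx_N V \<B> A B p q; M = ctx_M V \<B> A B p q;
             BimV = Bim V
         in Q \<in> Cell0 BimV \<and> P \<in> Cell0 BimV \<and>
            N \<in> hom1 BimV Q P \<and>
            M \<in> hom1 BimV P Q \<and>
            (\<exists>tri btri.
               tri \<in> Cell2 BimV (N \<bullet>\<^bsub>BimV\<^esub> M) (Unit1 BimV Q) \<and>
               tri \<cdot>\<^bsub>V\<^esub> proj V N M = triangle0 V \<B> A B p q \<and>
               btri \<in> Cell2 BimV (M \<bullet>\<^bsub>BimV\<^esub> N) (Unit1 BimV P) \<and>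
               btri \<cdot>\<^bsub>V\<^esub> proj V M N = blacktriangle0 V \<B> A B p q \<and>
               morita_context BimV Q P N M tri btri)"
proof -
  note T = enriched_bicategory.morita_context_of_cells[OF assms(3,6,7,1)]
  note M = monoidal_category_with_coequalizers.Bim_simps[OF assms(1)]
  have "LAlg (ctx_N V \<B> A B p q) = ctx_Q \<B> A B q" "RAlg (ctx_N V \<B> A B p q) = ctx_P V \<B> A B p"
    "LAlg (ctx_M V \<B> A B p q) = ctx_P V \<B> A B p" "RAlg (ctx_M V \<B> A B p q) = ctx_Q \<B> A B q"
    by (simp_all add: ctx_N_def ctx_M_def Let_def)
  then show ?thesis using T(1-4) T(5) unfolding Let_def by (simp add: hom1_def M(1-4))
qed

end
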